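(* Let $L$ and $\tilde L$ be two boundary value problems of the form described in the context, with coefficients $p,q$ and $\tilde p,\tilde q$ respectively, such that for $j=2,\dots,m$ we have $p_j=\tilde p_j$ in $AC[0,\pi]$ and $q_j=\tilde q_j$ in $L(0,\pi)$. Let $\Lambda$ be a subspectrum of $L$ and $\tilde\Lambda$ a subspectrum of $\tilde L$. Suppose that $\Lambda$ is of four-sequence form, $\Lambda=\tilde\Lambda$, and assumptions $(A)$ and $(B)$ hold for both pairs $(L,\Lambda)$ and $(\tilde L,\tilde\Lambda)$. Then $p_1=\tilde p_1$ in $AC[0,\pi]$ and $q_1=\tilde q_1$ in $L(0,\pi)$. Thus, under these assumptions, the problem of finding $p_1,q_1$ from $\{p_j\}_{j=2}^m$, $\{q_j\}_{j=2}^m$ and $\Lambda$ has a unique solution.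
   Context: Let $m\ge 2$ be an integer. The graph $G$ has vertices $v_1,\dots,v_m$ and edges $e_1,\dots,e_m$ of length $\pi$; for $j\le m-1$ the edge $e_j$ joins the boundary vertex $v_j$ ($x_j=0$) to the internal vertex $v_m$ ($x_j=\pi$), and $e_m$ is a loop at $v_m$. The boundary value problem $L$ is $$-y_j''(x_j)+q_j(x_j)y_j(x_j)+2\lambda p_j(x_j)y_j(x_j)=\lambda^2y_j(x_j),\quad x_j\in(0,\pi),\ j=1,\dots,m,$$ $$y_j(0)=0,\ j=1,\dots,m-1;\qquad y_m(0)=y_j(\pi),\ j=1,\dots,m;\qquad y_m'(0)=\sum_{j=1}^m y_j'(\pi),$$ with complex-valued $p_j\in AC[0,\pi]$ (absolutely continuous), $q_j\in L(0,\pi)$ (integrable), and $y_j,y_j'$ absolutely continuous on $[0,\pi]$. Objects with a tilde are the analogous objects for $\tilde L$. Put $\alpha_j=\frac1\pi\int_0^\pi p_j(t)\,dt$. $S_j(x_j,\lambda)$, $C_j(x_j,\lambda)$ are the solutions of the $j$-th equation with $S_j(0,\lambda)=C_j'(0,\lambda)=0$, $S_j'(0,\lambda)=C_j(0,\lambda)=1$, and $d_m(\lambda)=S_m'(\pi,\lambda)+C_m(\pi,\lambda)-2$. The eigenvalues of $L$ are counted with multiplicity as the zeros of $$\Delta(\lambda)=\sum_{j=1}^{m-1}S_j'(\pi,\lambda)\prod_{k=1,\,k\ne j}^m S_k(\pi,\lambda)+d_m(\lambda)\prod_{k=1}^{m-1}S_k(\pi,\lambda).$$ A subspectrum $\Lambda=\{\lambda_\theta\}_{\theta\in\Theta}$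 of $L$ ($\Theta$ a countable index set) is a family of eigenvalues, possibly with repeated values, such that the number $m_\theta$ of indices $\tau\in\Theta$ with $\lambda_\tau=\lambda_\theta$ does not exceed the multiplicity of $\lambda_\theta$ as an eigenvalue. $\Lambda=\tilde\Lambda$ means equality of the indexed families. The notation $a\equiv b\pmod c$ means $\frac{a-b}c\in\mathbb Z$. Four-sequence form: $\Lambda=\{\lambda_{nk}\}_{(n,k)\in\mathcal N}$ with $\mathcal N=\{(n,1):n\in\mathbb Z\setminus\{0\}\}\cup\{(n,k):n\in\mathbb Z,\ k=2,3,4\}$ and $\lambda_{nk}=2n+\beta_k+O(|n|^{-1})$ as $|n|\to\infty$, $k=1,\dots,4$, where $\beta_1,\dots,\beta_4\in(-1,1)$ are distinct and $\beta_k\not\equiv\alpha_j\pmod1$ for $k=1,\dots,4$, $j=1,\dots,m-1$. Assumption $(A)$: (i) $\alpha_j\in\mathbb R$, $j=1,\dots,m$; (ii) $\alpha_j\not\equiv\alpha_k\pmod1$ for $j\ne k$ in $\{1,\dots,m\}$; (iii) $\alpha_m=0$. Assumption $(B)$ for $(L,\Lambda)$: $\Theta=\Theta_1\cup\Theta_2$, where (i) for each $\theta\in\Theta_1$, $S_j(\pi,\lambda_\theta)\ne0$ for $j=2,\dots,m$; (ii) for each $\theta\in\Theta_2$ there is an index $j_\theta\in\{2,\dots,m\}$ such that $S_{j_\theta}(\pi,\lambda_\theta)=0$ and $S_j(\pi,\lambda_\theta)\neq0$ for all $j\in\{2,\dots,m\}\setminus\{j_\theta\}$; if $j_\theta=m$,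 then additionally $d_m(\lambda_\theta)\ne0$. *)

theory Defs
  imports "HOL-Complex_Analysis.Complex_Analysis" "HOL-Library.Landau_Symbols"
begin

(* Absolute continuity of functions; the library's absolutely_continuous is about measures. *)
definition abs_cont_on :: "real \<Rightarrow> real \<Rightarrow> (real \<Rightarrow> complex) \<Rightarrow> bool" where
  "abs_cont_on a b f \<longleftrightarrow>
     (\<forall>\<epsilon>>0. \<exists>\<delta>>0. \<forall>(n::nat) u v.
        (\<forall>i<n. a \<le> u i \<and> u i \<le> v i \<and> v i \<le> b) \<and>
        (\<forall>i<n. \<forall>j<n. i \<noteq> j \<longrightarrow> {u i<..<v i} \<inter> {u j<..<v j} = {}) \<and>
        (\<Sum>i<n. v i - u i) < \<delta>
        \<longrightarrow> (\<Sum>i<n. norm (f (v i) - f (u i))) < \<epsilon>)"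

definition coefficients :: "nat \<Rightarrow> (nat \<Rightarrow> real \<Rightarrow> complex) \<Rightarrow> (nat \<Rightarrow> real \<Rightarrow> complex) \<Rightarrow> bool" where
  "coefficients m p q \<longleftrightarrow>
     (\<forall>j\<in>{1..m}. abs_cont_on 0 pi (p j) \<and> q j absolutely_integrable_on {0<..<pi})"

definition eq_AC :: "(real \<Rightarrow> complex) \<Rightarrow> (real \<Rightarrow> complex) \<Rightarrow> bool" where
  "eq_AC f g \<longleftrightarrow> (\<forall>x\<in>{0..pi}. f x = g x)"

definition eq_L :: "(real \<Rightarrow> complex) \<Rightarrow> (real \<Rightarrow> complex) \<Rightarrow> bool" where
  "eq_L f g \<longleftrightarrow> (AE x in lebesgue_on {0<..<pi}. f x = g x)"

(* y' is carried along explicitly as dy; derivatives at 0 and pi are one-sided.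
   As q is only integrable, the equation is required almost everywhere. *)
definition edge_solution ::
  "(real \<Rightarrow> complex) \<Rightarrow> (real \<Rightarrow> complex) \<Rightarrow> complex \<Rightarrow> (real \<Rightarrow> complex) \<Rightarrow> (real \<Rightarrow> complex) \<Rightarrow> bool" where
  "edge_solution p q lam y dy \<longleftrightarrow>
     abs_cont_on 0 pi y \<and> abs_cont_on 0 pi dy \<and>
     (\<forall>x\<in>{0..pi}. (y has_vector_derivative dy x) (at x within {0..pi})) \<and>
     (AE x in lebesgue_on {0<..<pi}. \<exists>d2y. (dy has_vector_derivative d2y) (at x) \<and>
        - d2y + q x * y x + 2 * lam * p x * y x = lam\<^sup>2 * y x)"

definition bvp_solution ::
  "nat \<Rightarrow> (nat \<Rightarrow> real \<Rightarrow> complex) \<Rightarrow> (nat \<Rightarrow> real \<Rightarrow> complex) \<Rightarrow> complex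
     \<Rightarrow> (nat \<Rightarrow> real \<Rightarrow> complex) \<Rightarrow> (nat \<Rightarrow> real \<Rightarrow> complex) \<Rightarrow> bool" where
  "bvp_solution m p q lam y dy \<longleftrightarrow>
     (\<forall>j\<in>{1..m}. edge_solution (p j) (q j) lam (y j) (dy j)) \<and>
     (\<forall>j\<in>{1..m-1}. y j 0 = 0) \<and>
     (\<forall>j\<in>{1..m}. y m 0 = y j pi) \<and>
     dy m 0 = (\<Sum>j=1..m. dy j pi)"

definition eigenvalue ::
  "nat \<Rightarrow> (nat \<Rightarrow> real \<Rightarrow> complex) \<Rightarrow> (nat \<Rightarrow> real \<Rightarrow> complex) \<Rightarrow> complex \<Rightarrow> bool" where
  "eigenvalue m p q lam \<longleftrightarrow>
     (\<exists>y dy. bvp_solution m p q lam y dy \<and> (\<exists>j\<in>{1..m}. \<exists>x\<in>{0..pi}. y j x \<noteq> 0))"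

(* The pair (y, y') solving the initial value problem y(0) = a, y'(0) = b; for admissible
   coefficients it exists and is determined on [0, pi], so the choice is immaterial there. *)
definition ivp ::
  "(real \<Rightarrow> complex) \<Rightarrow> (real \<Rightarrow> complex) \<Rightarrow> complex \<Rightarrow> complex \<Rightarrow> complex
     \<Rightarrow> (real \<Rightarrow> complex) \<times> (real \<Rightarrow> complex)" where
  "ivp p q a b lam =
     (SOME u. edge_solution p q lam (fst u) (snd u) \<and> fst u 0 = a \<and> snd u 0 = b)"

definition sol_S :: "(real \<Rightarrow> complex) \<Rightarrow> (real \<Rightarrow> complex) \<Rightarrow> real \<Rightarrow> complex \<Rightarrow> complex" where
  "sol_S p q x lam = fst (ivp p q 0 1 lam) x"

definition deriv_S :: "(real \<Rightarrow> complex) \<Rightarrow> (real \<Rightarrow> complex) \<Rightarrow> real \<Rightarrow> complex \<Rightarrow> complex" where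
  "deriv_S p q x lam = snd (ivp p q 0 1 lam) x"

definition sol_C :: "(real \<Rightarrow> complex) \<Rightarrow> (real \<Rightarrow> complex) \<Rightarrow> real \<Rightarrow> complex \<Rightarrow> complex" where
  "sol_C p q x lam = fst (ivp p q 1 0 lam) x"

definition d_loop :: "(real \<Rightarrow> complex) \<Rightarrow> (real \<Rightarrow> complex) \<Rightarrow> complex \<Rightarrow> complex" where
  "d_loop p q lam = deriv_S p q pi lam + sol_C p q pi lam - 2"

definition char_fun ::
  "nat \<Rightarrow> (nat \<Rightarrow> real \<Rightarrow> complex) \<Rightarrow> (nat \<Rightarrow> real \<Rightarrow> complex) \<Rightarrow> complex \<Rightarrow> complex" where
  "char_fun m p q lam =
     (\<Sum>j=1..m-1. deriv_S (p j) (q j) pi lam * (\<Prod>k\<in>{1..m} - {j}. sol_S (p k) (q k) pi lam))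
     + d_loop (p m) (q m) lam * (\<Prod>k=1..m-1. sol_S (p k) (q k) pi lam)"

(* The multiplicity of an eigenvalue is its order as a zero of char_fun, which is entire and
   not identically zero. *)
definition subspectrum ::
  "nat \<Rightarrow> (nat \<Rightarrow> real \<Rightarrow> complex) \<Rightarrow> (nat \<Rightarrow> real \<Rightarrow> complex) \<Rightarrow> 'i set \<Rightarrow> ('i \<Rightarrow> complex) \<Rightarrow> bool" where
  "subspectrum m p q \<Theta> \<Lambda> \<longleftrightarrow>
     countable \<Theta> \<and>
     (\<forall>\<theta>\<in>\<Theta>. eigenvalue m p q (\<Lambda> \<theta>) \<and>
        finite {\<tau>\<in>\<Theta>. \<Lambda> \<tau> = \<Lambda> \<theta>} \<and>
        int (card {\<tau>\<in>\<Theta>. \<Lambda> \<tau> = \<Lambda> \<theta>}) \<le> zorder (char_fun m p q) (\<Lambda> \<theta>))"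

definition alpha :: "(nat \<Rightarrow> real \<Rightarrow> complex) \<Rightarrow> nat \<Rightarrow> complex" where
  "alpha p j = (1 / complex_of_real pi) * integral {0..pi} (p j)"

definition cong_mod :: "complex \<Rightarrow> complex \<Rightarrow> complex \<Rightarrow> bool" where
  "cong_mod a b c \<longleftrightarrow> (a - b) / c \<in> \<int>"

definition four_index_set :: "(int \<times> nat) set" where
  "four_index_set = {(n, 1) | n. n \<noteq> 0} \<union> {(n, k) | n k. k \<in> {2, 3, 4}}"

definition four_sequence_form ::
  "nat \<Rightarrow> (nat \<Rightarrow> real \<Rightarrow> complex) \<Rightarrow> (int \<times> nat) set \<Rightarrow> (int \<times> nat \<Rightarrow> complex) \<Rightarrow> bool" where
  "four_sequence_form m p \<Theta> \<Lambda> \<longleftrightarrow>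
     \<Theta> = four_index_set \<and>
     (\<exists>\<beta> :: nat \<Rightarrow> real.
        (\<forall>k\<in>{1..4}. \<beta> k \<in> {-1<..<1}) \<and> inj_on \<beta> {1..4} \<and>
        (\<forall>k\<in>{1..4}. \<forall>j\<in>{1..m-1}. \<not> cong_mod (\<beta> k) (alpha p j) 1) \<and>
        (\<forall>k\<in>{1..4}. (\<lambda>n::int. \<Lambda> (n, k) - (2 * of_int n + of_real (\<beta> k)))
           \<in> O[sup at_top at_bot](\<lambda>n. complex_of_real (1 / real_of_int \<bar>n\<bar>))))"

definition assumption_A :: "nat \<Rightarrow> (nat \<Rightarrow> real \<Rightarrow> complex) \<Rightarrow> bool" where
  "assumption_A m p \<longleftrightarrow>
     (\<forall>j\<in>{1..m}. alpha p j \<in> \<real>) \<and>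
     (\<forall>j\<in>{1..m}. \<forall>k\<in>{1..m}. j \<noteq> k \<longrightarrow> \<not> cong_mod (alpha p j) (alpha p k) 1) \<and>
     alpha p m = 0"

definition assumption_B ::
  "nat \<Rightarrow> (nat \<Rightarrow> real \<Rightarrow> complex) \<Rightarrow> (nat \<Rightarrow> real \<Rightarrow> complex) \<Rightarrow> 'i set \<Rightarrow> ('i \<Rightarrow> complex) \<Rightarrow> bool" where
  "assumption_B m p q \<Theta> \<Lambda> \<longleftrightarrow>
     (\<exists>\<Theta>\<^sub>1 \<Theta>\<^sub>2. \<Theta> = \<Theta>\<^sub>1 \<union> \<Theta>\<^sub>2 \<and>
        (\<forall>\<theta>\<in>\<Theta>\<^sub>1. \<forall>j\<in>{2..m}. sol_S (p j) (q j) pi (\<Lambda> \<theta>) \<noteq> 0) \<and>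
        (\<forall>\<theta>\<in>\<Theta>\<^sub>2. \<exists>i\<in>{2..m}.
           sol_S (p i) (q i) pi (\<Lambda> \<theta>) = 0 \<and>
           (\<forall>j\<in>{2..m} - {i}. sol_S (p j) (q j) pi (\<Lambda> \<theta>) \<noteq> 0) \<and>
           (i = m \<longrightarrow> d_loop (p m) (q m) (\<Lambda> \<theta>) \<noteq> 0)))"

(* (p1, q1) solves the inverse problem with data p j, q j for 2 <= j <= m and Lambda; the
   entries p 1, q 1 are overwritten and hence not part of the data. *)
definition inverse_solution ::
  "nat \<Rightarrow> (nat \<Rightarrow> real \<Rightarrow> complex) \<Rightarrow> (nat \<Rightarrow> real \<Rightarrow> complex) \<Rightarrow> 'i set \<Rightarrow> ('i \<Rightarrow> complex)
     \<Rightarrow> (real \<Rightarrow> complex) \<Rightarrow> (real \<Rightarrow> complex) \<Rightarrow> bool" where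
  "inverse_solution m p q \<Theta> \<Lambda> p1 q1 \<longleftrightarrow>
     coefficients m (p(1 := p1)) (q(1 := q1)) \<and>
     subspectrum m (p(1 := p1)) (q(1 := q1)) \<Theta> \<Lambda> \<and>
     assumption_A m (p(1 := p1)) \<and>
     assumption_B m (p(1 := p1)) (q(1 := q1)) \<Theta> \<Lambda>"

end

theory Submission
  imports Defs
begin

text \<open>
  The unknown first edge enters the characteristic function only through the values of
  \<open>S\<^sub>1\<close> and \<open>S\<^sub>1'\<close> at \<open>\<pi>\<close>: one has \<open>\<Delta> = S\<^sub>1' A + S\<^sub>1 B\<close> with entire functions \<open>A\<close>, \<open>B\<close> that are
  built from the other edges and hence are the same for both problems (\<open>char_fun_split\<close>).
  With \<open>T\<^sub>1\<close> in place of \<open>S\<^sub>1\<close> for the second problem, consider the cross product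
  \<open>D = S\<^sub>1 T\<^sub>1' - T\<^sub>1 S\<^sub>1'\<close> at \<open>\<pi>\<close>. Both \<open>D A\<close> and \<open>D B\<close> are combinations of the two
  characteristic functions with entire coefficients, so they vanish at every point of the
  subspectrum to the order of its multiplicity. Assumption (B) ensures that \<open>A\<close> and \<open>B\<close>
  have no common zero there (\<open>rest_not_both_zero\<close>), so \<open>D\<close> itself vanishes to that order.

  On the other hand \<open>D\<close> is too small to have so many zeros. As the mean of \<open>p\<^sub>1\<close> is real, the
  leading terms of the solutions give \<open>\<lambda> D(\<lambda>) = O(1) + o(exp (2 \<pi> |Im \<lambda>|))\<close>
  (\<open>cross_growth\<close>). The product of the four sines \<open>sin (\<pi> (\<lambda> - \<beta>\<^sub>k) / 2)\<close> also has the size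
  \<open>exp (2 \<pi> |Im \<lambda>|)\<close>, and its zeros are asymptotically the points of the subspectrum, with one
  point more. The missing point costs one power of \<open>\<lambda>\<close>, which is the power gained in
  \<open>\<lambda> D(\<lambda>)\<close>; comparing \<open>D\<close> with the product yields \<open>D = 0\<close>
  (\<open>entire_zero_if_too_many_zeros\<close>).

  Finally \<open>D = 0\<close> means that the quotient \<open>S\<^sub>1' / S\<^sub>1\<close> at \<open>\<pi>\<close>, the Weyl function of the first edge,
  is the same for both problems, and the Weyl function determines the coefficients
  (\<open>edge_uniqueness\<close>). Indeed, let \<open>s\<close>, \<open>c\<close> and \<open>\<sigma>\<close>, \<open>\<kappa>\<close> be the sine and cosine type solutions of the
  two equations started at the vertex \<open>\<pi>\<close>. Equality of the Weyl functions lets one write the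
  entire function \<open>s \<kappa> - \<sigma> c\<close> of \<open>\<lambda>\<close> as a quotient that is bounded and tends to zero along the
  imaginary axis, so it vanishes by Liouville's theorem. Together with the Wronskian identities this
  gives \<open>s\<^sup>2 = \<sigma>\<^sup>2\<close>, hence equality of \<open>q + 2 \<lambda> p\<close> almost everywhere for each \<open>\<lambda>\<close>, and the values
  \<open>\<lambda> = 0\<close> and \<open>\<lambda> = 1\<close> separate \<open>q\<close> from \<open>p\<close>.

  The analytic input is the existence of solutions that are entire in \<open>\<lambda>\<close> (Picard iteration,
  whose iterates are polynomials in \<open>\<lambda>\<close>) and their asymptotics (\<open>edge_asymptotics\<close>), which rest on
  Lebesgue's theorems about absolutely continuous functions and indefinite integrals.
\<close>

section \<open>The fundamental theorem for absolutely continuous functions\<close>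

text \<open>The families of intervals in the definition are numbered by an initial segment of the naturals; partitions
  of an interval come as finite sets, so the condition is needed for arbitrary finite index sets.\<close>

lemma abs_cont_on_finite_sum:
  assumes "abs_cont_on a b f" "\<epsilon> > 0"
  shows "\<exists>\<delta>>0. \<forall>(I :: 'i set) u v. finite I \<longrightarrow> (\<forall>i\<in>I. a \<le> u i \<and> u i \<le> v i \<and> v i \<le> b)
      \<longrightarrow> (\<forall>i\<in>I. \<forall>j\<in>I. i \<noteq> j \<longrightarrow> {u i<..<v i} \<inter> {u j<..<v j} = {})
      \<longrightarrow> (\<Sum>i\<in>I. v i - u i) < \<delta> \<longrightarrow> (\<Sum>i\<in>I. norm (f (v i) - f (u i))) < \<epsilon>"
proof -
  from assms(1)[unfolded abs_cont_on_def, rule_format, OF assms(2)] obtain \<delta> where \<delta>1: "\<delta> > 0"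
    and "\<forall>(n::nat) u v.
        (\<forall>i<n. a \<le> u i \<and> u i \<le> v i \<and> v i \<le> b) \<and>
        (\<forall>i<n. \<forall>j<n. i \<noteq> j \<longrightarrow> {u i<..<v i} \<inter> {u j<..<v j} = {}) \<and>
        (\<Sum>i<n. v i - u i) < \<delta>
        \<longrightarrow> (\<Sum>i<n. norm (f (v i) - f (u i))) < \<epsilon>"
    by (elim exE conjE)
  note \<delta> = \<delta>1 this(2)[rule_format, OF conjI, OF _ conjI]
  show ?thesis
  proof (intro exI[of _ \<delta>] conjI allI impI, fact \<delta>(1))
    fix I :: "'i set" and u v
    assume I: "finite I" and uv: "\<forall>i\<in>I. a \<le> u i \<and> u i \<le> v i \<and> v i \<le> b"
      and dj: "\<forall>i\<in>I. \<forall>j\<in>I. i \<noteq> j \<longrightarrow> {u i<..<v i} \<inter> {u j<..<v j} = {}"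
      and s: "(\<Sum>i\<in>I. v i - u i) < \<delta>"
    from ex_bij_betw_nat_finite[OF I] obtain h where h: "bij_betw h {0..<card I} I" by blast
    then have h': "bij_betw h {..<card I} I" by (simp add: lessThan_atLeast0)
    have hI: "h i \<in> I" if "i < card I" for i using h' that by (auto simp: bij_betw_def)
    have "(\<Sum>i<card I. norm (f (v (h i)) - f (u (h i)))) < \<epsilon>"
    proof (rule \<delta>(2); (intro allI impI)?)
      fix i assume "i < card I"
      from bspec[OF uv hI[OF this]]
      show "a \<le> u (h i) \<and> u (h i) \<le> v (h i) \<and> v (h i) \<le> b" .
    next
      fix i j assume ij: "i < card I" "j < card I" "i \<noteq> j"
      have "h i \<noteq> h j" using h' ij by (auto simp: bij_betw_def inj_on_def)
      with dj hI ij show "{u (h i)<..<v (h i)} \<inter> {u (h j)<..<v (h j)} = {}" by simp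
    next
      show "(\<Sum>i<card I. v (h i) - u (h i)) < \<delta>"
        using s sum.reindex_bij_betw[OF h', of "\<lambda>i. v i - u i"] by simp
    qed
    then show "(\<Sum>i\<in>I. norm (f (v i) - f (u i))) < \<epsilon>"
      using sum.reindex_bij_betw[OF h', of "\<lambda>i. norm (f (v i) - f (u i))"] by simp
  qed
qed

text \<open>A Riemann sum with a gauge splits according to the tags. At a tag outside \<open>N\<close> differentiability
  controls the error. The intervals tagged in \<open>N\<close> are forced by the gauge into an open set of small
  measure around \<open>N\<close>, where absolute continuity makes the increments of \<open>f\<close> small in total.\<close>

lemma abs_cont_on_FTC:
  fixes f :: "real \<Rightarrow> complex"
  assumes ab: "a \<le> b" and ac: "abs_cont_on a b f" and N: "negligible N"
    and der: "\<And>x. x \<in> {a..b} - N \<Longrightarrow> (f has_vector_derivative f' x) (at x within {a..b})"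
  shows "(f' has_integral (f b - f a)) {a..b}"
proof -
  define g where "g x = (if x \<in> N then 0 else f' x)" for x
  have "(g has_integral (f b - f a)) {a..b}"
    unfolding has_integral[of g _ a b, unfolded box_real]
  proof safe
    fix e0 :: real
    assume "e0 > 0"
    define e where "e = e0 / (2 * (b - a + 1))"
    have e: "e > 0" using \<open>e0 > 0\<close> ab by (auto simp: e_def)
    have "\<forall>x. \<exists>d>0. x \<in> {a..b} - N \<longrightarrow>
         (\<forall>y\<in>{a..b}. norm (y-x) < d \<longrightarrow> norm (f y - f x - (y-x) *\<^sub>R f' x) \<le> e * norm (y-x))"
    proof
      fix x
      show "\<exists>d>0. x \<in> {a..b} - N \<longrightarrow>
         (\<forall>y\<in>{a..b}. norm (y-x) < d \<longrightarrow> norm (f y - f x - (y-x) *\<^sub>R f' x) \<le> e * norm (y-x))"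
      proof (cases "x \<in> {a..b} - N")
        case True
        from der[OF this] e show ?thesis
          unfolding has_vector_derivative_def has_derivative_within_alt by blast
      qed (use zero_less_one in blast)
    qed
    then obtain d where d: "\<And>x. 0 < d x"
       "\<And>x y. \<lbrakk>x \<in> {a..b} - N; y \<in> {a..b}; norm (y-x) < d x\<rbrakk>
                        \<Longrightarrow> norm (f y - f x - (y-x) *\<^sub>R f' x) \<le> e * norm (y-x)"
      by metis
    have "e0/2 > 0" using \<open>e0 > 0\<close> by simp
    from abs_cont_on_finite_sum[OF ac this, where ?'i = "real \<times> real set"] obtain \<delta> where \<delta>0: "\<delta> > 0" and
      "\<forall>(I :: (real \<times> real set) set) u v. finite I \<longrightarrow> (\<forall>i\<in>I. a \<le> u i \<and> u i \<le> v i \<and> v i \<le> b)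
      \<longrightarrow> (\<forall>i\<in>I. \<forall>j\<in>I. i \<noteq> j \<longrightarrow> {u i<..<v i} \<inter> {u j<..<v j} = {})
      \<longrightarrow> (\<Sum>i\<in>I. v i - u i) < \<delta> \<longrightarrow> (\<Sum>i\<in>I. norm (f (v i) - f (u i))) < e0/2"
      by (elim exE conjE)
    note \<delta> = \<delta>0 this(2)[rule_format]
    obtain U where U: "open U" "N \<subseteq> U" "(U - N) \<in> lmeasurable" "emeasure lebesgue (U - N) < ennreal \<delta>"
      using sets_lebesgue_outer_open[OF negligible_imp_sets[OF N] \<delta>(1)] by metis
    have Um: "U \<in> lmeasurable"
      using U N by (metis Diff_Un Un_Diff_cancel2 fmeasurable.Un negligible_imp_measurable sup.absorb1)
    have mU: "measure lebesgue U < \<delta>"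
    proof -
      have "measure lebesgue U \<le> measure lebesgue (U - N) + measure lebesgue N"
        using measure_Un_le[of "U - N" lebesgue N] U N
        by (metis Un_Diff_cancel2 fmeasurableD negligible_imp_measurable sup.absorb1)
      moreover have "measure lebesgue N = 0" using N negligible_imp_measure0 by blast
      moreover have "measure lebesgue (U - N) < \<delta>"
        using U(3,4) \<delta>(1) by (simp add: emeasure_eq_measure2 ennreal_less_iff)
      ultimately show ?thesis by linarith
    qed
    obtain r where r: "\<And>x. x \<in> U \<Longrightarrow> r x > 0 \<and> ball x (r x) \<subseteq> U"
    proof -
      have "\<forall>x\<in>U. \<exists>e>0. ball x e \<subseteq> U" using U(1) by (simp add: open_contains_ball)
      then show thesis using that by metis
    qed
    \<comment> \<open>a gauge that keeps intervals tagged in \<open>N\<close> inside \<open>U\<close>\<close>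
    define G where "G x = (if x \<in> N then ball x (r x) else ball x (d x))" for x
    show "\<exists>\<gamma>. gauge \<gamma> \<and> (\<forall>\<D>. \<D> tagged_division_of {a..b} \<and> \<gamma> fine \<D> \<longrightarrow>
            norm ((\<Sum>(x, k)\<in>\<D>. measure lborel k *\<^sub>R g x) - (f b - f a)) < e0)"
    proof (rule exI[of _ G], safe)
      show "gauge G"
        unfolding gauge_def G_def using r U(2) d(1) by auto
      fix p
      assume p: "p tagged_division_of {a..b}" and fine: "G fine p"
      have fp: "finite p" using p by auto
      define l h where "l z = Inf (snd z)" and "h z = Sup (snd z)" for z :: "real \<times> real set"
      have uv: "snd z = {l z..h z} \<and> l z \<le> fst z \<and> fst z \<le> h z \<and> a \<le> l z \<and> h z \<le> b \<and> snd z \<subseteq> G (fst z)"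
        if zp: "z \<in> p" for z
      proof -
        obtain x K where z: "z = (x,K)" by force
        have inp: "(x,K) \<in> p" using zp z by simp
        have xK: "x \<in> K" "K \<subseteq> {a..b}" using p inp by blast+
        obtain u v where K: "K = {u..v}" using tagged_division_ofD(4)[OF p inp] by (metis box_real(2))
        have ux: "u \<le> x" "x \<le> v" using xK K by auto
        have "a \<le> u" "v \<le> b" using xK(2) K ux by auto
        moreover have "K \<subseteq> G x" using fine inp by (auto simp: fine_def)
        ultimately show ?thesis using K ux by (auto simp: z l_def h_def)
      qed
      define p1 where "p1 = {z \<in> p. fst z \<in> N}"
      have split: "p = p1 \<union> (p - p1)" "p1 \<inter> (p - p1) = {}" "finite p1" "finite (p - p1)"
        using fp by (auto simp: p1_def)
      have fba: "f b - f a = (\<Sum>z\<in>p. f (h z) - f (l z))"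
        using additive_tagged_division_1[OF ab p, of f] by (simp add: split_def l_def h_def)
      have ba: "b - a = (\<Sum>z\<in>p. (h z) - (l z))"
        using additive_tagged_division_1[OF ab p, of "\<lambda>x. x"] by (simp add: split_def l_def h_def)
      have dj: "{l i<..<h i} \<inter> {l j<..<h j} = {}"
        if "i \<in> p" "j \<in> p" "i \<noteq> j" for i j
      proof -
        have "interior (snd i) \<inter> interior (snd j) = {}"
          using tagged_division_ofD(5)[OF p, of "fst i" "snd i" "fst j" "snd j"] that by (auto simp: prod_eq_iff)
        moreover have "snd i = {l i..h i}" "snd j = {l j..h j}"
          using uv[OF \<open>i \<in> p\<close>] uv[OF \<open>j \<in> p\<close>] by blast+
        ultimately show ?thesis by (metis interior_atLeastAtMost_real)
      qed
      have s1: "(\<Sum>z\<in>p1. norm (f (h z) - f (l z))) < e0/2"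
      proof (rule \<delta>(2))
        show "finite p1" by fact
        show "a \<le> l i \<and> l i \<le> h i \<and> h i \<le> b" if "i \<in> p1" for i
          using uv[of i] that by (auto simp: p1_def)
        show "{l i<..<h i} \<inter> {l j<..<h j} = {}"
          if "i \<in> p1" "j \<in> p1" "i \<noteq> j" for i j
          using dj that by (auto simp: p1_def)
        have "(\<Sum>i\<in>p1. h i - l i) = (\<Sum>i\<in>p1. measure lebesgue {l i<..<h i})"
        proof (rule sum.cong)
          fix i assume "i \<in> p1"
          then show "h i - l i = measure lebesgue {l i<..<h i}"
            using uv[of i] by (auto simp: p1_def)
        qed simp
        also have "\<dots> = measure lebesgue (\<Union>i\<in>p1. {l i<..<h i})"
          by (rule measure_UNION'[symmetric]) (use split(3) dj in \<open>auto simp: p1_def pairwise_def disjnt_def\<close>)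
        also have "\<dots> \<le> measure lebesgue U"
        proof (rule measure_mono_fmeasurable)
          show "(\<Union>i\<in>p1. {l i<..<h i}) \<subseteq> U"
          proof (rule UN_least)
            fix i assume i: "i \<in> p1"
            then have "i \<in> p" "fst i \<in> N" by (auto simp: p1_def)
            then have "G (fst i) \<subseteq> U" using r U(2) by (auto simp: G_def)
            moreover have "{l i..h i} \<subseteq> G (fst i)" using uv[OF \<open>i \<in> p\<close>] by metis
            moreover have "{l i<..<h i} \<subseteq> {l i..h i}" by auto
            ultimately show "{l i<..<h i} \<subseteq> U" by blast
          qed
          show "(\<Union>i\<in>p1. {l i<..<h i}) \<in> sets lebesgue"
            using split(3) by auto
        qed (fact Um)
        finally show "(\<Sum>i\<in>p1. h i - l i) < \<delta>" using mU by linarith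
      qed
      have s2: "norm (\<Sum>z\<in>p-p1. measure lborel (snd z) *\<^sub>R g (fst z) - (f (h z) - f (l z)))
          \<le> (\<Sum>z\<in>p-p1. e * (h z - l z))"
      proof (rule sum_norm_le)
        fix z assume z: "z \<in> p - p1"
        define x u v where "x = fst z" and "u = l z" and "v = h z"
        have xN: "x \<notin> N" "z \<in> p" using z by (auto simp: p1_def x_def)
        have k: "snd z = {u..v}" "u \<le> x" "x \<le> v" "a \<le> u" "v \<le> b" "{u..v} \<subseteq> G x"
          using uv[OF xN(2)] by (auto simp: x_def u_def v_def)
        have B: "u \<in> ball x (d x)" "v \<in> ball x (d x)"
        proof -
          have "{u..v} \<subseteq> ball x (d x)" using k xN(1) by (simp add: G_def)
          moreover have "u \<in> {u..v}" "v \<in> {u..v}" using k by auto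
          ultimately show "u \<in> ball x (d x)" "v \<in> ball x (d x)" by blast+
        qed
        have xx: "x \<in> {a..b} - N" using k xN by auto
        have "norm ((v - u) *\<^sub>R f' x - (f v - f u)) = norm (f u - f x - (u - x) *\<^sub>R f' x - (f v - f x - (v - x) *\<^sub>R f' x))"
          by (auto simp: algebra_simps)
        also have "\<dots> \<le> norm (f u - f x - (u - x) *\<^sub>R f' x) + norm (f v - f x - (v - x) *\<^sub>R f' x)"
          by (rule norm_triangle_ineq4)
        also have "\<dots> \<le> e * norm (u - x) + e * norm (v - x)"
        proof (rule add_mono)
          show "norm (f u - f x - (u - x) *\<^sub>R f' x) \<le> e * norm (u - x)"
            by (rule d(2)[OF xx]) (use k B in \<open>auto simp: dist_real_def\<close>)
          show "norm (f v - f x - (v - x) *\<^sub>R f' x) \<le> e * norm (v - x)"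
            by (rule d(2)[OF xx]) (use k B in \<open>auto simp: dist_real_def\<close>)
        qed
        also have "\<dots> = e * (v - u)" using k by (simp add: algebra_simps)
        finally show "norm (measure lborel (snd z) *\<^sub>R g (fst z) - (f (h z) - f (l z))) \<le> e * (h z - l z)"
          using xN k by (simp add: g_def x_def[symmetric] u_def[symmetric] v_def[symmetric])
      qed
      also have "\<dots> \<le> (\<Sum>z\<in>p. e * (h z - l z))"
      proof (rule sum_mono2[OF fp])
        fix z assume "z \<in> p - (p - p1)"
        then show "0 \<le> e * (h z - l z)" using uv[of z] e by auto
      qed auto
      also have "\<dots> = e * (b - a)" by (simp add: ba sum_distrib_left)
      also have "\<dots> < e0 / 2" using ab \<open>e0 > 0\<close> by (simp add: e_def field_simps)
      finally have s2': "norm (\<Sum>z\<in>p-p1. measure lborel (snd z) *\<^sub>R g (fst z) - (f (h z) - f (l z))) < e0/2" .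
      have "(\<Sum>(x, k)\<in>p. measure lborel k *\<^sub>R g x) - (f b - f a) =
         (\<Sum>z\<in>p. measure lborel (snd z) *\<^sub>R g (fst z) - (f (h z) - f (l z)))"
        by (simp add: fba sum_subtractf split_def)
      also have "\<dots> = (\<Sum>z\<in>p1. measure lborel (snd z) *\<^sub>R g (fst z) - (f (h z) - f (l z))) +
         (\<Sum>z\<in>p-p1. measure lborel (snd z) *\<^sub>R g (fst z) - (f (h z) - f (l z)))"
        using sum.subset_diff[OF _ fp, of p1 "\<lambda>z. measure lborel (snd z) *\<^sub>R g (fst z) - (f (h z) - f (l z))"] split(1)
        by (subst add.commute) blast
      also have "(\<Sum>z\<in>p1. measure lborel (snd z) *\<^sub>R g (fst z) - (f (h z) - f (l z)))
         = - (\<Sum>z\<in>p1. f (h z) - f (l z))"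
        unfolding sum_negf[symmetric] by (rule sum.cong) (auto simp: p1_def g_def)
      finally have eq: "(\<Sum>(x, k)\<in>p. measure lborel k *\<^sub>R g x) - (f b - f a) =
          - (\<Sum>z\<in>p1. f (h z) - f (l z)) +
          (\<Sum>z\<in>p-p1. measure lborel (snd z) *\<^sub>R g (fst z) - (f (h z) - f (l z)))" .
      have "norm (\<Sum>z\<in>p1. f (h z) - f (l z)) < e0/2"
        using s1 norm_sum[of "\<lambda>z. f (h z) - f (l z)" p1] by linarith
      then show "norm ((\<Sum>(x, k)\<in>p. measure lborel k *\<^sub>R g x) - (f b - f a)) < e0"
        unfolding eq using s2' norm_triangle_ineq[of "- (\<Sum>z\<in>p1. f (h z) - f (l z))"
          "\<Sum>z\<in>p-p1. measure lborel (snd z) *\<^sub>R g (fst z) - (f (h z) - f (l z))"]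
        unfolding norm_minus_cancel by linarith
    qed
  qed
  then show ?thesis
    by (rule has_integral_spike[OF N, rotated]) (auto simp: g_def)
qed

section \<open>Indefinite Lebesgue integrals\<close>

lemma integral_Icc_diff:
  fixes f :: "real \<Rightarrow> 'a::banach"
  assumes "f integrable_on {a..b}" "a \<le> u" "u \<le> v" "v \<le> b"
  shows "integral {a..v} f - integral {a..u} f = integral {u..v} f"
proof -
  have "f integrable_on {a..v}" by (rule integrable_on_subinterval[OF assms(1)]) (use assms in auto)
  then have "integral {a..u} f + integral {u..v} f = integral {a..v} f"
    using assms by (intro Henstock_Kurzweil_Integration.integral_combine) auto
  then show ?thesis by (simp add: algebra_simps)
qed

lemma cball_midpoint_real: "cball ((x + y) / 2) (\<bar>y - x\<bar> / 2) = {min x y..max x (y::real)}"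
  by (auto simp: cball_eq_atLeastAtMost min_def max_def field_simps abs_if)

text \<open>Lebesgue's differentiation theorem. The exceptional points at level \<open>k\<close> are endpoints of arbitrarily
  short intervals on which the difference quotient is off by at least \<open>1/(k+1)\<close>. By Vitali's theorem
  countably many disjoint ones of them cover almost all exceptional points, and the Henstock lemma says that
  the errors over any such disjoint family add up to as little as desired; so the total length is
  arbitrarily small.\<close>

lemma indefinite_integral_derivative_ae:
  fixes f :: "real \<Rightarrow> complex"
  assumes f: "f integrable_on {a..b}"
  shows "\<exists>N. negligible N \<and> (\<forall>x\<in>{a<..<b} - N. ((\<lambda>t. integral {a..t} f) has_vector_derivative f x) (at x))"
proof -
  define F where "F t = integral {a..t} f" for t
  define bad where "bad k = {x \<in> {a<..<b}. \<forall>d>0. \<exists>y\<in>{a..b}. y \<noteq> x \<and> \<bar>y - x\<bar> < d \<and>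
      norm (F y - F x - (y - x) *\<^sub>R f x) > \<bar>y - x\<bar> / real (Suc k)}" for k
  have der: "(F has_vector_derivative f x) (at x)" if x: "x \<in> {a<..<b}" and nb: "\<And>k. x \<notin> bad k" for x
  proof -
    have "(F has_vector_derivative f x) (at x within {a..b})"
      unfolding has_vector_derivative_def has_derivative_within_alt
    proof (intro conjI allI impI)
      show "bounded_linear (\<lambda>h. h *\<^sub>R f x)" by (rule bounded_linear_scaleR_left)
      fix e :: real assume "e > 0"
      then obtain k where k: "1 / real (Suc k) < e" using nat_approx_posE by blast
      have "\<not> (\<forall>d>0. \<exists>y\<in>{a..b}. y \<noteq> x \<and> \<bar>y - x\<bar> < d \<and>
         norm (F y - F x - (y - x) *\<^sub>R f x) > \<bar>y - x\<bar> / real (Suc k))"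
      proof
        assume "\<forall>d>0. \<exists>y\<in>{a..b}. y \<noteq> x \<and> \<bar>y - x\<bar> < d \<and>
         norm (F y - F x - (y - x) *\<^sub>R f x) > \<bar>y - x\<bar> / real (Suc k)"
        with x have "x \<in> bad k" unfolding bad_def by (intro CollectI conjI)
        with nb[of k] show False by (rule notE)
      qed
      then obtain d where d: "d > 0" and "\<not> (\<exists>y\<in>{a..b}. y \<noteq> x \<and> \<bar>y - x\<bar> < d \<and>
         norm (F y - F x - (y - x) *\<^sub>R f x) > \<bar>y - x\<bar> / real (Suc k))"
        unfolding not_all not_imp by (elim exE conjE)
      note d = d this(2)
      show "\<exists>d>0. \<forall>y\<in>{a..b}. norm (y - x) < d \<longrightarrow>
             norm (F y - F x - (y - x) *\<^sub>R f x) \<le> e * norm (y - x)"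
      proof (intro exI[of _ d] conjI ballI impI, fact d(1))
        fix y assume y: "y \<in> {a..b}" "norm (y - x) < d"
        show "norm (F y - F x - (y - x) *\<^sub>R f x) \<le> e * norm (y - x)"
        proof (cases "y = x")
          case False
          have "norm (F y - F x - (y - x) *\<^sub>R f x) \<le> \<bar>y - x\<bar> * (1 / real (Suc k))"
          proof (rule ccontr)
            assume "\<not> ?thesis"
            then have "y \<noteq> x \<and> \<bar>y - x\<bar> < d \<and> norm (F y - F x - (y - x) *\<^sub>R f x) > \<bar>y - x\<bar> / real (Suc k)"
              using False y(2) by simp
            with y(1) d(2) show False by blast
          qed
          also have "\<dots> \<le> \<bar>y - x\<bar> * e" by (rule mult_left_mono) (use k in auto)
          finally show ?thesis by (simp add: mult.commute)
        qed simp
      qed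
    qed
    then show ?thesis using x by (simp add: at_within_Icc_at)
  qed
  have neg: "negligible (bad k)" for k
    unfolding negligible_outer_le
  proof (intro allI impI)
    fix e :: real assume "e > 0"
    then have e': "e / real (Suc k) > 0" by simp
    have "f integrable_on cbox a b" using f by simp
    from Henstock_lemma[OF this e'] obtain \<gamma> where \<gamma>: "gauge \<gamma>"
      "\<And>p. p tagged_partial_division_of (cbox a b) \<Longrightarrow> \<gamma> fine p \<Longrightarrow>
             (\<Sum>(x,k)\<in>p. norm (measure lborel k *\<^sub>R f x - integral k f)) < e / real (Suc k)" by blast
    define I where "I z = {min (fst z) (snd z)..max (fst z) (snd z)}" for z :: "real \<times> real"
    \<comment> \<open>a pair codes an interval together with the endpoint that serves as its tag\<close>
    define K where "K = {z. fst z \<in> bad k \<and> snd z \<in> {a..b} \<and> snd z \<noteq> fst z \<and> I z \<subseteq> \<gamma> (fst z) \<and>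
       norm (F (snd z) - F (fst z) - (snd z - fst z) *\<^sub>R f (fst z)) > \<bar>snd z - fst z\<bar> / real (Suc k)}"
    have Icb: "cball ((fst z + snd z) / 2) (\<bar>snd z - fst z\<bar> / 2) = I z" for z
      unfolding I_def cball_midpoint_real by (rule refl)
    obtain C where C: "countable C" "C \<subseteq> K"
       "pairwise (\<lambda>i j. disjnt (I i) (I j)) C" "negligible (bad k - (\<Union>i \<in> C. I i))"
    proof (rule Vitali_covering_theorem_cballs[of K "\<lambda>z. \<bar>snd z - fst z\<bar> / 2" "bad k" "\<lambda>z. (fst z + snd z) / 2", unfolded Icb])
      show "0 < \<bar>snd i - fst i\<bar> / 2" if "i \<in> K" for i using that by (auto simp: K_def)
      fix x d :: real assume x: "x \<in> bad k" and d: "d > 0"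
      have "open (\<gamma> x)" "x \<in> \<gamma> x" using \<gamma>(1) by (auto simp: gauge_def)
      then obtain \<rho> where \<rho>: "\<rho> > 0" "ball x \<rho> \<subseteq> \<gamma> x" by (auto simp: open_contains_ball)
      have "min d \<rho> > 0" using d \<rho> by simp
      then obtain y where y: "y \<in> {a..b}" "y \<noteq> x" "\<bar>y - x\<bar> < min d \<rho>"
         "norm (F y - F x - (y - x) *\<^sub>R f x) > \<bar>y - x\<bar> / real (Suc k)"
        using x unfolding bad_def by blast
      have "I (x,y) \<subseteq> ball x \<rho>" using y(3) by (auto simp: I_def dist_real_def min_def max_def abs_if split: if_splits)
      then have "(x,y) \<in> K" using y x \<rho> by (auto simp: K_def)
      moreover have "x \<in> I (x,y)" by (auto simp: I_def)
      moreover have "\<bar>y - x\<bar> / 2 < d" using y(3) by auto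
      ultimately show "\<exists>i. i \<in> K \<and> x \<in> I i \<and> \<bar>snd i - fst i\<bar> / 2 < d"
        by (intro exI[of _ "(x,y)"]) auto
    qed
    have bound: "measure lebesgue (\<Union>z\<in>J. I z) \<le> e" if J: "J \<subseteq> C" "finite J" for J
    proof -
      define p where "p = (\<lambda>z. (fst z, I z)) ` J"
      have JK: "z \<in> K" if "z \<in> J" for z using J C that by auto
      have ne: "fst z \<in> I z" for z by (auto simp: I_def)
      have inj: "inj_on (\<lambda>z. (fst z, I z)) J"
      proof (rule inj_onI)
        fix z w assume zw: "z \<in> J" "w \<in> J" "(fst z, I z) = (fst w, I w)"
        show "z = w"
        proof (rule ccontr)
          assume "z \<noteq> w"
          then have "disjnt (I z) (I w)" using C(3) zw(1,2) J(1) unfolding pairwise_def by blast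
          then show False using zw(3) ne[of z] by (simp add: disjnt_def)
        qed
      qed
      have "p tagged_partial_division_of (cbox a b)"
        unfolding tagged_partial_division_of_def
      proof (intro conjI allI impI)
        show "finite p" using J by (simp add: p_def)
        fix x L assume "(x,L) \<in> p"
        then obtain z where z: "z \<in> J" "x = fst z" "L = I z" by (auto simp: p_def)
        show "x \<in> L" using ne z by simp
        have "fst z \<in> {a<..<b}" "snd z \<in> {a..b}" using JK[OF z(1)] by (auto simp: K_def bad_def)
        then show "L \<subseteq> cbox a b" by (auto simp: z I_def)
        show "\<exists>a b. L = cbox a b" by (auto simp: z I_def)
      next
        fix x1 L1 x2 L2 assume "(x1,L1) \<in> p \<and> (x2,L2) \<in> p \<and> (x1,L1) \<noteq> (x2,L2)"
        then obtain z w where zw: "z \<in> J" "w \<in> J" "L1 = I z" "L2 = I w" "z \<noteq> w" by (auto simp: p_def)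
        then have "disjnt (I z) (I w)" using C(3) J(1) unfolding pairwise_def by blast
        then have "L1 \<inter> L2 = {}" using zw(3,4) by (simp add: disjnt_def)
        moreover have "interior L1 \<inter> interior L2 \<subseteq> L1 \<inter> L2" by (intro Int_mono interior_subset)
        ultimately show "interior L1 \<inter> interior L2 = {}" by simp
      qed
      moreover have "\<gamma> fine p" using JK by (auto simp: fine_def p_def K_def)
      ultimately have "(\<Sum>(x,k)\<in>p. norm (measure lborel k *\<^sub>R f x - integral k f)) < e / real (Suc k)"
        by (rule \<gamma>(2))
      also have "(\<Sum>(x,k)\<in>p. norm (measure lborel k *\<^sub>R f x - integral k f)) =
         (\<Sum>z\<in>J. norm (measure lborel (I z) *\<^sub>R f (fst z) - integral (I z) f))"
        unfolding p_def by (subst sum.reindex[OF inj]) (simp add: o_def)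
      finally have s: "(\<Sum>z\<in>J. norm (measure lborel (I z) *\<^sub>R f (fst z) - integral (I z) f)) < e / real (Suc k)" .
      have each: "\<bar>snd z - fst z\<bar> / real (Suc k) \<le> norm (measure lborel (I z) *\<^sub>R f (fst z) - integral (I z) f)"
        if z: "z \<in> J" for z
      proof -
        have z1: "fst z \<in> {a<..<b}" "snd z \<in> {a..b}" "snd z \<noteq> fst z"
          and z2: "norm (F (snd z) - F (fst z) - (snd z - fst z) *\<^sub>R f (fst z)) > \<bar>snd z - fst z\<bar> / real (Suc k)"
          using JK[OF z] by (auto simp: K_def bad_def)
        have "norm (measure lborel (I z) *\<^sub>R f (fst z) - integral (I z) f)
            = norm (F (snd z) - F (fst z) - (snd z - fst z) *\<^sub>R f (fst z))"
        proof (cases "fst z < snd z")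
          case True
          then have "I z = {fst z..snd z}" by (simp add: I_def)
          moreover have "F (snd z) - F (fst z) = integral {fst z..snd z} f"
            unfolding F_def by (rule integral_Icc_diff[OF f]) (use z1 True in auto)
          ultimately show ?thesis using True by (simp add: norm_minus_commute)
        next
          case False
          then have lt: "snd z < fst z" using z1 by auto
          then have "I z = {snd z..fst z}" by (simp add: I_def)
          moreover have "F (fst z) - F (snd z) = integral {snd z..fst z} f"
            unfolding F_def by (rule integral_Icc_diff[OF f]) (use z1 lt in auto)
          moreover have "(fst z - snd z) *\<^sub>R f (fst z) - (F (fst z) - F (snd z)) = F (snd z) - F (fst z) - (snd z - fst z) *\<^sub>R f (fst z)"
            by (simp add: algebra_simps)
          ultimately show ?thesis using lt by simp
        qed
        then show ?thesis using z2 by linarith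
      qed
      have "measure lebesgue (\<Union>z\<in>J. I z) \<le> (\<Sum>z\<in>J. measure lebesgue (I z))"
        by (rule measure_UNION_le[OF J(2)]) (auto simp: I_def)
      also have "\<dots> = (\<Sum>z\<in>J. \<bar>snd z - fst z\<bar>)"
        by (rule sum.cong) (auto simp: I_def min_def max_def)
      also have "\<dots> = real (Suc k) * (\<Sum>z\<in>J. \<bar>snd z - fst z\<bar> / real (Suc k))"
        by (simp add: sum_divide_distrib[symmetric])
      also have "\<dots> \<le> real (Suc k) * (\<Sum>z\<in>J. norm (measure lborel (I z) *\<^sub>R f (fst z) - integral (I z) f))"
        by (intro mult_left_mono sum_mono each) auto
      also have "\<dots> \<le> real (Suc k) * (e / real (Suc k))"
        using s by (intro mult_left_mono) auto
      finally show ?thesis by simp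
    qed
    have Im: "I z \<in> lmeasurable" for z by (auto simp: I_def)
    have U: "(\<Union>z\<in>C. I z) \<in> lmeasurable" "measure lebesgue (\<Union>z\<in>C. I z) \<le> e"
      using fmeasurable_UN_bound[OF C(1) Im bound] measure_UN_bound[OF C(1) Im bound] by auto
    have m0: "(bad k - (\<Union>z\<in>C. I z)) \<in> lmeasurable" "measure lebesgue (bad k - (\<Union>z\<in>C. I z)) = 0"
      using C(4) negligible_imp_measurable negligible_imp_measure0 by auto
    show "\<exists>T. bad k \<subseteq> T \<and> T \<in> lmeasurable \<and> measure lebesgue T \<le> e"
    proof (intro exI conjI)
      show "bad k \<subseteq> (bad k - (\<Union>z\<in>C. I z)) \<union> (\<Union>z\<in>C. I z)" by auto
      show "(bad k - (\<Union>z\<in>C. I z)) \<union> (\<Union>z\<in>C. I z) \<in> lmeasurable" using m0 U by (intro fmeasurable.Un)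
      show "measure lebesgue ((bad k - (\<Union>z\<in>C. I z)) \<union> (\<Union>z\<in>C. I z)) \<le> e"
        using measure_Un_le[of "bad k - (\<Union>z\<in>C. I z)" lebesgue "\<Union>z\<in>C. I z"] m0 U by (simp add: fmeasurableD)
    qed
  qed
  show ?thesis
  proof (intro exI[of _ "\<Union>k. bad k"] conjI ballI)
    show "negligible (\<Union>k. bad k)" by (rule negligible_countable_Union) (use neg in auto)
    fix x assume "x \<in> {a<..<b} - (\<Union>k. bad k)"
    then have "(F has_vector_derivative f x) (at x)" by (intro der) auto
    then show "((\<lambda>t. integral {a..t} f) has_vector_derivative f x) (at x)" by (simp add: F_def[abs_def])
  qed
qed

text \<open>Truncate: \<open>|f| \<le> N + h\<close> with \<open>h = max 0 (|f| - N)\<close>, whose integral is small for large \<open>N\<close> by dominated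
  convergence. The bounded part contributes at most \<open>N\<close> times the total length.\<close>

lemma indefinite_integral_abs_cont:
  fixes f :: "real \<Rightarrow> complex"
  assumes f: "f absolutely_integrable_on {a..b}"
  shows "abs_cont_on a b (\<lambda>x. integral {a..x} f)"
  unfolding abs_cont_on_def
proof (intro allI impI)
  fix \<epsilon> :: real assume \<epsilon>: "\<epsilon> > 0"
  have fi: "f integrable_on {a..b}" and fn: "(\<lambda>x. norm (f x)) integrable_on {a..b}"
    using f by (auto simp: absolutely_integrable_on_def)
  define h where "h n x = max 0 (norm (f x) - real n)" for n x
  have habs: "h n absolutely_integrable_on {a..b}" for n
  proof -
    have "(\<lambda>x. norm (f x)) absolutely_integrable_on {a..b}" using fn by (auto simp: absolutely_integrable_on_def)
    then have "(\<lambda>x. norm (f x) - real n) absolutely_integrable_on {a..b}"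
      by (rule set_integral_diff(1)) (rule absolutely_integrable_continuous_real, rule continuous_on_const)
    then show ?thesis unfolding h_def
      by (intro absolutely_integrable_max_1[OF absolutely_integrable_zero])
  qed
  have hi: "h n integrable_on {a..b}" for n using habs[of n] unfolding absolutely_integrable_on_def by (rule conjunct1)
  have "(\<lambda>n. integral {a..b} (h n)) \<longlonglongrightarrow> integral {a..b} (\<lambda>x. 0)"
  proof (rule dominated_convergence(2)[of h "{a..b}" "\<lambda>x. norm (f x)" "\<lambda>x. 0", OF hi fn])
    show "norm (h n x) \<le> norm (f x)" if "x \<in> {a..b}" for n x by (auto simp: h_def)
    show "(\<lambda>n. h n x) \<longlonglongrightarrow> 0" if "x \<in> {a..b}" for x
    proof (rule tendsto_eventually)
      obtain N where "norm (f x) \<le> real N" using real_arch_simple by blast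
      then show "\<forall>\<^sub>F n in sequentially. h n x = 0"
        by (intro eventually_sequentiallyI[of N]) (auto simp: h_def max_def)
    qed
  qed
  then have "(\<lambda>n. integral {a..b} (h n)) \<longlonglongrightarrow> 0" by simp
  then have "\<forall>\<^sub>F n in sequentially. integral {a..b} (h n) < \<epsilon> / 2"
    using \<epsilon> by (intro order_tendstoD) auto
  then obtain N where N: "integral {a..b} (h N) < \<epsilon> / 2" by (auto simp: eventually_sequentially)
  show "\<exists>\<delta>>0. \<forall>(n::nat) u v.
        (\<forall>i<n. a \<le> u i \<and> u i \<le> v i \<and> v i \<le> b) \<and>
        (\<forall>i<n. \<forall>j<n. i \<noteq> j \<longrightarrow> {u i<..<v i} \<inter> {u j<..<v j} = {}) \<and>
        (\<Sum>i<n. v i - u i) < \<delta>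
        \<longrightarrow> (\<Sum>i<n. norm (integral {a..v i} f - integral {a..u i} f)) < \<epsilon>"
  proof (intro exI[of _ "\<epsilon> / (2 * (real N + 1))"] conjI allI impI)
    show "0 < \<epsilon> / (2 * (real N + 1))" using \<epsilon> by simp
    fix n :: nat and u v
    assume A: "(\<forall>i<n. a \<le> u i \<and> u i \<le> v i \<and> v i \<le> b) \<and>
        (\<forall>i<n. \<forall>j<n. i \<noteq> j \<longrightarrow> {u i<..<v i} \<inter> {u j<..<v j} = {}) \<and>
        (\<Sum>i<n. v i - u i) < \<epsilon> / (2 * (real N + 1))"
    have uv: "a \<le> u i" "u i \<le> v i" "v i \<le> b" if "i < n" for i using A that by auto
    have each: "norm (integral {a..v i} f - integral {a..u i} f) \<le> real N * (v i - u i) + integral {u i..v i} (h N)"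
      if i: "i < n" for i
    proof -
      have sub: "{u i..v i} \<subseteq> {a..b}" using uv[OF i] by auto
      have 1: "f integrable_on {u i..v i}" "h N integrable_on {u i..v i}"
        using integrable_on_subinterval[OF fi sub] integrable_on_subinterval[OF hi sub] by auto
      have 2: "(\<lambda>x. real N + h N x) integrable_on {u i..v i}" using 1 by (intro integrable_add) auto
      have "integral {a..v i} f - integral {a..u i} f = integral {u i..v i} f"
        by (rule integral_Icc_diff[OF fi uv[OF i]])
      also have "norm \<dots> \<le> integral {u i..v i} (\<lambda>x. real N + h N x)"
        by (rule Henstock_Kurzweil_Integration.integral_norm_bound_integral[OF 1(1) 2]) (auto simp: h_def)
      also have "\<dots> = real N * (v i - u i) + integral {u i..v i} (h N)"
        using 1(2) uv[OF i] by (subst Henstock_Kurzweil_Integration.integral_add) (auto simp: mult.commute)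
      finally show ?thesis .
    qed
    have dis: "(h N has_integral (\<Sum>i<n. integral {u i..v i} (h N))) (\<Union>i<n. {u i..v i})"
    proof (rule has_integral_UN)
      fix i assume "i \<in> {..<n}"
      then have "{u i..v i} \<subseteq> {a..b}" using uv[of i] by auto
      from integrable_on_subinterval[OF hi this] show "(h N has_integral integral {u i..v i} (h N)) {u i..v i}"
        by (rule integrable_integral)
    next
      show "pairwise (\<lambda>i i'. negligible ({u i..v i} \<inter> {u i'..v i'})) {..<n}"
      proof (rule pairwiseI)
        fix i j assume ij: "i \<in> {..<n}" "j \<in> {..<n}" "i \<noteq> j"
        then have dj: "{u i<..<v i} \<inter> {u j<..<v j} = {}" using A by auto
        have "{u i..v i} \<inter> {u j..v j} \<subseteq> {u i, v i, u j, v j} \<union> ({u i<..<v i} \<inter> {u j<..<v j})"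
          by (auto simp: not_less)
        then have "{u i..v i} \<inter> {u j..v j} \<subseteq> {u i, v i, u j, v j}" unfolding dj by simp
        then show "negligible ({u i..v i} \<inter> {u j..v j})"
          by (rule negligible_subset[rotated]) (simp add: negligible_finite)
      qed
    qed simp
    then have "(\<Sum>i<n. integral {u i..v i} (h N)) = integral (\<Union>i<n. {u i..v i}) (h N)"
      by (simp add: integral_unique)
    also have "\<dots> \<le> integral {a..b} (h N)"
    proof (rule integral_subset_le)
      have "{u i..v i} \<subseteq> {a..b}" if "i < n" for i using uv[OF that] by auto
      then show "(\<Union>i<n. {u i..v i}) \<subseteq> {a..b}" by blast
      show "h N integrable_on (\<Union>i<n. {u i..v i})" using dis by (rule has_integral_integrable)
    qed (use hi in \<open>auto simp: h_def\<close>)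
    finally have s: "(\<Sum>i<n. integral {u i..v i} (h N)) < \<epsilon> / 2" using N by linarith
    have "(\<Sum>i<n. norm (integral {a..v i} f - integral {a..u i} f))
        \<le> (\<Sum>i<n. real N * (v i - u i) + integral {u i..v i} (h N))"
      by (rule sum_mono) (use each in auto)
    also have "\<dots> = real N * (\<Sum>i<n. v i - u i) + (\<Sum>i<n. integral {u i..v i} (h N))"
      by (simp add: sum.distrib sum_distrib_left)
    also have "\<dots> < \<epsilon>"
    proof -
      have "real N * (\<Sum>i<n. v i - u i) \<le> real N * (\<epsilon> / (2 * (real N + 1)))"
        using A by (intro mult_left_mono) auto
      also have "\<dots> \<le> \<epsilon> / 2" using \<epsilon> by (simp add: field_simps)
      finally show ?thesis using s by linarith
    qed
    finally show "(\<Sum>i<n. norm (integral {a..v i} f - integral {a..u i} f)) < \<epsilon>" .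
  qed
qed

section \<open>Calculus of absolutely continuous functions and Gronwall's inequality\<close>

text \<open>One criterion for all closure properties: sums, products and exponentials of absolutely continuous functions
  are estimated by the increments of their constituents.\<close>

lemma abs_cont_on_dominated:
  assumes f: "abs_cont_on a b f" and g: "abs_cont_on a b g"
    and h: "\<And>x y. a \<le> x \<Longrightarrow> x \<le> y \<Longrightarrow> y \<le> b \<Longrightarrow> norm (h y - h x) \<le> M * (norm (f y - f x) + norm (g y - g x))"
  shows "abs_cont_on a b h"
  unfolding abs_cont_on_def
proof (intro allI impI)
  fix \<epsilon> :: real assume "\<epsilon> > 0"
  define \<eta> where "\<eta> = \<epsilon> / (2 * (\<bar>M\<bar> + 1))"
  have \<eta>: "\<eta> > 0" using \<open>\<epsilon> > 0\<close> by (simp add: \<eta>_def)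
  obtain \<delta>1 where \<delta>1: "\<delta>1 > 0" and f': "\<forall>(n::nat) u v.
        (\<forall>i<n. a \<le> u i \<and> u i \<le> v i \<and> v i \<le> b) \<and>
        (\<forall>i<n. \<forall>j<n. i \<noteq> j \<longrightarrow> {u i<..<v i} \<inter> {u j<..<v j} = {}) \<and>
        (\<Sum>i<n. v i - u i) < \<delta>1
        \<longrightarrow> (\<Sum>i<n. norm (f (v i) - f (u i))) < \<eta>"
    using f[unfolded abs_cont_on_def, rule_format, OF \<eta>] by (elim exE conjE)
  obtain \<delta>2 where \<delta>2: "\<delta>2 > 0" and g': "\<forall>(n::nat) u v.
        (\<forall>i<n. a \<le> u i \<and> u i \<le> v i \<and> v i \<le> b) \<and>
        (\<forall>i<n. \<forall>j<n. i \<noteq> j \<longrightarrow> {u i<..<v i} \<inter> {u j<..<v j} = {}) \<and>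
        (\<Sum>i<n. v i - u i) < \<delta>2
        \<longrightarrow> (\<Sum>i<n. norm (g (v i) - g (u i))) < \<eta>"
    using g[unfolded abs_cont_on_def, rule_format, OF \<eta>] by (elim exE conjE)
  show "\<exists>\<delta>>0. \<forall>(n::nat) u v.
        (\<forall>i<n. a \<le> u i \<and> u i \<le> v i \<and> v i \<le> b) \<and>
        (\<forall>i<n. \<forall>j<n. i \<noteq> j \<longrightarrow> {u i<..<v i} \<inter> {u j<..<v j} = {}) \<and>
        (\<Sum>i<n. v i - u i) < \<delta>
        \<longrightarrow> (\<Sum>i<n. norm (h (v i) - h (u i))) < \<epsilon>"
  proof (intro exI[of _ "min \<delta>1 \<delta>2"] conjI allI impI)
    show "0 < min \<delta>1 \<delta>2" using \<delta>1 \<delta>2 by simp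
    fix n :: nat and u v
    assume A: "(\<forall>i<n. a \<le> u i \<and> u i \<le> v i \<and> v i \<le> b) \<and>
        (\<forall>i<n. \<forall>j<n. i \<noteq> j \<longrightarrow> {u i<..<v i} \<inter> {u j<..<v j} = {}) \<and>
        (\<Sum>i<n. v i - u i) < min \<delta>1 \<delta>2"
    have 1: "(\<Sum>i<n. norm (f (v i) - f (u i))) < \<eta>"
      by (rule f'[rule_format]) (use A in simp)
    have 2: "(\<Sum>i<n. norm (g (v i) - g (u i))) < \<eta>"
      by (rule g'[rule_format]) (use A in simp)
    have "(\<Sum>i<n. norm (h (v i) - h (u i))) \<le> (\<Sum>i<n. \<bar>M\<bar> * (norm (f (v i) - f (u i)) + norm (g (v i) - g (u i))))"
    proof (rule sum_mono)
      fix i assume "i \<in> {..<n}"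
      then have "norm (h (v i) - h (u i)) \<le> M * (norm (f (v i) - f (u i)) + norm (g (v i) - g (u i)))"
        using A by (intro h) auto
      also have "\<dots> \<le> \<bar>M\<bar> * (norm (f (v i) - f (u i)) + norm (g (v i) - g (u i)))"
        by (rule mult_right_mono) auto
      finally show "norm (h (v i) - h (u i)) \<le> \<bar>M\<bar> * (norm (f (v i) - f (u i)) + norm (g (v i) - g (u i)))" .
    qed
    also have "\<dots> = \<bar>M\<bar> * ((\<Sum>i<n. norm (f (v i) - f (u i))) + (\<Sum>i<n. norm (g (v i) - g (u i))))"
      by (simp add: sum_distrib_left[symmetric] sum.distrib)
    also have "\<dots> \<le> \<bar>M\<bar> * (\<eta> + \<eta>)" using 1 2 by (intro mult_left_mono) auto
    also have "\<dots> = \<epsilon> * (\<bar>M\<bar> / (\<bar>M\<bar> + 1))"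
      by (simp add: \<eta>_def field_simps add_nonneg_eq_0_iff)
    also have "\<dots> < \<epsilon> * 1" using \<open>\<epsilon> > 0\<close> by (intro mult_strict_left_mono) (auto simp: field_simps)
    also have "\<dots> = \<epsilon>" by simp
    finally show "(\<Sum>i<n. norm (h (v i) - h (u i))) < \<epsilon>" .
  qed
qed

lemma abs_cont_on_subinterval:
  assumes "abs_cont_on a b f" "a \<le> u" "v \<le> b"
  shows "abs_cont_on u v f"
  unfolding abs_cont_on_def
proof (intro allI impI)
  fix \<epsilon> :: real assume e: "\<epsilon> > 0"
  obtain \<delta> where \<delta>: "\<delta> > 0" and f': "\<forall>(n::nat) u v.
        (\<forall>i<n. a \<le> u i \<and> u i \<le> v i \<and> v i \<le> b) \<and>
        (\<forall>i<n. \<forall>j<n. i \<noteq> j \<longrightarrow> {u i<..<v i} \<inter> {u j<..<v j} = {}) \<and>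
        (\<Sum>i<n. v i - u i) < \<delta>
        \<longrightarrow> (\<Sum>i<n. norm (f (v i) - f (u i))) < \<epsilon>"
    using assms(1)[unfolded abs_cont_on_def, rule_format, OF e] by (elim exE conjE)
  show "\<exists>\<delta>>0. \<forall>(n::nat) x y.
        (\<forall>i<n. u \<le> x i \<and> x i \<le> y i \<and> y i \<le> v) \<and>
        (\<forall>i<n. \<forall>j<n. i \<noteq> j \<longrightarrow> {x i<..<y i} \<inter> {x j<..<y j} = {}) \<and>
        (\<Sum>i<n. y i - x i) < \<delta>
        \<longrightarrow> (\<Sum>i<n. norm (f (y i) - f (x i))) < \<epsilon>"
  proof (intro exI[of _ \<delta>] conjI allI impI, fact \<delta>)
    fix n :: nat and x y
    assume A: "(\<forall>i<n. u \<le> x i \<and> x i \<le> y i \<and> y i \<le> v) \<and>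
        (\<forall>i<n. \<forall>j<n. i \<noteq> j \<longrightarrow> {x i<..<y i} \<inter> {x j<..<y j} = {}) \<and>
        (\<Sum>i<n. y i - x i) < \<delta>"
    then have "\<forall>i<n. a \<le> x i \<and> x i \<le> y i \<and> y i \<le> b" using assms(2,3) by (meson order_trans)
    with A show "(\<Sum>i<n. norm (f (y i) - f (x i))) < \<epsilon>" by (intro f'[rule_format]) simp
  qed
qed

lemma abs_cont_on_imp_continuous_on:
  assumes "abs_cont_on a b f"
  shows "continuous_on {a..b} f"
  unfolding continuous_on_iff
proof (intro ballI allI impI)
  fix x e :: real assume x: "x \<in> {a..b}" and e: "e > 0"
  from abs_cont_on_finite_sum[OF assms e, where ?'i = nat]
  obtain \<delta> where \<delta>: "\<delta> > 0" and f': "\<forall>(I :: nat set) u v. finite I \<longrightarrow> (\<forall>i\<in>I. a \<le> u i \<and> u i \<le> v i \<and> v i \<le> b)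
      \<longrightarrow> (\<forall>i\<in>I. \<forall>j\<in>I. i \<noteq> j \<longrightarrow> {u i<..<v i} \<inter> {u j<..<v j} = {})
      \<longrightarrow> (\<Sum>i\<in>I. v i - u i) < \<delta> \<longrightarrow> (\<Sum>i\<in>I. norm (f (v i) - f (u i))) < e"
    by (elim exE conjE)
  show "\<exists>d>0. \<forall>y\<in>{a..b}. dist y x < d \<longrightarrow> dist (f y) (f x) < e"
  proof (intro exI[of _ \<delta>] conjI ballI impI, fact \<delta>)
    fix y assume y: "y \<in> {a..b}" "dist y x < \<delta>"
    have "(\<Sum>i\<in>{0::nat}. norm (f (max x y) - f (min x y))) < e"
      by (rule f'[rule_format, of "{0}" "\<lambda>_. min x y" "\<lambda>_. max x y"])
        (use x y in \<open>auto simp: dist_real_def\<close>)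
    then show "dist (f y) (f x) < e"
      by (cases "x \<le> y") (auto simp: dist_norm norm_minus_commute)
  qed
qed

text \<open>A function together with its almost everywhere derivative. Keeping the derivative as an explicit argument
  makes the product and chain rules compose like those for ordinary derivatives.\<close>

definition ac_deriv :: "real \<Rightarrow> real \<Rightarrow> (real \<Rightarrow> complex) \<Rightarrow> (real \<Rightarrow> complex) \<Rightarrow> bool" where
  "ac_deriv a b f f' \<longleftrightarrow> abs_cont_on a b f \<and>
     (\<exists>N. negligible N \<and> (\<forall>x\<in>{a<..<b} - N. (f has_vector_derivative f' x) (at x)))"

lemma ac_derivE:
  assumes "ac_deriv a b f f'"
  obtains N where "abs_cont_on a b f" "negligible N" "\<And>x. x \<in> {a<..<b} - N \<Longrightarrow> (f has_vector_derivative f' x) (at x)"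
  using assms unfolding ac_deriv_def by blast

lemma ac_deriv_continuous_on: "ac_deriv a b f f' \<Longrightarrow> continuous_on {a..b} f"
  by (simp add: ac_deriv_def abs_cont_on_imp_continuous_on)

lemma ac_deriv_has_integral:
  assumes "ac_deriv a b f f'" "a \<le> u" "u \<le> v" "v \<le> b"
  shows "(f' has_integral (f v - f u)) {u..v}"
proof -
  from ac_derivE[OF assms(1)] obtain N where N: "abs_cont_on a b f" "negligible N"
    "\<And>x. x \<in> {a<..<b} - N \<Longrightarrow> (f has_vector_derivative f' x) (at x)" by blast
  show ?thesis
  proof (rule abs_cont_on_FTC[OF assms(3) abs_cont_on_subinterval[OF N(1)]])
    show "negligible (N \<union> {a,b})" using N(2) by (simp add: negligible_Un)
    fix x assume "x \<in> {u..v} - (N \<union> {a,b})"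
    then have "x \<in> {a<..<b} - N" using assms by auto
    from N(3)[OF this] show "(f has_vector_derivative f' x) (at x within {u..v})"
      by (rule has_vector_derivative_at_within)
  qed (use assms in auto)
qed

lemma ac_deriv_integral:
  assumes "ac_deriv a b f f'" "a \<le> u" "u \<le> v" "v \<le> b"
  shows "f' integrable_on {u..v}" "f v = f u + integral {u..v} f'"
  using ac_deriv_has_integral[OF assms] by (auto simp: has_integral_integrable integral_unique)

lemma ac_deriv_cong:
  assumes "ac_deriv a b f f'" "\<And>x. x \<in> {a..b} \<Longrightarrow> f x = g x" "\<And>x. x \<in> {a<..<b} \<Longrightarrow> f' x = g' x"
  shows "ac_deriv a b g g'"
proof -
  from ac_derivE[OF assms(1)] obtain N where N: "abs_cont_on a b f" "negligible N"
    "\<And>x. x \<in> {a<..<b} - N \<Longrightarrow> (f has_vector_derivative f' x) (at x)" by blast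
  show ?thesis unfolding ac_deriv_def
  proof (intro conjI exI[of _ N] ballI)
    show "abs_cont_on a b g" by (rule abs_cont_on_dominated[OF N(1) N(1), of _ 1]) (simp add: assms(2)[symmetric])
    fix x assume x: "x \<in> {a<..<b} - N"
    show "(g has_vector_derivative g' x) (at x)"
    proof (rule has_vector_derivative_transform_within_open)
      show "(f has_vector_derivative g' x) (at x)" using N(3)[OF x] x assms(3) by simp
    qed (use x assms(2) in \<open>auto intro: open_greaterThanLessThan\<close>)
  qed (fact N(2))
qed

lemma ac_deriv_indefinite_integral:
  assumes "f' absolutely_integrable_on {a..b}"
  shows "ac_deriv a b (\<lambda>x. c + integral {a..x} f') f'"
proof -
  have "f' integrable_on {a..b}" using assms by (simp add: absolutely_integrable_on_def)
  from indefinite_integral_derivative_ae[OF this] obtain N where N: "negligible N"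
    "\<And>x. x\<in>{a<..<b} - N \<Longrightarrow> ((\<lambda>t. integral {a..t} f') has_vector_derivative f' x) (at x)" by blast
  show ?thesis unfolding ac_deriv_def
  proof (intro conjI exI[of _ N] ballI)
    show "abs_cont_on a b (\<lambda>x. c + integral {a..x} f')"
      by (rule abs_cont_on_dominated[OF indefinite_integral_abs_cont[OF assms] indefinite_integral_abs_cont[OF assms], of _ 1]) simp
    fix x assume "x \<in> {a<..<b} - N"
    from has_vector_derivative_add[OF has_vector_derivative_const N(2)[OF this], of c]
    show "((\<lambda>x. c + integral {a..x} f') has_vector_derivative f' x) (at x)" by simp
  qed (fact N)
qed

lemma ac_deriv_C1:
  assumes d: "\<And>x. x \<in> {a..b} \<Longrightarrow> (f has_vector_derivative f' x) (at x within {a..b})"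
    and c: "continuous_on {a..b} f'"
  shows "ac_deriv a b f f'"
proof (rule ac_deriv_cong)
  show "ac_deriv a b (\<lambda>x. f a + integral {a..x} f') f'"
    by (intro ac_deriv_indefinite_integral absolutely_integrable_continuous_real c)
  fix x assume x: "x \<in> {a..b}"
  have "(f' has_integral (f x - f a)) {a..x}"
    by (rule fundamental_theorem_of_calculus)
      (use x in \<open>auto intro!: has_vector_derivative_within_subset[OF d]\<close>)
  then show "f a + integral {a..x} f' = f x" by (simp add: integral_unique)
qed simp

lemma ac_deriv_add:
  assumes "ac_deriv a b f f'" "ac_deriv a b g g'"
  shows "ac_deriv a b (\<lambda>x. f x + g x) (\<lambda>x. f' x + g' x)"
proof -
  from ac_derivE[OF assms(1)] obtain N where N: "abs_cont_on a b f" "negligible N"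
    "\<And>x. x \<in> {a<..<b} - N \<Longrightarrow> (f has_vector_derivative f' x) (at x)" by blast
  from ac_derivE[OF assms(2)] obtain K where K: "abs_cont_on a b g" "negligible K"
    "\<And>x. x \<in> {a<..<b} - K \<Longrightarrow> (g has_vector_derivative g' x) (at x)" by blast
  show ?thesis unfolding ac_deriv_def
  proof (intro conjI exI[of _ "N \<union> K"] ballI)
    show "abs_cont_on a b (\<lambda>x. f x + g x)"
    proof (rule abs_cont_on_dominated[OF N(1) K(1), of _ 1])
      fix x y
      show "norm (f y + g y - (f x + g x)) \<le> 1 * (norm (f y - f x) + norm (g y - g x))"
        using norm_triangle_ineq[of "f y - f x" "g y - g x"] by (simp add: algebra_simps)
    qed
    show "negligible (N \<union> K)" using N(2) K(2) by (rule negligible_Un)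
    fix x assume "x \<in> {a<..<b} - (N \<union> K)"
    then show "((\<lambda>x. f x + g x) has_vector_derivative f' x + g' x) (at x)"
      by (intro has_vector_derivative_add N(3) K(3)) auto
  qed
qed

lemma continuous_on_Icc_norm_bound:
  fixes f :: "real \<Rightarrow> complex"
  assumes "continuous_on {a..b} f"
  obtains B where "B > 0" "\<And>x. x \<in> {a..b} \<Longrightarrow> norm (f x) \<le> B"
proof -
  have "bounded (f ` {a..b})" by (intro compact_imp_bounded compact_continuous_image assms compact_Icc)
  then obtain B where "B > 0" "\<forall>z\<in>f ` {a..b}. norm z \<le> B" by (auto simp: bounded_pos)
  then show thesis by (intro that[of B]) auto
qed

lemma ac_deriv_mult:
  assumes "ac_deriv a b f f'" "ac_deriv a b g g'"
  shows "ac_deriv a b (\<lambda>x. f x * g x) (\<lambda>x. f x * g' x + f' x * g x)"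
proof -
  from ac_derivE[OF assms(1)] obtain N where N: "abs_cont_on a b f" "negligible N"
    "\<And>x. x \<in> {a<..<b} - N \<Longrightarrow> (f has_vector_derivative f' x) (at x)" by blast
  from ac_derivE[OF assms(2)] obtain K where K: "abs_cont_on a b g" "negligible K"
    "\<And>x. x \<in> {a<..<b} - K \<Longrightarrow> (g has_vector_derivative g' x) (at x)" by blast
  obtain Bf where Bf: "Bf > 0" "\<And>x. x \<in> {a..b} \<Longrightarrow> norm (f x) \<le> Bf"
    using continuous_on_Icc_norm_bound[OF abs_cont_on_imp_continuous_on[OF N(1)]] by blast
  obtain Bg where Bg: "Bg > 0" "\<And>x. x \<in> {a..b} \<Longrightarrow> norm (g x) \<le> Bg"
    using continuous_on_Icc_norm_bound[OF abs_cont_on_imp_continuous_on[OF K(1)]] by blast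
  show ?thesis unfolding ac_deriv_def
  proof (intro conjI exI[of _ "N \<union> K"] ballI)
    show "abs_cont_on a b (\<lambda>x. f x * g x)"
    proof (rule abs_cont_on_dominated[OF N(1) K(1), of _ "Bf + Bg"])
      fix x y assume xy: "a \<le> x" "x \<le> y" "y \<le> b"
      have "norm (f y * g y - f x * g x) = norm ((f y - f x) * g y + f x * (g y - g x))"
        by (simp add: algebra_simps)
      also have "\<dots> \<le> norm (f y - f x) * norm (g y) + norm (f x) * norm (g y - g x)"
        using norm_triangle_ineq[of "(f y - f x) * g y" "f x * (g y - g x)"] by (simp add: norm_mult)
      also have "\<dots> \<le> norm (f y - f x) * (Bf + Bg) + (Bf + Bg) * norm (g y - g x)"
        using Bf(2)[of x] Bg(2)[of y] Bf(1) Bg(1) xy by (intro add_mono mult_left_mono mult_right_mono) auto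
      finally show "norm (f y * g y - f x * g x) \<le> (Bf + Bg) * (norm (f y - f x) + norm (g y - g x))"
        by (simp add: algebra_simps)
    qed
    show "negligible (N \<union> K)" using N(2) K(2) by (rule negligible_Un)
    fix x assume "x \<in> {a<..<b} - (N \<union> K)"
    then show "((\<lambda>x. f x * g x) has_vector_derivative f x * g' x + f' x * g x) (at x)"
      by (intro has_vector_derivative_mult N(3) K(3)) auto
  qed
qed

lemma ac_deriv_const: "ac_deriv a b (\<lambda>x. c) (\<lambda>x. 0)"
  by (rule ac_deriv_C1) (auto intro: continuous_intros)

lemma ac_deriv_cmult: "ac_deriv a b f f' \<Longrightarrow> ac_deriv a b (\<lambda>x. c * f x) (\<lambda>x. c * f' x)"
  using ac_deriv_mult[OF ac_deriv_const, of a b f f' c] by simp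

lemma ac_deriv_diff:
  assumes "ac_deriv a b f f'" "ac_deriv a b g g'"
  shows "ac_deriv a b (\<lambda>x. f x - g x) (\<lambda>x. f' x - g' x)"
  using ac_deriv_add[OF assms(1) ac_deriv_cmult[OF assms(2), of "-1"]] by simp

lemma exp_lipschitz:
  fixes z w :: complex
  assumes "norm z \<le> B" "norm w \<le> B"
  shows "norm (exp z - exp w) \<le> exp B * norm (z - w)"
proof (rule field_differentiable_bound[of "cball 0 B" exp exp])
  show "norm (exp u) \<le> exp B" if "u \<in> cball 0 B" for u :: complex
    using that complex_Re_le_cmod[of u] by (simp add: norm_exp_eq_Re)
qed (use assms in \<open>auto intro!: derivative_eq_intros\<close>)

lemma ac_deriv_exp:
  assumes "ac_deriv a b f f'"
  shows "ac_deriv a b (\<lambda>x. exp (f x)) (\<lambda>x. f' x * exp (f x))"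
proof -
  from ac_derivE[OF assms(1)] obtain N where N: "abs_cont_on a b f" "negligible N"
    "\<And>x. x \<in> {a<..<b} - N \<Longrightarrow> (f has_vector_derivative f' x) (at x)" by blast
  obtain B where B: "B > 0" "\<And>x. x \<in> {a..b} \<Longrightarrow> norm (f x) \<le> B"
    using continuous_on_Icc_norm_bound[OF abs_cont_on_imp_continuous_on[OF N(1)]] by blast
  show ?thesis unfolding ac_deriv_def
  proof (intro conjI exI[of _ N] ballI)
    show "abs_cont_on a b (\<lambda>x. exp (f x))"
    proof (rule abs_cont_on_dominated[OF N(1) N(1), of _ "exp B"])
      fix x y assume xy: "a \<le> x" "x \<le> y" "y \<le> b"
      have "norm (exp (f y) - exp (f x)) \<le> exp B * norm (f y - f x)"
        by (rule exp_lipschitz) (use B xy in auto)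
      also have "\<dots> \<le> exp B * (norm (f y - f x) + norm (f y - f x))"
        by (intro mult_left_mono) auto
      finally show "norm (exp (f y) - exp (f x)) \<le> exp B * (norm (f y - f x) + norm (f y - f x))" .
    qed
    fix x assume x: "x \<in> {a<..<b} - N"
    have "((exp \<circ> f) has_vector_derivative f' x * exp (f x)) (at x)"
      by (rule field_vector_diff_chain_at[OF N(3)[OF x]]) (rule DERIV_exp)
    then show "((\<lambda>x. exp (f x)) has_vector_derivative f' x * exp (f x)) (at x)"
      by (simp add: o_def)
  qed (fact N)
qed

lemma absolutely_integrable_times_continuous:
  fixes f g :: "real \<Rightarrow> complex"
  assumes "f absolutely_integrable_on {a..b}" "continuous_on {a..b} g"
  shows "(\<lambda>x. f x * g x) absolutely_integrable_on {a..b}"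
proof -
  have "(\<lambda>x. g x * f x) absolutely_integrable_on {a..b}"
  proof (rule absolutely_integrable_bounded_measurable_product[OF bilinear_times])
    show "g \<in> borel_measurable (lebesgue_on {a..b})"
      by (rule continuous_imp_measurable_on_sets_lebesgue[OF assms(2)]) auto
    show "bounded (g ` {a..b})"
      by (intro compact_imp_bounded compact_continuous_image assms compact_Icc)
  qed (use assms in auto)
  then show ?thesis by (simp add: mult.commute)
qed

lemma integrable_times_continuous_real:
  fixes k u :: "real \<Rightarrow> real"
  assumes k: "k integrable_on {a..b}" "\<And>t. t \<in> {a..b} \<Longrightarrow> 0 \<le> k t" and u: "continuous_on {a..b} u"
  shows "(\<lambda>x. k x * u x) integrable_on {a..b}"
proof -
  have k': "k absolutely_integrable_on {a..b}"
    using k by (intro nonnegative_absolutely_integrable_1) auto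
  have "(\<lambda>x. u x * k x) absolutely_integrable_on {a..b}"
  proof (rule absolutely_integrable_bounded_measurable_product_real)
    show "u \<in> borel_measurable (lebesgue_on {a..b})"
      by (rule continuous_imp_measurable_on_sets_lebesgue[OF u]) auto
    show "bounded (u ` {a..b})"
      by (intro compact_imp_bounded compact_continuous_image u compact_Icc)
  qed (use k' in auto)
  then show ?thesis by (simp add: mult.commute absolutely_integrable_on_def)
qed

text \<open>The primitive of \<open>k exp (2 \<integral> k)\<close> is \<open>exp (2 \<integral> k) / 2\<close>; as \<open>k\<close> is only integrable this uses the chain
  rule for absolutely continuous functions, which is formulated for complex functions.\<close>

lemma integral_weighted_exp:
  fixes k :: "real \<Rightarrow> real"
  assumes k: "k integrable_on {0..b}" "\<And>t. t \<in> {0..b} \<Longrightarrow> 0 \<le> k t" and x: "x \<in> {0..b}"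
  shows "((\<lambda>t. k t * exp (2 * integral {0..t} k)) has_integral (exp (2 * integral {0..x} k) - 1) / 2) {0..x}"
proof -
  have k': "k absolutely_integrable_on {0..b}"
    using k by (intro nonnegative_absolutely_integrable_1) auto
  then have kc: "(\<lambda>t. complex_of_real (k t)) absolutely_integrable_on {0..b}"
    unfolding absolutely_integrable_on_def using integrable_linear[OF _ bounded_linear_of_real[where 'a=complex], of k "{0..b}"]
    by (auto simp: o_def)
  define G where "G t = integral {0..t} (\<lambda>t. complex_of_real (k t))" for t
  have G: "G t = of_real (integral {0..t} k)" if "t \<in> {0..b}" for t
  proof -
    have "k integrable_on {0..t}" by (rule integrable_on_subinterval[OF k(1)]) (use that in auto)
    from has_integral_of_real[OF integrable_integral[OF this]] show ?thesis
      unfolding G_def by (rule integral_unique)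
  qed
  have "ac_deriv 0 b (\<lambda>t. 0 + G t) (\<lambda>t. complex_of_real (k t))"
    unfolding G_def by (rule ac_deriv_indefinite_integral[OF kc])
  then have "ac_deriv 0 b (\<lambda>t. exp (2 * G t)) (\<lambda>t. (2 * complex_of_real (k t)) * exp (2 * G t))"
    by (intro ac_deriv_exp ac_deriv_cmult) simp
  then have "((\<lambda>t. (2 * complex_of_real (k t)) * exp (2 * G t)) has_integral (exp (2 * G x) - exp (2 * G 0))) {0..x}"
    by (rule ac_deriv_has_integral) (use x in auto)
  from has_integral_linear[OF this bounded_linear_Re]
  have "((\<lambda>t. Re ((2 * complex_of_real (k t)) * exp (2 * G t))) has_integral Re (exp (2 * G x) - exp (2 * G 0))) {0..x}"
    by (simp add: o_def)
  moreover have e: "exp (2 * G t) = of_real (exp (2 * integral {0..t} k))" if "t \<in> {0..b}" for t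
    unfolding G[OF that] by (metis exp_of_real of_real_mult of_real_numeral)
  have "Re (exp (2 * G x) - exp (2 * G 0)) = exp (2 * integral {0..x} k) - 1"
    using e[OF x] e[of 0] x by simp
  moreover have "Re ((2 * complex_of_real (k t)) * exp (2 * G t)) = 2 * (k t * exp (2 * integral {0..t} k))"
    if "t \<in> {0..x}" for t using e[of t] x that by simp
  ultimately have "((\<lambda>t. 2 * (k t * exp (2 * integral {0..t} k))) has_integral (exp (2 * integral {0..x} k) - 1)) {0..x}"
    by (metis (no_types, lifting) has_integral_cong)
  from has_integral_mult_right[OF this, of "1/2"] show ?thesis by simp
qed

lemma continuous_on_indefinite:
  fixes k :: "real \<Rightarrow> 'a::banach"
  shows "k integrable_on {0..b} \<Longrightarrow> continuous_on {0..b} (\<lambda>x. integral {0..x} k)"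
  by (rule indefinite_integral_continuous_1)

lemma indefinite_integral_nonneg_mono:
  fixes k :: "real \<Rightarrow> real"
  assumes k: "k integrable_on {0..b}" "\<And>t. t \<in> {0..b} \<Longrightarrow> 0 \<le> k t" and x: "0 \<le> x" "x \<le> y" "y \<le> b"
  shows "integral {0..x} k \<le> integral {0..y} k"
proof (rule integral_subset_le)
  show "k integrable_on {0..x}" "k integrable_on {0..y}"
    by (rule integrable_on_subinterval[OF k(1)]; use x in auto)+
qed (use x k(2) in auto)

text \<open>In the norm weighted by \<open>exp (- 2 \<integral> k)\<close> the Volterra operator \<open>u \<mapsto> \<integral> k u\<close> has norm at most one half. This
  gives both Gronwall's inequality and the geometric convergence of Picard iterates.\<close>

lemma integral_weighted_exp_le:
  fixes k u :: "real \<Rightarrow> real"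
  assumes k: "k integrable_on {0..b}" "\<And>t. t \<in> {0..b} \<Longrightarrow> 0 \<le> k t" and u: "continuous_on {0..b} u"
    and le: "\<And>t. t \<in> {0..b} \<Longrightarrow> u t \<le> M * exp (2 * integral {0..t} k)" and x: "x \<in> {0..b}" and M: "M \<ge> 0"
  shows "integral {0..x} (\<lambda>t. k t * u t) \<le> M / 2 * exp (2 * integral {0..x} k)"
proof -
  have kx: "k integrable_on {0..x}" by (rule integrable_on_subinterval[OF k(1)]) (use x in auto)
  have "integral {0..x} (\<lambda>t. k t * u t) \<le> integral {0..x} (\<lambda>t. M * (k t * exp (2 * integral {0..t} k)))"
  proof (rule integral_le)
    show "(\<lambda>t. k t * u t) integrable_on {0..x}"
      by (rule integrable_times_continuous_real[OF kx]) (use k x continuous_on_subset[OF u] in auto)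
    show "(\<lambda>t. M * (k t * exp (2 * integral {0..t} k))) integrable_on {0..x}"
      using has_integral_mult_right[OF integral_weighted_exp[OF k x], of M] by (auto simp: has_integral_integrable)
    fix t assume t: "t \<in> {0..x}"
    then have "k t * u t \<le> k t * (M * exp (2 * integral {0..t} k))" using x by (intro mult_left_mono le k(2)) auto
    then show "k t * u t \<le> M * (k t * exp (2 * integral {0..t} k))" by (simp add: algebra_simps)
  qed
  also have "\<dots> = M * ((exp (2 * integral {0..x} k) - 1) / 2)"
    by (rule integral_unique[OF has_integral_mult_right[OF integral_weighted_exp[OF k x]]])
  also have "\<dots> \<le> M / 2 * exp (2 * integral {0..x} k)" using M by (simp add: field_simps)
  finally show ?thesis .
qed

text \<open>Let \<open>M\<close> be the maximum of \<open>u exp (- 2 \<integral> k)\<close>. The weighted bound turns the hypothesis at a maximum point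
  into \<open>M \<le> A + M / 2\<close>.\<close>

lemma gronwall:
  fixes k u :: "real \<Rightarrow> real"
  assumes k: "k integrable_on {0..b}" "\<And>t. t \<in> {0..b} \<Longrightarrow> 0 \<le> k t"
    and u: "continuous_on {0..b} u" "\<And>t. t \<in> {0..b} \<Longrightarrow> 0 \<le> u t"
    and le: "\<And>x. x \<in> {0..b} \<Longrightarrow> u x \<le> A + integral {0..x} (\<lambda>t. k t * u t)"
    and x: "x \<in> {0..b}"
  shows "u x \<le> 2 * A * exp (2 * integral {0..b} k)"
proof -
  define K where "K t = integral {0..t} k" for t
  have Kc: "continuous_on {0..b} K" unfolding K_def by (rule continuous_on_indefinite[OF k(1)])
  have K0: "0 \<le> K t" if "t \<in> {0..b}" for t
    using indefinite_integral_nonneg_mono[OF k, of 0 t] that by (auto simp: K_def)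
  have "\<exists>x0\<in>{0..b}. \<forall>t\<in>{0..b}. u t * exp (- 2 * K t) \<le> u x0 * exp (- 2 * K x0)"
    by (rule continuous_attains_sup) (use x in \<open>auto intro!: continuous_intros u Kc\<close>)
  then obtain x0 where x0: "x0 \<in> {0..b}" "\<And>t. t \<in> {0..b} \<Longrightarrow> u t * exp (- 2 * K t) \<le> u x0 * exp (- 2 * K x0)"
    by blast
  define M where "M = u x0 * exp (- 2 * K x0)"
  have M0: "M \<ge> 0" using u(2)[OF x0(1)] by (simp add: M_def)
  have uM: "u t \<le> M * exp (2 * K t)" if "t \<in> {0..b}" for t
  proof -
    have "u t * exp (- 2 * K t) * exp (2 * K t) \<le> M * exp (2 * K t)"
      using x0(2)[OF that] by (intro mult_right_mono) (auto simp: M_def)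
    then show ?thesis by (simp add: mult.assoc exp_add[symmetric])
  qed
  have "u x0 \<le> A + integral {0..x0} (\<lambda>t. k t * u t)" by (rule le[OF x0(1)])
  also have "\<dots> \<le> A + M / 2 * exp (2 * K x0)"
    using integral_weighted_exp_le[OF k u(1) uM[unfolded K_def] x0(1) M0] by (simp add: K_def)
  finally have "u x0 * exp (- 2 * K x0) \<le> (A + M / 2 * exp (2 * K x0)) * exp (- 2 * K x0)"
    by (intro mult_right_mono) auto
  then have "M \<le> (A + M / 2 * exp (2 * K x0)) * exp (- 2 * K x0)" by (simp only: M_def[symmetric])
  also have "\<dots> = A * exp (- 2 * K x0) + M / 2 * (exp (2 * K x0) * exp (- 2 * K x0))" by (simp add: algebra_simps)
  finally have 1: "M \<le> A * exp (- 2 * K x0) + M / 2" by (simp add: exp_add[symmetric])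
  have A0: "0 \<le> A" using le[of 0] u(2)[of 0] x by auto
  have "A * exp (- 2 * K x0) \<le> A * 1" using A0 K0[OF x0(1)] by (intro mult_left_mono) auto
  with 1 have M2: "M \<le> 2 * A" by simp
  have "u x \<le> M * exp (2 * K x)" by (rule uM[OF x])
  also have "\<dots> \<le> (2 * A) * exp (2 * K b)"
  proof (intro mult_mono M2)
    show "exp (2 * K x) \<le> exp (2 * K b)"
      using indefinite_integral_nonneg_mono[OF k, of x b] x by (auto simp: K_def)
  qed (use A0 in auto)
  finally show ?thesis by (simp add: K_def)
qed

section \<open>Solutions of the edge equation and their dependence on the spectral parameter\<close>

lemma AE_lebesgue_on_iff_negligible:
  assumes "S \<in> sets lebesgue"
  shows "(AE x in lebesgue_on S. P x) \<longleftrightarrow> (\<exists>N. negligible N \<and> (\<forall>x\<in>S - N. P x))"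
proof -
  have "(AE x in lebesgue_on S. P x) \<longleftrightarrow> (AE x in lebesgue. x \<in> S \<longrightarrow> P x)"
    by (rule AE_restrict_space_iff) (use assms in simp)
  also have "\<dots> \<longleftrightarrow> (\<exists>N\<in>null_sets lebesgue. {x \<in> space lebesgue. \<not> (x \<in> S \<longrightarrow> P x)} \<subseteq> N)"
    by (rule eventually_ae_filter)
  also have "\<dots> \<longleftrightarrow> (\<exists>N. negligible N \<and> (\<forall>x\<in>S - N. P x))"
    unfolding Bex_def negligible_iff_null_sets by (intro ex_cong1 conj_cong refl) auto
  finally show ?thesis .
qed

text \<open>The equation reads \<open>y'' = pot y\<close>.\<close>

definition pot :: "(real \<Rightarrow> complex) \<Rightarrow> (real \<Rightarrow> complex) \<Rightarrow> complex \<Rightarrow> real \<Rightarrow> complex" where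
  "pot p q lam x = q x + 2 * lam * p x - lam\<^sup>2"

text \<open>As a first order system \<open>y' = dy\<close>, \<open>dy' = pot y\<close>. For the converse implication, \<open>y\<close> is the integral of
  the continuous function \<open>dy\<close> and therefore differentiable at every point.\<close>

lemma edge_solution_iff_ac_deriv:
  "edge_solution p q lam y dy \<longleftrightarrow> ac_deriv 0 pi y dy \<and> ac_deriv 0 pi dy (\<lambda>x. pot p q lam x * y x)"
proof
  assume L: "edge_solution p q lam y dy"
  note L' = L[unfolded edge_solution_def]
  note y = L'[THEN conjunct1]
  note dy = L'[THEN conjunct2, THEN conjunct1]
  note d = L'[THEN conjunct2, THEN conjunct2, THEN conjunct1]
  note ae = L'[THEN conjunct2, THEN conjunct2, THEN conjunct2]
  have "ac_deriv 0 pi y dy"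
    by (rule ac_deriv_C1) (use d abs_cont_on_imp_continuous_on[OF dy] in auto)
  moreover have S: "{0<..<pi} \<in> sets lebesgue" by simp
  obtain N where N: "negligible N"
    "\<forall>x\<in>{0<..<pi} - N. \<exists>d2y. (dy has_vector_derivative d2y) (at x) \<and>
        - d2y + q x * y x + 2 * lam * p x * y x = lam\<^sup>2 * y x"
    using ae[unfolded AE_lebesgue_on_iff_negligible[OF S]] by (elim exE conjE)
  have "(dy has_vector_derivative (pot p q lam x * y x)) (at x)" if x: "x \<in> {0<..<pi} - N" for x
  proof -
    obtain e where e: "(dy has_vector_derivative e) (at x)" "- e + q x * y x + 2 * lam * p x * y x = lam\<^sup>2 * y x"
      using bspec[OF N(2) x] by (elim exE conjE)
    have "e = pot p q lam x * y x" using e(2) by (simp add: pot_def algebra_simps)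
    then show ?thesis using e(1) by simp
  qed
  then have "ac_deriv 0 pi dy (\<lambda>x. pot p q lam x * y x)"
    unfolding ac_deriv_def by (intro conjI exI[of _ N] ballI dy N(1))
  ultimately show "ac_deriv 0 pi y dy \<and> ac_deriv 0 pi dy (\<lambda>x. pot p q lam x * y x)" by (rule conjI)
next
  assume R: "ac_deriv 0 pi y dy \<and> ac_deriv 0 pi dy (\<lambda>x. pot p q lam x * y x)"
  then have y: "ac_deriv 0 pi y dy" by (rule conjunct1)
  from R have "ac_deriv 0 pi dy (\<lambda>x. pot p q lam x * y x)" by (rule conjunct2)
  from ac_derivE[OF this] obtain N where N: "abs_cont_on 0 pi dy" "negligible N"
    "\<And>x. x \<in> {0<..<pi} - N \<Longrightarrow> (dy has_vector_derivative pot p q lam x * y x) (at x)" by blast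
  have cdy: "continuous_on {0..pi} dy" by (rule abs_cont_on_imp_continuous_on[OF N(1)])
  have yeq: "y u = y 0 + integral {0..u} dy" if "u \<in> {0..pi}" for u
    by (rule ac_deriv_integral(2)[OF y]) (use that in auto)
  show "edge_solution p q lam y dy" unfolding edge_solution_def
  proof (intro conjI ballI)
    show "abs_cont_on 0 pi y" using y by (simp add: ac_deriv_def)
    show "abs_cont_on 0 pi dy" by (rule N(1))
    fix x assume x: "x \<in> {0..pi}"
    have "((\<lambda>u. y 0 + integral {0..u} dy) has_vector_derivative 0 + dy x) (at x within {0..pi})"
      by (intro has_vector_derivative_add has_vector_derivative_const integral_has_vector_derivative cdy x)
    then have "((\<lambda>u. y 0 + integral {0..u} dy) has_vector_derivative dy x) (at x within {0..pi})" by simp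
    then show "(y has_vector_derivative dy x) (at x within {0..pi})"
      by (rule has_vector_derivative_transform[of x "{0..pi}" y "\<lambda>u. y 0 + integral {0..u} dy", OF x, rotated]) (rule yeq)
  next
    have S: "{0<..<pi} \<in> sets lebesgue" by simp
    show "AE x in lebesgue_on {0<..<pi}. \<exists>d2y. (dy has_vector_derivative d2y) (at x) \<and>
        - d2y + q x * y x + 2 * lam * p x * y x = lam\<^sup>2 * y x"
      unfolding AE_lebesgue_on_iff_negligible[OF S]
    proof (intro exI[of _ N] conjI ballI)
      fix x assume "x \<in> {0<..<pi} - N"
      from N(3)[OF this] show "\<exists>d2y. (dy has_vector_derivative d2y) (at x) \<and>
        - d2y + q x * y x + 2 * lam * p x * y x = lam\<^sup>2 * y x"
        by (intro exI[of _ "pot p q lam x * y x"]) (simp add: pot_def algebra_simps)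
    qed (fact N)
  qed
qed

lemma pot_absolutely_integrable:
  assumes "continuous_on {0..pi} p" "q absolutely_integrable_on {0..pi}"
  shows "pot p q lam absolutely_integrable_on {0..pi}"
proof -
  have "(\<lambda>x. q x + (2 * lam * p x - lam\<^sup>2)) absolutely_integrable_on {0..pi}"
    by (rule set_integral_add(1)[OF assms(2)])
      (rule absolutely_integrable_continuous_real, intro continuous_intros assms)
  then show ?thesis by (simp add: pot_def[abs_def] algebra_simps)
qed

text \<open>Both primitives occurring in the integrated equation are dominated by a single Volterra operator, at the price of the factor
  \<open>\<pi>\<close>, so that the weighted estimates above apply.\<close>

lemma double_integral_bound:
  fixes Q e :: "real \<Rightarrow> complex"
  assumes Q: "Q absolutely_integrable_on {0..pi}" and e: "continuous_on {0..pi} e" and x: "x \<in> {0..pi}"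
    and k: "k integrable_on {0..pi}" "\<And>t. t \<in> {0..pi} \<Longrightarrow> pi * norm (Q t) \<le> k t"
  shows "pi * norm (integral {0..x} (\<lambda>t. Q t * e t)) \<le> integral {0..x} (\<lambda>t. k t * norm (e t))"
    and "norm (integral {0..x} (\<lambda>s. integral {0..s} (\<lambda>t. Q t * e t))) \<le> integral {0..x} (\<lambda>t. k t * norm (e t))"
proof -
  have k0: "0 \<le> k t" if "t \<in> {0..pi}" for t
    using k(2)[OF that] by (meson mult_nonneg_nonneg norm_ge_zero order_trans pi_ge_zero)
  have Qe: "(\<lambda>t. Q t * e t) integrable_on {0..pi}"
    using absolutely_integrable_times_continuous[OF Q e] by (simp add: absolutely_integrable_on_def)
  have ke: "(\<lambda>t. k t * norm (e t)) integrable_on {0..pi}"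
  proof (rule integrable_times_continuous_real[OF k(1)])
    show "0 \<le> k t" if "t \<in> {0..pi}" for t by (rule k0[OF that])
    show "continuous_on {0..pi} (\<lambda>t. norm (e t))" by (intro continuous_intros e)
  qed
  have 1: "pi * norm (integral {0..x} (\<lambda>t. Q t * e t)) \<le> integral {0..x} (\<lambda>t. k t * norm (e t))"
    if x: "x \<in> {0..pi}" for x
  proof -
    have "norm (integral {0..x} (\<lambda>t. pi *\<^sub>R (Q t * e t))) \<le> integral {0..x} (\<lambda>t. k t * norm (e t))"
    proof (rule Henstock_Kurzweil_Integration.integral_norm_bound_integral)
      show "(\<lambda>t. pi *\<^sub>R (Q t * e t)) integrable_on {0..x}"
        by (intro integrable_cmul integrable_on_subinterval[OF Qe]) (use x in auto)
      show "(\<lambda>t. k t * norm (e t)) integrable_on {0..x}"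
        by (intro integrable_on_subinterval[OF ke]) (use x in auto)
      fix t assume "t \<in> {0..x}"
      then have "pi * norm (Q t) * norm (e t) \<le> k t * norm (e t)" using x by (intro mult_right_mono k(2)) auto
      then show "norm (pi *\<^sub>R (Q t * e t)) \<le> k t * norm (e t)" by (simp add: norm_mult mult.assoc)
    qed
    then show ?thesis by simp
  qed
  show "pi * norm (integral {0..x} (\<lambda>t. Q t * e t)) \<le> integral {0..x} (\<lambda>t. k t * norm (e t))"
    by (rule 1[OF x])
  define B where "B = integral {0..x} (\<lambda>t. k t * norm (e t)) / pi"
  have "norm (integral (cbox 0 x) (\<lambda>s. integral {0..s} (\<lambda>t. Q t * e t))) \<le> B * measure lborel (cbox 0 x)"
  proof (rule integrable_bound)
    have "0 \<le> integral {0..x} (\<lambda>t. k t * norm (e t))"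
      using 1[OF x] by (meson mult_nonneg_nonneg norm_ge_zero order_trans pi_ge_zero)
    then show "0 \<le> B" by (simp add: B_def)
    have "continuous_on {0..pi} (\<lambda>s. integral {0..s} (\<lambda>t. Q t * e t))" by (rule continuous_on_indefinite[OF Qe])
    then have "continuous_on {0..x} (\<lambda>s. integral {0..s} (\<lambda>t. Q t * e t))"
      by (rule continuous_on_subset) (use x in auto)
    then show "(\<lambda>s. integral {0..s} (\<lambda>t. Q t * e t)) integrable_on cbox 0 x"
      by (simp add: integrable_continuous_real)
    fix s assume "s \<in> cbox 0 x"
    then have s: "s \<in> {0..pi}" "0 \<le> s" "s \<le> x" using x by auto
    have "pi * norm (integral {0..s} (\<lambda>t. Q t * e t)) \<le> integral {0..s} (\<lambda>t. k t * norm (e t))" by (rule 1[OF s(1)])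
    also have "\<dots> \<le> integral {0..x} (\<lambda>t. k t * norm (e t))"
      by (rule indefinite_integral_nonneg_mono[OF ke]) (use s x k0 in auto)
    finally show "norm (integral {0..s} (\<lambda>t. Q t * e t)) \<le> B" by (simp add: B_def field_simps)
  qed
  also have "\<dots> = B * x" using x by simp
  also have "\<dots> \<le> B * pi"
  proof (rule mult_left_mono)
    have "0 \<le> integral {0..x} (\<lambda>t. k t * norm (e t))"
      using 1[OF x] by (meson mult_nonneg_nonneg norm_ge_zero order_trans pi_ge_zero)
    then show "0 \<le> B" by (simp add: B_def)
  qed (use x in auto)
  also have "\<dots> = integral {0..x} (\<lambda>t. k t * norm (e t))" by (simp add: B_def)
  finally show "norm (integral {0..x} (\<lambda>s. integral {0..s} (\<lambda>t. Q t * e t))) \<le> integral {0..x} (\<lambda>t. k t * norm (e t))"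
    by simp
qed

lemma edge_solution_unique:
  assumes p: "continuous_on {0..pi} p" and q: "q absolutely_integrable_on {0..pi}"
    and y: "edge_solution p q lam y dy" and z: "edge_solution p q lam z dz"
    and init: "y 0 = z 0" "dy 0 = dz 0" and x: "x \<in> {0..pi}"
  shows "y x = z x" "dy x = dz x"
proof -
  define e de where "e x = y x - z x" and "de x = dy x - dz x" for x
  have ac: "ac_deriv 0 pi e de" "ac_deriv 0 pi de (\<lambda>x. pot p q lam x * e x)"
    using y z ac_deriv_diff[of 0 pi y dy z dz] ac_deriv_diff[of 0 pi dy "\<lambda>x. pot p q lam x * y x" dz "\<lambda>x. pot p q lam x * z x"]
    by (auto simp: edge_solution_iff_ac_deriv e_def[abs_def] de_def[abs_def] right_diff_distrib)
  have e0: "e 0 = 0" "de 0 = 0" using init by (auto simp: e_def de_def)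
  have Q: "pot p q lam absolutely_integrable_on {0..pi}" by (rule pot_absolutely_integrable[OF p q])
  define k where "k t = pi * norm (pot p q lam t)" for t
  have k: "k integrable_on {0..pi}" "\<And>t. t \<in> {0..pi} \<Longrightarrow> 0 \<le> k t"
    using integrable_cmul[of "\<lambda>t. norm (pot p q lam t)" "{0..pi}" pi] Q
    by (auto simp: k_def[abs_def] absolutely_integrable_on_def)
  have ec: "continuous_on {0..pi} e" by (rule ac_deriv_continuous_on[OF ac(1)])
  have de: "de t = integral {0..t} (\<lambda>t. pot p q lam t * e t)" if "t \<in> {0..pi}" for t
    using ac_deriv_integral(2)[OF ac(2), of 0 t] that e0 by auto
  have ei: "e t = integral {0..t} (\<lambda>s. integral {0..s} (\<lambda>t. pot p q lam t * e t))" if "t \<in> {0..pi}" for t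
  proof -
    have "e t = integral {0..t} de" using ac_deriv_integral(2)[OF ac(1), of 0 t] that e0 by auto
    also have "\<dots> = integral {0..t} (\<lambda>s. integral {0..s} (\<lambda>t. pot p q lam t * e t))"
      by (rule integral_cong) (use de that in auto)
    finally show ?thesis .
  qed
  have bd: "norm (e t) \<le> 2 * 0 * exp (2 * integral {0..pi} k)" if "t \<in> {0..pi}" for t
  proof (rule gronwall[OF k, where u = "\<lambda>t. norm (e t)"])
    fix s assume s: "s \<in> {0..pi}"
    show "norm (e s) \<le> 0 + integral {0..s} (\<lambda>t. k t * norm (e t))"
      using double_integral_bound(2)[OF Q ec s k(1)] ei[OF s] by (simp add: k_def)
  qed (use that ec in \<open>auto intro!: continuous_intros\<close>)
  have ez: "e t = 0" if "t \<in> {0..pi}" for t using bd[OF that] by simp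
  show "y x = z x" using ez[OF x] by (simp add: e_def)
  have "integral {0..x} (\<lambda>t. pot p q lam t * e t) = integral {0..x} (\<lambda>t. 0)"
    by (rule integral_cong) (use ez x in auto)
  then show "dy x = dz x" using de[OF x] by (simp add: de_def)
qed

text \<open>Functions on \<open>[0,\<pi>]\<close> that are polynomials in the parameter with continuous coefficients. The class is
  closed under the operations of a Picard step, so the iterates are holomorphic in the parameter with no
  need to differentiate under the integral.\<close>

definition polynomial_family :: "(complex \<Rightarrow> real \<Rightarrow> complex) \<Rightarrow> bool" where
  "polynomial_family F \<longleftrightarrow> (\<exists>N c. (\<forall>k. continuous_on {0..pi} (c k)) \<and>
     (\<forall>z. \<forall>x\<in>{0..pi}. F z x = (\<Sum>k<(N::nat). z ^ k * c k x)))"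

lemma polynomial_family_cong:
  "polynomial_family F \<Longrightarrow> (\<And>z x. x \<in> {0..pi} \<Longrightarrow> F z x = G z x) \<Longrightarrow> polynomial_family G"
  unfolding polynomial_family_def by simp

lemma polynomial_family_holomorphic: "polynomial_family F \<Longrightarrow> x \<in> {0..pi} \<Longrightarrow> (\<lambda>z. F z x) holomorphic_on A"
  unfolding polynomial_family_def by (auto intro!: holomorphic_intros)

lemma polynomial_family_continuous: "polynomial_family F \<Longrightarrow> continuous_on {0..pi} (F z)"
proof -
  assume "polynomial_family F"
  then obtain N c where c: "\<And>k. continuous_on {0..pi} (c k)"
     "\<And>z x. x\<in>{0..pi} \<Longrightarrow> F z x = (\<Sum>k<(N::nat). z ^ k * c k x)" unfolding polynomial_family_def by blast
  have "continuous_on {0..pi} (\<lambda>x. \<Sum>k<N. z ^ k * c k x)" by (intro continuous_intros c)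
  then show ?thesis by (rule continuous_on_eq) (simp add: c(2))
qed

lemma polynomial_family_const:
  assumes "continuous_on {0..pi} c" shows "polynomial_family (\<lambda>z. c)"
  unfolding polynomial_family_def by (rule exI[of _ 1], rule exI[of _ "\<lambda>_. c"]) (simp add: assms)

lemma polynomial_family_add:
  assumes "polynomial_family F" "polynomial_family G" shows "polynomial_family (\<lambda>z x. F z x + G z x)"
proof -
  obtain N c where c: "\<And>k. continuous_on {0..pi} (c k)"
     "\<And>z x. x\<in>{0..pi} \<Longrightarrow> F z x = (\<Sum>k<(N::nat). z ^ k * c k x)" using assms(1) unfolding polynomial_family_def by blast
  obtain M d where d: "\<And>k. continuous_on {0..pi} (d k)"
     "\<And>z x. x\<in>{0..pi} \<Longrightarrow> G z x = (\<Sum>k<(M::nat). z ^ k * d k x)" using assms(2) unfolding polynomial_family_def by blast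
  have pad: "(\<Sum>k<n. z ^ k * f k x) = (\<Sum>k<n + m. z ^ k * (if k < n then f k x else 0))"
    for n m and f :: "nat \<Rightarrow> real \<Rightarrow> complex" and x z
    by (rule sum.mono_neutral_cong_left) auto
  show ?thesis unfolding polynomial_family_def
  proof (intro exI[of _ "N + M"] exI[of _ "\<lambda>k x. (if k < N then c k x else 0) + (if k < M then d k x else 0)"] conjI allI ballI)
    fix k show "continuous_on {0..pi} (\<lambda>x. (if k < N then c k x else 0) + (if k < M then d k x else 0))"
      by (cases "k < N"; cases "k < M") (auto intro!: continuous_intros c d)
  next
    fix z x assume x: "x \<in> {0..pi}"
    show "F z x + G z x = (\<Sum>k<N + M. z ^ k * ((if k < N then c k x else 0) + (if k < M then d k x else 0)))"
      unfolding c(2)[OF x] d(2)[OF x] distrib_left sum.distrib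
      using pad[where n = N and m = M and f = c and x = x and z = z]
        pad[where n = M and m = N and f = d and x = x and z = z] by (simp add: add.commute)
  qed
qed

lemma polynomial_family_times_param:
  assumes "polynomial_family F" shows "polynomial_family (\<lambda>z x. z * F z x)"
proof -
  obtain N c where c: "\<And>k. continuous_on {0..pi} (c k)"
     "\<And>z x. x\<in>{0..pi} \<Longrightarrow> F z x = (\<Sum>k<(N::nat). z ^ k * c k x)" using assms(1) unfolding polynomial_family_def by blast
  show ?thesis unfolding polynomial_family_def
  proof (intro exI[of _ "Suc N"] exI[of _ "\<lambda>k x. case k of 0 \<Rightarrow> 0 | Suc j \<Rightarrow> c j x"] conjI allI ballI)
    fix k show "continuous_on {0..pi} (\<lambda>x. case k of 0 \<Rightarrow> 0 | Suc j \<Rightarrow> c j x)"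
      by (cases k) (auto intro!: continuous_intros c)
  next
    fix z x assume x: "x \<in> {0..pi}"
    show "z * F z x = (\<Sum>k<Suc N. z ^ k * (case k of 0 \<Rightarrow> 0 | Suc j \<Rightarrow> c j x))"
      unfolding c(2)[OF x] by (subst sum.lessThan_Suc_shift) (simp add: sum_distrib_left mult.assoc)
  qed
qed

lemma polynomial_family_integral:
  assumes h: "h absolutely_integrable_on {0..pi}" and F: "polynomial_family F"
  shows "polynomial_family (\<lambda>z x. integral {0..x} (\<lambda>t. h t * F z t))"
proof -
  obtain N c where c: "\<And>k. continuous_on {0..pi} (c k)"
     "\<And>z x. x\<in>{0..pi} \<Longrightarrow> F z x = (\<Sum>k<(N::nat). z ^ k * c k x)" using F unfolding polynomial_family_def by blast
  have hc: "(\<lambda>t. h t * c k t) integrable_on {0..pi}" for k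
    using absolutely_integrable_times_continuous[OF h c(1)] by (simp add: absolutely_integrable_on_def)
  show ?thesis unfolding polynomial_family_def
  proof (intro exI[of _ N] exI[of _ "\<lambda>k x. integral {0..x} (\<lambda>t. h t * c k t)"] conjI allI ballI)
    fix k show "continuous_on {0..pi} (\<lambda>x. integral {0..x} (\<lambda>t. h t * c k t))"
      by (rule continuous_on_indefinite[OF hc])
  next
    fix z x assume x: "x \<in> {0..pi}"
    have "integral {0..x} (\<lambda>t. h t * F z t) = integral {0..x} (\<lambda>t. \<Sum>k<N. z ^ k * (h t * c k t))"
      by (rule integral_cong) (use c(2) x in \<open>auto simp: sum_distrib_left algebra_simps\<close>)
    also have "\<dots> = (\<Sum>k<N. integral {0..x} (\<lambda>t. z ^ k * (h t * c k t)))"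
    proof (rule integral_sum)
      fix k
      have "(\<lambda>t. h t * c k t) integrable_on {0..x}" by (rule integrable_on_subinterval[OF hc]) (use x in auto)
      then show "(\<lambda>t. z ^ k * (h t * c k t)) integrable_on {0..x}" by (rule integrable_on_mult_right)
    qed simp
    finally show "integral {0..x} (\<lambda>t. h t * F z t) = (\<Sum>k<N. z ^ k * integral {0..x} (\<lambda>t. h t * c k t))"
      by simp
  qed
qed

lemma polynomial_family_pot_integral:
  assumes p: "continuous_on {0..pi} p" and q: "q absolutely_integrable_on {0..pi}" and F: "polynomial_family F"
  shows "polynomial_family (\<lambda>z x. integral {0..x} (\<lambda>t. pot p q z t * F z t))"
proof -
  have pa: "(\<lambda>t. 2 * p t) absolutely_integrable_on {0..pi}"
    by (rule absolutely_integrable_continuous_real) (intro continuous_intros p)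
  have ca: "(\<lambda>t::real. -1 :: complex) absolutely_integrable_on {0..pi}"
    by (rule absolutely_integrable_continuous_real) (intro continuous_intros)
  have "polynomial_family (\<lambda>z x. integral {0..x} (\<lambda>t. q t * F z t) + (z * integral {0..x} (\<lambda>t. (2 * p t) * F z t)
     + z * (z * integral {0..x} (\<lambda>t. (-1) * F z t))))"
    by (intro polynomial_family_add polynomial_family_times_param polynomial_family_integral q pa ca F)
  then show ?thesis
  proof (rule polynomial_family_cong)
    fix z x assume x: "x \<in> {0..pi}"
    have i: "(\<lambda>t. h t * F z t) integrable_on {0..x}" if "h absolutely_integrable_on {0..pi}" for h
    proof (rule integrable_on_subinterval)
      show "(\<lambda>t. h t * F z t) integrable_on {0..pi}"
        using absolutely_integrable_times_continuous[OF that polynomial_family_continuous[OF F]] by (simp add: absolutely_integrable_on_def)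
    qed (use x in auto)
    have "((\<lambda>t. q t * F z t + (z * ((2 * p t) * F z t) + z * (z * ((-1) * F z t)))) has_integral
       integral {0..x} (\<lambda>t. q t * F z t) + (z * integral {0..x} (\<lambda>t. (2 * p t) * F z t)
     + z * (z * integral {0..x} (\<lambda>t. (-1) * F z t)))) {0..x}"
      by (intro has_integral_add has_integral_mult_right integrable_integral i q pa ca)
    moreover have "(\<lambda>t. q t * F z t + (z * ((2 * p t) * F z t) + z * (z * ((-1) * F z t)))) = (\<lambda>t. pot p q z t * F z t)"
      by (simp add: pot_def fun_eq_iff algebra_simps power2_eq_square)
    ultimately show "integral {0..x} (\<lambda>t. q t * F z t) + (z * integral {0..x} (\<lambda>t. (2 * p t) * F z t)
     + z * (z * integral {0..x} (\<lambda>t. (-1) * F z t))) = integral {0..x} (\<lambda>t. pot p q z t * F z t)"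
      by (simp add: integral_unique)
  qed
qed

primrec picard :: "(real \<Rightarrow> complex) \<Rightarrow> (real \<Rightarrow> complex) \<Rightarrow> complex \<Rightarrow> complex \<Rightarrow> nat \<Rightarrow> complex \<Rightarrow> real \<Rightarrow> complex" where
  "picard p q a b 0 z x = a + integral {0..x} (\<lambda>s. b)"
| "picard p q a b (Suc n) z x =
     a + integral {0..x} (\<lambda>s. b + integral {0..s} (\<lambda>t. pot p q z t * picard p q a b n z t))"

lemma polynomial_family_picard:
  assumes p: "continuous_on {0..pi} p" and q: "q absolutely_integrable_on {0..pi}"
  shows "polynomial_family (picard p q a b n)"
proof (induction n)
  case 0
  have "polynomial_family (\<lambda>z x. a + integral {0..x} (\<lambda>s. b))"
    by (intro polynomial_family_const continuous_intros continuous_on_indefinite integrable_const_ivl)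
  then show ?case by (rule polynomial_family_cong) simp
next
  case (Suc n)
  have 1: "(\<lambda>t::real. 1::complex) absolutely_integrable_on {0..pi}"
    by (rule absolutely_integrable_continuous_real) (intro continuous_intros)
  have "polynomial_family (\<lambda>z x. a + integral {0..x} (\<lambda>s. 1 * (b + integral {0..s} (\<lambda>t. pot p q z t * picard p q a b n z t))))"
    by (intro polynomial_family_add[OF polynomial_family_const] polynomial_family_integral[OF 1] polynomial_family_pot_integral p q Suc continuous_intros)
  then show ?case by (rule polynomial_family_cong) simp
qed

lemma geometric_increments_converge:
  fixes s :: "nat \<Rightarrow> complex"
  assumes "\<And>n. norm (s (Suc n) - s n) \<le> B * (1/2) ^ n"
  shows "s \<longlonglongrightarrow> lim s" "norm (lim s - s n) \<le> 2 * B * (1/2) ^ n"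
proof -
  have inc: "norm (s (n + m) - s n) \<le> 2 * B * ((1/2) ^ n - (1/2) ^ (n + m))" for n m
  proof (induction m)
    case (Suc m)
    have "norm (s (n + Suc m) - s n) \<le> norm (s (Suc (n + m)) - s (n + m)) + norm (s (n + m) - s n)"
      using norm_triangle_ineq[of "s (Suc (n + m)) - s (n + m)" "s (n + m) - s n"] by simp
    also have "\<dots> \<le> B * (1/2) ^ (n + m) + 2 * B * ((1/2) ^ n - (1/2) ^ (n + m))"
      using assms Suc by (intro add_mono)
    also have "\<dots> = 2 * B * ((1/2) ^ n - (1/2) ^ (n + Suc m))" by (simp add: algebra_simps)
    finally show ?case .
  qed simp
  have B: "B \<ge> 0" using order_trans[OF norm_ge_zero assms[of 0]] by simp
  have inc': "norm (s (n + m) - s n) \<le> 2 * B * (1/2) ^ n" for n m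
    using inc[of n m] B by (simp add: algebra_simps) (smt (verit) mult_nonneg_nonneg zero_le_power zero_le_divide_1_iff)
  have lim0: "(\<lambda>n. 2 * B * (1/2) ^ n) \<longlonglongrightarrow> 0"
    by (intro tendsto_mult_right_zero LIMSEQ_realpow_zero) auto
  have "Cauchy s"
  proof (rule CauchyI')
    fix e :: real assume "e > 0"
    then have "\<forall>\<^sub>F n in sequentially. 2 * B * (1/2) ^ n < e" using lim0 by (intro order_tendstoD)
    then obtain M where M: "\<And>n. n \<ge> M \<Longrightarrow> 2 * B * (1/2) ^ n < e" by (auto simp: eventually_sequentially)
    show "\<exists>M. \<forall>m\<ge>M. \<forall>n>m. dist (s m) (s n) < e"
    proof (intro exI[of _ M] allI impI)
      fix m n assume mn: "M \<le> m" "m < n"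
      then have "norm (s (m + (n - m)) - s m) \<le> 2 * B * (1/2) ^ m" by (intro inc')
      then show "dist (s m) (s n) < e" using M[OF mn(1)] mn by (simp add: dist_norm norm_minus_commute)
    qed
  qed
  then show L: "s \<longlonglongrightarrow> lim s" by (simp add: Cauchy_convergent convergent_LIMSEQ_iff[symmetric])
  have "(\<lambda>m. norm (s (n + m) - s n)) \<longlonglongrightarrow> norm (lim s - s n)"
    using LIMSEQ_ignore_initial_segment[OF L, of n] by (intro tendsto_intros) (simp add: add.commute)
  then show "norm (lim s - s n) \<le> 2 * B * (1/2) ^ n"
    by (rule LIMSEQ_le_const2) (use inc' in auto)
qed

context
  fixes p q :: "real \<Rightarrow> complex" and a b :: complex
  assumes p: "continuous_on {0..pi} p" and q: "q absolutely_integrable_on {0..pi}"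
begin

text \<open>A single weight \<open>k\<close> dominates \<open>\<pi>\<close> times the coefficient of the equation for all parameters in a
  disc, so that the factor one half per step is uniform on the disc.\<close>

lemma picard_increment:
  assumes "R \<ge> 0"
  shows "\<exists>B. \<forall>z n. \<forall>x\<in>{0..pi}. norm z \<le> R \<longrightarrow>
     norm (picard p q a b (Suc n) z x - picard p q a b n z x) \<le> B * (1/2) ^ n"
proof -
  define k where "k t = pi * (norm (q t) + 2 * R * norm (p t) + R\<^sup>2)" for t
  have k: "k integrable_on {0..pi}" "\<And>t. t \<in> {0..pi} \<Longrightarrow> 0 \<le> k t"
  proof -
    have "(\<lambda>t. norm (q t)) integrable_on {0..pi}" using q by (simp add: absolutely_integrable_on_def)
    moreover have "(\<lambda>t. 2 * R * norm (p t) + R\<^sup>2) integrable_on {0..pi}"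
      by (intro integrable_continuous_real continuous_intros p)
    ultimately have "(\<lambda>t. pi *\<^sub>R (norm (q t) + (2 * R * norm (p t) + R\<^sup>2))) integrable_on {0..pi}"
      by (intro integrable_cmul) (rule integrable_add)
    moreover have "k = (\<lambda>t. pi *\<^sub>R (norm (q t) + (2 * R * norm (p t) + R\<^sup>2)))"
      by (simp add: k_def fun_eq_iff algebra_simps)
    ultimately show "k integrable_on {0..pi}" by (simp only:)
    show "0 \<le> k t" for t using assms by (simp add: k_def)
  qed
  have kp: "pi * norm (pot p q z t) \<le> k t" if "norm z \<le> R" for z t
  proof -
    have "norm (pot p q z t) \<le> norm (q t + 2 * z * p t) + norm (z\<^sup>2)" unfolding pot_def by (rule norm_triangle_ineq4)
    also have "\<dots> \<le> norm (q t) + norm (2 * z * p t) + norm (z\<^sup>2)" by (intro add_mono norm_triangle_ineq order_refl)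
    also have "\<dots> \<le> norm (q t) + 2 * R * norm (p t) + R\<^sup>2"
      using that assms by (auto simp: norm_mult norm_power intro!: add_mono mult_mono power_mono)
    finally show ?thesis unfolding k_def by (intro mult_left_mono) auto
  qed
  define M where "M = norm a + pi * norm b"
  have M: "M \<ge> 0" by (simp add: M_def)
  have pc: "continuous_on {0..pi} (picard p q a b n z)" for n z
    by (rule polynomial_family_continuous[OF polynomial_family_picard[OF p q]])
  have int: "(\<lambda>t. pot p q z t * f t) integrable_on {0..x}" if "continuous_on {0..pi} f" "x \<in> {0..pi}" for z f x
  proof (rule integrable_on_subinterval)
    show "(\<lambda>t. pot p q z t * f t) integrable_on {0..pi}"
      using absolutely_integrable_times_continuous[OF pot_absolutely_integrable[OF p q] that(1)]
      by (simp add: absolutely_integrable_on_def)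
  qed (use that in auto)
  have int2: "(\<lambda>s. integral {0..s} (\<lambda>t. pot p q z t * f t)) integrable_on {0..x}"
    if f: "continuous_on {0..pi} f" and x: "x \<in> {0..pi}" for z f x
  proof (rule integrable_on_subinterval)
    show "(\<lambda>s. integral {0..s} (\<lambda>t. pot p q z t * f t)) integrable_on {0..pi}"
      by (rule integrable_continuous_real, rule continuous_on_indefinite, rule int[OF f]) simp
  qed (use x in auto)
  have dd: "norm (picard p q a b (Suc n) z x - picard p q a b n z x) \<le> M * (1/2) ^ n * exp (2 * integral {0..x} k)"
    if z: "norm z \<le> R" and x: "x \<in> {0..pi}" for n z x
    using x
  proof (induction n arbitrary: x)
    case 0
    have "picard p q a b (Suc 0) z x - picard p q a b 0 z x
        = integral {0..x} (\<lambda>s. integral {0..s} (\<lambda>t. pot p q z t * picard p q a b 0 z t))"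
    proof -
      have "integral {0..x} (\<lambda>s. b + integral {0..s} (\<lambda>t. pot p q z t * picard p q a b 0 z t))
        = integral {0..x} (\<lambda>s. b) + integral {0..x} (\<lambda>s. integral {0..s} (\<lambda>t. pot p q z t * picard p q a b 0 z t))"
        by (rule Henstock_Kurzweil_Integration.integral_add[OF integrable_const_ivl int2[OF pc 0]])
      then have "picard p q a b (Suc 0) z x = a + (integral {0..x} (\<lambda>s. b)
          + integral {0..x} (\<lambda>s. integral {0..s} (\<lambda>t. pot p q z t * picard p q a b 0 z t)))"
        by (simp only: picard.simps(2))
      moreover have "picard p q a b 0 z x = a + integral {0..x} (\<lambda>s. b)" by (rule picard.simps(1))
      ultimately show ?thesis by (simp only: add_diff_cancel_left add_diff_cancel_left')
    qed
    also have "norm \<dots> \<le> integral {0..x} (\<lambda>t. k t * norm (picard p q a b 0 z t))"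
      by (rule double_integral_bound(2)[OF pot_absolutely_integrable[OF p q] pc 0 k(1) kp[OF z]])
    also have "\<dots> \<le> M / 2 * exp (2 * integral {0..x} k)"
    proof (rule integral_weighted_exp_le[OF k _ _ 0 M])
      fix t assume t: "t \<in> {0..pi}"
      have "norm (picard p q a b 0 z t) \<le> norm a + norm (integral {0..t} (\<lambda>s. b))"
        by (simp add: norm_triangle_ineq del: integral_const_real)
      also have "\<dots> \<le> M" using t by (simp add: M_def mult_right_mono)
      also have "\<dots> \<le> M * exp (2 * integral {0..t} k)"
        using M indefinite_integral_nonneg_mono[OF k, of 0 t] t by (simp add: mult_le_cancel_left1)
      finally show "norm (picard p q a b 0 z t) \<le> M * exp (2 * integral {0..t} k)" .
    next
      show "continuous_on {0..pi} (\<lambda>t. norm (picard p q a b 0 z t))" by (intro continuous_intros pc)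
    qed
    also have "\<dots> \<le> M * (1/2) ^ 0 * exp (2 * integral {0..x} k)" using M by simp
    finally show ?case .
  next
    case (Suc n)
    define e where "e t = picard p q a b (Suc n) z t - picard p q a b n z t" for t
    have ec: "continuous_on {0..pi} e" unfolding e_def by (intro continuous_intros pc)
    have "picard p q a b (Suc (Suc n)) z x - picard p q a b (Suc n) z x =
       integral {0..x} (\<lambda>s. (b + integral {0..s} (\<lambda>t. pot p q z t * picard p q a b (Suc n) z t))
         - (b + integral {0..s} (\<lambda>t. pot p q z t * picard p q a b n z t)))"
      unfolding picard.simps(2)[of p q a b "Suc n"] picard.simps(2)[of p q a b n z x]
      by (subst Henstock_Kurzweil_Integration.integral_diff)
        (auto intro!: integrable_add int2 pc Suc.prems simp del: picard.simps)
    also have "\<dots> = integral {0..x} (\<lambda>s. integral {0..s} (\<lambda>t. pot p q z t * e t))"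
    proof (rule integral_cong)
      fix s assume "s \<in> {0..x}"
      then have s: "s \<in> {0..pi}" using Suc.prems by auto
      show "(b + integral {0..s} (\<lambda>t. pot p q z t * picard p q a b (Suc n) z t))
         - (b + integral {0..s} (\<lambda>t. pot p q z t * picard p q a b n z t)) = integral {0..s} (\<lambda>t. pot p q z t * e t)"
        using int[OF pc[of "Suc n" z] s, of z] int[OF pc[of n z] s, of z]
        by (simp add: e_def right_diff_distrib Henstock_Kurzweil_Integration.integral_diff del: picard.simps)
    qed
    also have "norm \<dots> \<le> integral {0..x} (\<lambda>t. k t * norm (e t))"
      by (rule double_integral_bound(2)[OF pot_absolutely_integrable[OF p q] ec Suc.prems k(1) kp[OF z]])
    also have "\<dots> \<le> M * (1/2) ^ n / 2 * exp (2 * integral {0..x} k)"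
    proof (rule integral_weighted_exp_le[OF k _ _ Suc.prems])
      fix t assume t: "t \<in> {0..pi}"
      show "norm (e t) \<le> M * (1/2) ^ n * exp (2 * integral {0..t} k)" unfolding e_def by (rule Suc.IH[OF t])
    qed (use M ec in \<open>auto intro!: continuous_intros\<close>)
    also have "\<dots> = M * (1/2) ^ Suc n * exp (2 * integral {0..x} k)" by simp
    finally show ?case .
  qed
  show ?thesis
  proof (intro exI[of _ "M * exp (2 * integral {0..pi} k)"] allI ballI impI)
    fix z :: complex and n :: nat and x :: real assume x: "x \<in> {0..pi}" and z: "norm z \<le> R"
    have "norm (picard p q a b (Suc n) z x - picard p q a b n z x) \<le> M * (1/2) ^ n * exp (2 * integral {0..x} k)"
      by (rule dd[OF z x])
    also have "\<dots> \<le> M * (1/2) ^ n * exp (2 * integral {0..pi} k)"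
      using indefinite_integral_nonneg_mono[OF k, of x pi] x M by (intro mult_left_mono) auto
    finally show "norm (picard p q a b (Suc n) z x - picard p q a b n z x) \<le> M * exp (2 * integral {0..pi} k) * (1/2) ^ n"
      by (simp add: mult.commute mult.left_commute)
  qed
qed

definition "picard_limit z x = lim (\<lambda>n. picard p q a b n z x)"
definition "picard_limit_deriv z x = b + integral {0..x} (\<lambda>t. pot p q z t * picard_limit z t)"

lemma picard_limit_bound:
  assumes "R \<ge> 0"
  shows "\<exists>B\<ge>0. \<forall>z n. \<forall>x\<in>{0..pi}. norm z \<le> R \<longrightarrow> norm (picard_limit z x - picard p q a b n z x) \<le> B * (1/2) ^ n"
proof -
  obtain B where B: "\<And>z n x. x\<in>{0..pi} \<Longrightarrow> norm z \<le> R \<Longrightarrow>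
     norm (picard p q a b (Suc n) z x - picard p q a b n z x) \<le> B * (1/2) ^ n"
    using picard_increment[OF assms] by blast
  have "B \<ge> 0" using order_trans[OF norm_ge_zero B[of 0 0 0]] assms by simp
  show ?thesis
  proof (intro exI[of _ "2 * B"] conjI allI ballI impI)
    show "0 \<le> 2 * B" using \<open>B \<ge> 0\<close> by simp
    fix z :: complex and n :: nat and x :: real assume "x \<in> {0..pi}" "norm z \<le> R"
    then show "norm (picard_limit z x - picard p q a b n z x) \<le> 2 * B * (1/2) ^ n"
      unfolding picard_limit_def
      by (intro geometric_increments_converge(2)[of "\<lambda>n. picard p q a b n z x"] B)
  qed
qed

lemma picard_limit_uniform:
  assumes "R \<ge> 0"
  shows "uniform_limit ({0..pi} \<times> cball 0 R) (\<lambda>n u. picard p q a b n (snd u) (fst u))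
            (\<lambda>u. picard_limit (snd u) (fst u)) sequentially"
proof -
  obtain B where B: "B \<ge> 0" "\<And>z n x. x\<in>{0..pi} \<Longrightarrow> norm z \<le> R \<Longrightarrow> norm (picard_limit z x - picard p q a b n z x) \<le> B * (1/2) ^ n"
    using picard_limit_bound[OF assms] by blast
  have lim0: "(\<lambda>n. B * (1/2) ^ n) \<longlonglongrightarrow> 0"
    by (intro tendsto_mult_right_zero LIMSEQ_realpow_zero) auto
  show ?thesis
  proof (rule uniform_limitI)
    fix e :: real assume "e > 0"
    then have "\<forall>\<^sub>F n in sequentially. B * (1/2) ^ n < e" using lim0 by (intro order_tendstoD)
    then show "\<forall>\<^sub>F n in sequentially. \<forall>u\<in>{0..pi} \<times> cball 0 R.
        dist (picard p q a b n (snd u) (fst u)) (picard_limit (snd u) (fst u)) < e"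
    proof (rule eventually_mono)
      fix n assume n: "B * (1/2) ^ n < e"
      show "\<forall>u\<in>{0..pi} \<times> cball 0 R.
        dist (picard p q a b n (snd u) (fst u)) (picard_limit (snd u) (fst u)) < e"
      proof
        fix u :: "real \<times> complex" assume u: "u \<in> {0..pi} \<times> cball 0 R"
        have "norm (picard_limit (snd u) (fst u) - picard p q a b n (snd u) (fst u)) \<le> B * (1/2) ^ n"
          by (rule B(2)) (use u in auto)
        then show "dist (picard p q a b n (snd u) (fst u)) (picard_limit (snd u) (fst u)) < e"
          using n by (simp add: dist_norm norm_minus_commute)
      qed
    qed
  qed
qed

lemma picard_limit_continuous: "continuous_on {0..pi} (picard_limit z)"
proof (rule uniform_limit_theorem)
  have "uniform_limit ({0..pi} \<times> cball 0 (norm z)) (\<lambda>n u. picard p q a b n (snd u) (fst u))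
            (\<lambda>u. picard_limit (snd u) (fst u)) sequentially" by (rule picard_limit_uniform) simp
  from uniform_limit_compose'[OF this, of "\<lambda>x. (x, z)" "{0..pi}"]
  show "uniform_limit {0..pi} (\<lambda>n x. picard p q a b n z x) (picard_limit z) sequentially" by simp
  show "\<forall>\<^sub>F n in sequentially. continuous_on {0..pi} (picard p q a b n z)"
    using polynomial_family_continuous[OF polynomial_family_picard[OF p q]] by simp
qed simp

lemma pot_picard_integrable:
  assumes "continuous_on {0..pi} f" "x \<in> {0..pi}"
  shows "(\<lambda>t. pot p q z t * f t) integrable_on {0..x}"
proof (rule integrable_on_subinterval)
  show "(\<lambda>t. pot p q z t * f t) integrable_on {0..pi}"
    using absolutely_integrable_times_continuous[OF pot_absolutely_integrable[OF p q] assms(1)]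
    by (simp add: absolutely_integrable_on_def)
qed (use assms in auto)

lemma picard_limit_deriv_uniform:
  assumes "R \<ge> 0"
  shows "\<exists>B\<ge>0. \<forall>z n. \<forall>x\<in>{0..pi}. norm z \<le> R \<longrightarrow>
     norm (picard_limit_deriv z x - (b + integral {0..x} (\<lambda>t. pot p q z t * picard p q a b n z t))) \<le> B * (1/2) ^ n"
proof -
  obtain B where B: "B \<ge> 0" "\<And>z n x. x\<in>{0..pi} \<Longrightarrow> norm z \<le> R \<Longrightarrow> norm (picard_limit z x - picard p q a b n z x) \<le> B * (1/2) ^ n"
    using picard_limit_bound[OF assms] by blast
  define k where "k t = norm (q t) + 2 * R * norm (p t) + R\<^sup>2" for t
  have k: "k integrable_on {0..pi}" "0 \<le> k t" for t
  proof -
    have "(\<lambda>t. norm (q t)) integrable_on {0..pi}" using q by (simp add: absolutely_integrable_on_def)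
    moreover have "(\<lambda>t. 2 * R * norm (p t) + R\<^sup>2) integrable_on {0..pi}"
      by (intro integrable_continuous_real continuous_intros p)
    ultimately have "(\<lambda>t. norm (q t) + (2 * R * norm (p t) + R\<^sup>2)) integrable_on {0..pi}"
      by (rule integrable_add)
    moreover have "k = (\<lambda>t. (norm (q t) + (2 * R * norm (p t) + R\<^sup>2)))"
      by (simp add: k_def fun_eq_iff algebra_simps)
    ultimately show "k integrable_on {0..pi}" by (simp only:)
    show "0 \<le> k t" for t using assms by (simp add: k_def)
  qed
  have kp: "norm (pot p q z t) \<le> k t" if "norm z \<le> R" for z t
  proof -
    have "norm (pot p q z t) \<le> norm (q t + 2 * z * p t) + norm (z\<^sup>2)" unfolding pot_def by (rule norm_triangle_ineq4)
    also have "\<dots> \<le> norm (q t) + norm (2 * z * p t) + norm (z\<^sup>2)" by (intro add_mono norm_triangle_ineq order_refl)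
    also have "\<dots> \<le> k t" unfolding k_def
      using that assms by (auto simp: norm_mult norm_power intro!: add_mono mult_mono power_mono)
    finally show ?thesis .
  qed
  show ?thesis
  proof (intro exI[of _ "B * integral {0..pi} k"] conjI allI ballI impI)
    show "0 \<le> B * integral {0..pi} k" using B(1) k by (intro mult_nonneg_nonneg integral_nonneg) auto
    fix z :: complex and n :: nat and x :: real assume x: "x \<in> {0..pi}" and z: "norm z \<le> R"
    have i1: "(\<lambda>t. pot p q z t * picard_limit z t) integrable_on {0..x}"
      by (rule pot_picard_integrable[OF picard_limit_continuous x])
    have i2: "(\<lambda>t. pot p q z t * picard p q a b n z t) integrable_on {0..x}"
      by (rule pot_picard_integrable[OF polynomial_family_continuous[OF polynomial_family_picard[OF p q]] x])
    have kx: "k integrable_on {0..x}" by (rule integrable_on_subinterval[OF k(1)]) (use x in auto)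
    have "norm (picard_limit_deriv z x - (b + integral {0..x} (\<lambda>t. pot p q z t * picard p q a b n z t)))
      = norm (integral {0..x} (\<lambda>t. pot p q z t * picard_limit z t - pot p q z t * picard p q a b n z t))"
      unfolding picard_limit_deriv_def
      by (subst Henstock_Kurzweil_Integration.integral_diff[OF i1 i2]) simp
    also have "\<dots> \<le> integral {0..x} (\<lambda>t. (B * (1/2) ^ n) *\<^sub>R k t)"
    proof (rule Henstock_Kurzweil_Integration.integral_norm_bound_integral)
      fix t assume "t \<in> {0..x}"
      then have t: "t \<in> {0..pi}" using x by auto
      have "norm (pot p q z t * picard_limit z t - pot p q z t * picard p q a b n z t)
         = norm (picard_limit z t - picard p q a b n z t) * norm (pot p q z t)"
        by (simp add: norm_mult[symmetric] algebra_simps)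
      also have "\<dots> \<le> (B * (1/2) ^ n) * k t" using B(1) by (intro mult_mono B(2) kp t z) auto
      finally show "norm (pot p q z t * picard_limit z t - pot p q z t * picard p q a b n z t) \<le> (B * (1/2) ^ n) *\<^sub>R k t"
        by simp
    qed (intro integrable_diff integrable_cmul i1 i2 kx)+
    also have "\<dots> = B * (1/2) ^ n * integral {0..x} k" by simp
    also have "\<dots> \<le> B * (1/2) ^ n * integral {0..pi} k"
      using indefinite_integral_nonneg_mono[OF k, of x pi] x B(1) by (intro mult_left_mono) auto
    finally show "norm (picard_limit_deriv z x - (b + integral {0..x} (\<lambda>t. pot p q z t * picard p q a b n z t))) \<le> B * integral {0..pi} k * (1/2) ^ n"
      by (simp add: mult_ac)
  qed
qed

lemma picard_limit_deriv_continuous: "continuous_on {0..pi} (picard_limit_deriv z)"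
  unfolding picard_limit_deriv_def
  by (intro continuous_intros continuous_on_indefinite pot_picard_integrable picard_limit_continuous) auto

lemma picard_limit_integral:
  assumes x: "x \<in> {0..pi}"
  shows "picard_limit z x = a + integral {0..x} (picard_limit_deriv z)"
proof -
  obtain B where B: "B \<ge> 0" "\<And>w n x. x\<in>{0..pi} \<Longrightarrow> norm w \<le> norm z \<Longrightarrow> norm (picard_limit w x - picard p q a b n w x) \<le> B * (1/2) ^ n"
    using picard_limit_bound[OF norm_ge_zero] by blast
  obtain D where D: "D \<ge> 0" "\<And>w n x. x\<in>{0..pi} \<Longrightarrow> norm w \<le> norm z \<Longrightarrow>
     norm (picard_limit_deriv w x - (b + integral {0..x} (\<lambda>t. pot p q w t * picard p q a b n w t))) \<le> D * (1/2) ^ n"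
    using picard_limit_deriv_uniform[OF norm_ge_zero] by blast
  have le: "norm (picard_limit z x - (a + integral {0..x} (picard_limit_deriv z))) \<le> (B + D * pi) * (1/2) ^ n" for n
  proof -
    define g where "g s = b + integral {0..s} (\<lambda>t. pot p q z t * picard p q a b n z t)" for s
    have gc: "continuous_on {0..pi} g" unfolding g_def
      by (intro continuous_intros continuous_on_indefinite pot_picard_integrable polynomial_family_continuous[OF polynomial_family_picard[OF p q]]) auto
    have i: "picard_limit_deriv z integrable_on {0..x}" "g integrable_on {0..x}"
      by (intro integrable_continuous_real continuous_on_subset[OF picard_limit_deriv_continuous] continuous_on_subset[OF gc]; use x in auto)+
    have "norm (integral (cbox 0 x) (\<lambda>s. picard_limit_deriv z s - g s)) \<le> (D * (1/2) ^ n) * measure lborel (cbox 0 x)"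
    proof (rule integrable_bound)
      show "(\<lambda>s. picard_limit_deriv z s - g s) integrable_on cbox 0 x" using i by (auto intro: integrable_diff)
      show "norm (picard_limit_deriv z s - g s) \<le> D * (1/2) ^ n" if "s \<in> cbox 0 x" for s
        unfolding g_def by (rule D(2)) (use that x in auto)
    qed (use D(1) in simp)
    also have "\<dots> \<le> (D * (1/2) ^ n) * pi" using x D(1) by (intro mult_left_mono) auto
    finally have 1: "norm (integral {0..x} (picard_limit_deriv z) - integral {0..x} g) \<le> D * pi * (1/2) ^ n"
      using Henstock_Kurzweil_Integration.integral_diff[OF i] by (simp add: mult_ac)
    have 2: "norm (picard_limit z x - (a + integral {0..x} g)) \<le> B * (1/2) ^ Suc n"
      using B(2)[OF x, of z "Suc n"] by (simp add: g_def[abs_def])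
    have 3: "B * (1/2) ^ Suc n \<le> B * (1/2) ^ n" using B(1) by simp
    have "norm (picard_limit z x - (a + integral {0..x} (picard_limit_deriv z))) =
      norm ((picard_limit z x - (a + integral {0..x} g)) - (integral {0..x} (picard_limit_deriv z) - integral {0..x} g))"
      by (simp add: algebra_simps)
    also have "\<dots> \<le> norm (picard_limit z x - (a + integral {0..x} g)) + norm (integral {0..x} (picard_limit_deriv z) - integral {0..x} g)"
      by (rule norm_triangle_ineq4)
    also have "\<dots> \<le> (B + D * pi) * (1/2) ^ n" using 1 2 3 by (simp only: distrib_right)
    finally show ?thesis .
  qed
  have "(\<lambda>n. (B + D * pi) * (1/2) ^ n) \<longlonglongrightarrow> 0"
    by (intro tendsto_mult_right_zero LIMSEQ_realpow_zero) auto
  then have "norm (picard_limit z x - (a + integral {0..x} (picard_limit_deriv z))) \<le> 0"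
    by (rule LIMSEQ_le_const) (use le in auto)
  then show ?thesis by simp
qed

lemma picard_limit_edge_solution:
  "edge_solution p q z (picard_limit z) (picard_limit_deriv z)"
  "picard_limit z 0 = a" "picard_limit_deriv z 0 = b"
proof -
  have "ac_deriv 0 pi (\<lambda>x. a + integral {0..x} (picard_limit_deriv z)) (picard_limit_deriv z)"
    by (intro ac_deriv_indefinite_integral absolutely_integrable_continuous_real picard_limit_deriv_continuous)
  then have 1: "ac_deriv 0 pi (picard_limit z) (picard_limit_deriv z)"
    by (rule ac_deriv_cong) (simp_all add: picard_limit_integral)
  have 2: "ac_deriv 0 pi (picard_limit_deriv z) (\<lambda>x. pot p q z x * picard_limit z x)"
    unfolding picard_limit_deriv_def
    by (intro ac_deriv_indefinite_integral absolutely_integrable_times_continuous pot_absolutely_integrable p q picard_limit_continuous)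
  show "edge_solution p q z (picard_limit z) (picard_limit_deriv z)"
    unfolding edge_solution_iff_ac_deriv using 1 2 by blast
  show "picard_limit z 0 = a" using picard_limit_integral[of 0 z] by simp
  show "picard_limit_deriv z 0 = b" by (simp add: picard_limit_deriv_def)
qed

lemma picard_limit_holomorphic:
  assumes x: "x \<in> {0..pi}"
  shows "(\<lambda>z. picard_limit z x) holomorphic_on UNIV"
proof (rule holomorphic_uniform_sequence[of UNIV "\<lambda>n z. picard p q a b n z x"])
  show "(\<lambda>z. picard p q a b n z x) holomorphic_on UNIV" for n
    by (rule polynomial_family_holomorphic[OF polynomial_family_picard[OF p q] x])
  fix z :: complex
  have sub: "cball z 1 \<subseteq> cball 0 (norm z + 1)"
  proof
    fix w assume "w \<in> cball z 1"
    then have "norm (w - z) \<le> 1" by (simp add: dist_norm norm_minus_commute)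
    then show "w \<in> cball 0 (norm z + 1)" using norm_triangle_ineq[of z "w - z"] by simp
  qed
  have "uniform_limit ({0..pi} \<times> cball 0 (norm z + 1)) (\<lambda>n u. picard p q a b n (snd u) (fst u))
            (\<lambda>u. picard_limit (snd u) (fst u)) sequentially" by (rule picard_limit_uniform) simp
  note u = this
  have f: "(\<lambda>w. (x, w)) \<in> cball z 1 \<rightarrow> {0..pi} \<times> cball 0 (norm z + 1)" using x sub by blast
  have "uniform_limit (cball z 1) (\<lambda>n z. picard p q a b n z x) (\<lambda>z. picard_limit z x) sequentially"
    using uniform_limit_compose'[OF u f] by simp
  then show "\<exists>d>0. cball z d \<subseteq> UNIV \<and> uniform_limit (cball z d) (\<lambda>n z. picard p q a b n z x) (\<lambda>z. picard_limit z x) sequentially"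
    by (intro exI[of _ 1]) simp
qed simp

lemma picard_limit_deriv_holomorphic:
  assumes x: "x \<in> {0..pi}"
  shows "(\<lambda>z. picard_limit_deriv z x) holomorphic_on UNIV"
proof (rule holomorphic_uniform_sequence[of UNIV "\<lambda>n z. b + integral {0..x} (\<lambda>t. pot p q z t * picard p q a b n z t)"])
  show "(\<lambda>z. b + integral {0..x} (\<lambda>t. pot p q z t * picard p q a b n z t)) holomorphic_on UNIV" for n
    by (intro holomorphic_intros polynomial_family_holomorphic[OF polynomial_family_pot_integral[OF p q polynomial_family_picard[OF p q]] x])
  fix z :: complex
  obtain D where D: "D \<ge> 0" "\<And>w n x. x\<in>{0..pi} \<Longrightarrow> norm w \<le> norm z + 1 \<Longrightarrow>
     norm (picard_limit_deriv w x - (b + integral {0..x} (\<lambda>t. pot p q w t * picard p q a b n w t))) \<le> D * (1/2) ^ n"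
    using picard_limit_deriv_uniform[of "norm z + 1"] by auto
  have lim0: "(\<lambda>n. D * (1/2) ^ n) \<longlonglongrightarrow> 0"
    by (intro tendsto_mult_right_zero LIMSEQ_realpow_zero) auto
  have "uniform_limit (cball z 1) (\<lambda>n z. b + integral {0..x} (\<lambda>t. pot p q z t * picard p q a b n z t)) (\<lambda>z. picard_limit_deriv z x) sequentially"
  proof (rule uniform_limitI)
    fix e :: real assume "e > 0"
    then have "\<forall>\<^sub>F n in sequentially. D * (1/2) ^ n < e" using lim0 by (intro order_tendstoD)
    then show "\<forall>\<^sub>F n in sequentially. \<forall>w\<in>cball z 1.
        dist (b + integral {0..x} (\<lambda>t. pot p q w t * picard p q a b n w t)) (picard_limit_deriv w x) < e"
    proof (rule eventually_mono)
      fix n assume n: "D * (1/2) ^ n < e"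
      show "\<forall>w\<in>cball z 1. dist (b + integral {0..x} (\<lambda>t. pot p q w t * picard p q a b n w t)) (picard_limit_deriv w x) < e"
      proof
        fix w assume "w \<in> cball z 1"
        then have "norm (w - z) \<le> 1" by (simp add: dist_norm norm_minus_commute)
        then have "norm w \<le> norm z + 1" using norm_triangle_ineq[of z "w - z"] by simp
        from D(2)[OF x this, of n] n
        show "dist (b + integral {0..x} (\<lambda>t. pot p q w t * picard p q a b n w t)) (picard_limit_deriv w x) < e"
          by (simp add: dist_norm norm_minus_commute)
      qed
    qed
  qed
  then show "\<exists>d>0. cball z d \<subseteq> UNIV \<and> uniform_limit (cball z d) (\<lambda>n z. b + integral {0..x} (\<lambda>t. pot p q z t * picard p q a b n z t)) (\<lambda>z. picard_limit_deriv z x) sequentially"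
    by (intro exI[of _ 1]) simp
qed simp

lemma ivp_edge_solution:
  "edge_solution p q lam (fst (ivp p q a b lam)) (snd (ivp p q a b lam))"
  "fst (ivp p q a b lam) 0 = a" "snd (ivp p q a b lam) 0 = b"
proof -
  have "\<exists>u. edge_solution p q lam (fst u) (snd u) \<and> fst u 0 = a \<and> snd u 0 = b"
    using picard_limit_edge_solution by (intro exI[of _ "(picard_limit lam, picard_limit_deriv lam)"]) simp
  from someI_ex[OF this] show "edge_solution p q lam (fst (ivp p q a b lam)) (snd (ivp p q a b lam))"
    "fst (ivp p q a b lam) 0 = a" "snd (ivp p q a b lam) 0 = b" unfolding ivp_def by blast+
qed

lemma ivp_holomorphic:
  assumes x: "x \<in> {0..pi}"
  shows "(\<lambda>lam. fst (ivp p q a b lam) x) holomorphic_on UNIV" "(\<lambda>lam. snd (ivp p q a b lam) x) holomorphic_on UNIV"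
proof -
  have eq: "fst (ivp p q a b lam) x = picard_limit lam x \<and> snd (ivp p q a b lam) x = picard_limit_deriv lam x" for lam
    using edge_solution_unique[OF p q ivp_edge_solution(1) picard_limit_edge_solution(1) _ _ x]
    by (simp add: ivp_edge_solution picard_limit_edge_solution)
  show "(\<lambda>lam. fst (ivp p q a b lam) x) holomorphic_on UNIV" "(\<lambda>lam. snd (ivp p q a b lam) x) holomorphic_on UNIV"
    using picard_limit_holomorphic[OF x] picard_limit_deriv_holomorphic[OF x] by (simp_all add: eq)
qed

end

section \<open>Asymptotics of solutions\<close>

lemma sign_squared: "s \<in> {1, - 1 :: complex} \<Longrightarrow> s * s = 1" by auto

lemma Re_phase_le:
  assumes "s \<in> {1, - 1 :: complex}" "0 \<le> t"
  shows "Re (s * \<i> * (lam * of_real t)) \<le> \<bar>Im lam\<bar> * t"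
proof -
  have "Re (s * \<i> * (lam * of_real t)) = - (Re s * Im lam) * t" using assms(1) by auto
  also have "\<dots> \<le> \<bar>Im lam\<bar> * t" by (rule mult_right_mono) (use assms in auto)
  finally show ?thesis .
qed

lemma norm_integral_le_pi:
  fixes f :: "real \<Rightarrow> complex"
  assumes "continuous_on {0..pi} f" "\<And>t. t \<in> {0..pi} \<Longrightarrow> norm (f t) \<le> B" and x: "x \<in> {0..pi}"
  shows "norm (integral {0..x} f) \<le> B * pi"
proof -
  have B0: "B \<ge> 0" using assms(2)[of 0] order_trans[OF norm_ge_zero] by force
  have "f integrable_on {0..x}"
    by (rule integrable_continuous_real, rule continuous_on_subset[OF assms(1)]) (use x in auto)
  then have "norm (integral (cbox 0 x) f) \<le> B * measure lborel (cbox 0 x)"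
    by (intro integrable_bound[OF B0]) (use assms(2) x in auto)
  also have "\<dots> \<le> B * pi" using x B0 by (intro mult_left_mono) auto
  finally show ?thesis by simp
qed

text \<open>As \<open>p\<close> is merely continuous, it is replaced by a smooth \<open>r\<close> in the exponent. The
  combinations \<open>v\<^sub>s = y' + s i (\<lambda> - r) y\<close>, \<open>s = 1, -1\<close>, nearly diagonalise the system:
  \<open>v\<^sub>s' = s i (\<lambda> - r) v\<^sub>s + \<rho>\<^sub>s y\<close> with \<open>\<rho>\<^sub>s = q + 2 \<lambda> (p - r) + r\<^sup>2 - s i r'\<close>. Here \<open>\<rho>\<^sub>s / \<lambda>\<close> has integral at
  most \<open>\<eta>\<close>, while \<open>\<lambda> y\<close> is controlled by \<open>v\<^sub>1 - v\<^sub>-\<^sub>1 = 2 i (\<lambda> - r) y\<close>. Variation of constants and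
  Gronwall's inequality then bound the deviation from the pure exponentials.\<close>

lemma wkb_step:
  fixes p q r r' y dy :: "real \<Rightarrow> complex" and lam :: complex
  assumes p: "continuous_on {0..pi} p" and q: "q absolutely_integrable_on {0..pi}"
    and y: "edge_solution p q lam y dy"
    and r: "\<And>x. (r has_vector_derivative r' x) (at x)" and r': "continuous_on {0..pi} r'"
    and Br: "\<And>x. x \<in> {0..pi} \<Longrightarrow> norm (r x) \<le> Br" and Br': "\<And>x. x \<in> {0..pi} \<Longrightarrow> norm (r' x) \<le> Br'"
    and \<delta>: "\<And>x. x \<in> {0..pi} \<Longrightarrow> norm (p x - r x) \<le> \<delta>"
    and lam: "norm lam \<ge> 2 * Br" "lam \<noteq> 0"
  defines "v \<equiv> \<lambda>s x. dy x + s * \<i> * (lam - r x) * y x"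
    and "M \<equiv> exp (pi * Br)"
    and "\<eta> \<equiv> (integral {0..pi} (\<lambda>t. norm (q t)) + pi * (2 * norm lam * \<delta> + Br\<^sup>2 + Br')) / norm lam"
  defines "U \<equiv> 2 * M\<^sup>2 * (norm (v 1 0) + norm (v (-1) 0)) * exp (4 * M\<^sup>2 * \<eta>)"
  assumes x: "x \<in> {0..pi}"
  shows "norm lam * norm (y x) \<le> exp (\<bar>Im lam\<bar> * x) * U"
    and "s \<in> {1,-1} \<Longrightarrow> norm (v s x - exp (s * \<i> * (lam * x - integral {0..x} r)) * v s 0) \<le> exp (\<bar>Im lam\<bar> * x) * (M\<^sup>2 * \<eta> * U)"
proof -
  define \<tau> where "\<tau> = \<bar>Im lam\<bar>"
  define R where "R x = integral {0..x} r" for x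
  define \<rho> where "\<rho> s t = pot p q lam t - s * \<i> * r' t + (lam - r t)\<^sup>2" for s t
  define k where "k t = (norm (q t) + (2 * norm lam * \<delta> + Br\<^sup>2 + Br')) / norm lam" for t
  have Br0: "Br \<ge> 0" using Br[of 0] order_trans[OF norm_ge_zero] by force
  have Br'0: "Br' \<ge> 0" using Br'[of 0] order_trans[OF norm_ge_zero] by force
  have \<delta>0: "\<delta> \<ge> 0" using \<delta>[of 0] order_trans[OF norm_ge_zero] by force
  have M1: "M \<ge> 1" using Br0 by (simp add: M_def)
  have rc: "continuous_on {0..pi} r"
    by (rule continuous_at_imp_continuous_on) (use r has_vector_derivative_continuous in blast)
  have ri: "r integrable_on {0..t}" if "t \<in> {0..pi}" for t
    by (rule integrable_continuous_real, rule continuous_on_subset[OF rc]) (use that in auto)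
  have ac: "ac_deriv 0 pi y dy" "ac_deriv 0 pi dy (\<lambda>x. pot p q lam x * y x)"
    using y by (simp_all add: edge_solution_iff_ac_deriv)
  have yc: "continuous_on {0..pi} y" by (rule ac_deriv_continuous_on[OF ac(1)])
  have acr: "ac_deriv 0 pi r r'" by (rule ac_deriv_C1[OF has_vector_derivative_at_within[OF r] r'])
  have acR: "ac_deriv 0 pi R r"
    using ac_deriv_indefinite_integral[OF absolutely_integrable_continuous_real[OF rc], of 0] by (simp add: R_def[abs_def])
  have acid: "ac_deriv 0 pi of_real (\<lambda>x. 1)"
    by (rule ac_deriv_C1) (auto intro!: derivative_eq_intros continuous_intros simp: has_vector_derivative_def fun_eq_iff scaleR_conv_of_real)
  have acv: "ac_deriv 0 pi (v s) (\<lambda>x. pot p q lam x * y x + s * \<i> * ((lam - r x) * dy x - r' x * y x))" for s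
  proof -
    have "ac_deriv 0 pi (\<lambda>x. lam - r x) (\<lambda>x. 0 - r' x)" by (rule ac_deriv_diff[OF ac_deriv_const acr])
    from ac_deriv_add[OF ac(2) ac_deriv_cmult[OF ac_deriv_mult[OF this ac(1)], of "s * \<i>"]]
    show ?thesis by (rule ac_deriv_cong) (auto simp: v_def algebra_simps)
  qed
  have acE: "ac_deriv 0 pi (\<lambda>x. exp (- s * \<i> * (lam * x - R x)))
      (\<lambda>x. - s * \<i> * (lam - r x) * exp (- s * \<i> * (lam * x - R x)))" for s
  proof -
    have "ac_deriv 0 pi (\<lambda>x. lam * of_real x - R x) (\<lambda>x. lam * 1 - r x)"
      by (rule ac_deriv_diff[OF ac_deriv_cmult[OF acid] acR])
    from ac_deriv_exp[OF ac_deriv_cmult[OF this, of "- s * \<i>"]] show ?thesis by simp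
  qed
  have duhamel: "v s x = exp (s * \<i> * (lam * x - R x)) * v s 0 +
      integral {0..x} (\<lambda>t. exp (s * \<i> * (lam * x - R x)) * (exp (- s * \<i> * (lam * t - R t)) * (\<rho> s t * y t)))"
    and duhamel_int: "(\<lambda>t. exp (s * \<i> * (lam * x - R x)) * (exp (- s * \<i> * (lam * t - R t)) * (\<rho> s t * y t))) integrable_on {0..x}"
    if s: "s \<in> {1,-1}" and x: "x \<in> {0..pi}" for s x
  proof -
    have "ac_deriv 0 pi (\<lambda>x. exp (- s * \<i> * (lam * x - R x)) * v s x)
       (\<lambda>t. exp (- s * \<i> * (lam * t - R t)) * (\<rho> s t * y t))"
    proof (rule ac_deriv_cong[OF ac_deriv_mult[OF acE acv]])
      fix x :: real
      define E where "E = exp (- s * \<i> * (lam * x - R x))"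
      have "E * (pot p q lam x * y x + s * \<i> * ((lam - r x) * dy x - r' x * y x)) + - s * \<i> * (lam - r x) * E * v s x
        = E * (pot p q lam x * y x - s * \<i> * r' x * y x + (s * s) * (lam - r x)\<^sup>2 * y x)"
        by (simp add: v_def algebra_simps power2_eq_square)
      also have "\<dots> = E * (\<rho> s x * y x)" unfolding sign_squared[OF s] by (simp add: \<rho>_def algebra_simps)
      finally show "exp (- s * \<i> * (lam * x - R x)) * (pot p q lam x * y x + s * \<i> * ((lam - r x) * dy x - r' x * y x))
          + - s * \<i> * (lam - r x) * exp (- s * \<i> * (lam * x - R x)) * v s x
          = exp (- s * \<i> * (lam * x - R x)) * (\<rho> s x * y x)" unfolding E_def .
    qed simp
    then have hi: "((\<lambda>t. exp (- s * \<i> * (lam * t - R t)) * (\<rho> s t * y t)) has_integral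
       (exp (- s * \<i> * (lam * x - R x)) * v s x - exp (- s * \<i> * (lam * (0::real) - R 0)) * v s 0)) {0..x}"
      by (rule ac_deriv_has_integral) (use x in auto)
    have R0: "R 0 = 0" by (simp add: R_def)
    have "exp (s * \<i> * (lam * x - R x)) * (exp (- s * \<i> * (lam * x - R x)) * v s x - exp (- s * \<i> * (lam * (0::real) - R 0)) * v s 0)
       = v s x - exp (s * \<i> * (lam * x - R x)) * v s 0"
      by (simp add: right_diff_distrib R0 mult.assoc[symmetric] exp_add[symmetric])
    with has_integral_mult_right[OF hi, of "exp (s * \<i> * (lam * x - R x))"]
    have "((\<lambda>t. exp (s * \<i> * (lam * x - R x)) * (exp (- s * \<i> * (lam * t - R t)) * (\<rho> s t * y t))) has_integral
       (v s x - exp (s * \<i> * (lam * x - R x)) * v s 0)) {0..x}" by simp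
    note H = this
    show "v s x = exp (s * \<i> * (lam * x - R x)) * v s 0 +
      integral {0..x} (\<lambda>t. exp (s * \<i> * (lam * x - R x)) * (exp (- s * \<i> * (lam * t - R t)) * (\<rho> s t * y t)))"
      and "(\<lambda>t. exp (s * \<i> * (lam * x - R x)) * (exp (- s * \<i> * (lam * t - R t)) * (\<rho> s t * y t))) integrable_on {0..x}"
      unfolding integral_unique[OF H] using has_integral_integrable[OF H] by simp_all
  qed
  have Rb: "norm (R t) \<le> pi * Br" if t: "t \<in> {0..pi}" for t
  proof -
    have "norm (integral (cbox 0 t) r) \<le> Br * measure lborel (cbox 0 t)"
      by (rule integrable_bound[OF Br0]) (use ri[OF t] Br t in auto)
    also have "\<dots> \<le> Br * pi" using t Br0 by (intro mult_left_mono) auto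
    finally show ?thesis by (simp add: R_def mult.commute)
  qed
  have expR: "norm (exp (s * \<i> * R t)) \<le> M" if "s \<in> {1,-1}" "t \<in> {0..pi}" for s t
  proof -
    have "norm (s * \<i> * R t) \<le> pi * Br" using Rb[OF that(2)] that(1) by (auto simp: norm_mult)
    then show ?thesis unfolding M_def
      using norm_exp[of "s * \<i> * R t"] by (meson exp_le_cancel_iff order_trans)
  qed
  have phase: "norm (exp (s * \<i> * (lam * x - R x)) * exp (- s * \<i> * (lam * t - R t))) \<le> M\<^sup>2 * exp (\<tau> * (x - t))"
    if s: "s \<in> {1,-1}" and x: "x \<in> {0..pi}" and t: "t \<in> {0..x}" for s x t
  proof -
    have s': "- s \<in> {1,-1}" using s by auto
    have "exp (s * \<i> * (lam * x - R x)) * exp (- s * \<i> * (lam * t - R t))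
       = exp (s * \<i> * (lam * of_real (x - t))) * (exp (- s * \<i> * R x) * exp (s * \<i> * R t))"
      by (simp add: exp_add[symmetric] algebra_simps)
    also have "norm \<dots> = exp (Re (s * \<i> * (lam * of_real (x - t)))) * (norm (exp (- s * \<i> * R x)) * norm (exp (s * \<i> * R t)))"
      by (simp only: norm_mult norm_exp_eq_Re)
    also have "\<dots> \<le> exp (\<tau> * (x - t)) * (M * M)"
      using Re_phase_le[OF s, of "x - t" lam] expR[OF s' x] expR[OF s, of t] t x M1
      by (intro mult_mono) (auto simp: \<tau>_def)
    finally show ?thesis by (simp add: power2_eq_square mult.commute)
  qed
  define u where "u x = exp (- \<tau> * x) * (norm (v 1 x) + norm (v (-1) x))" for x
  have uc: "continuous_on {0..pi} u" unfolding u_def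
    by (intro continuous_intros ac_deriv_continuous_on[OF acv])
  have u0: "u t \<ge> 0" for t by (simp add: u_def)
  have yu: "norm lam * norm (y t) \<le> exp (\<tau> * t) * u t" if t: "t \<in> {0..pi}" for t
  proof -
    have "v 1 t - v (-1) t = 2 * \<i> * (lam - r t) * y t" by (simp add: v_def algebra_simps)
    then have "norm (2 * \<i> * (lam - r t) * y t) \<le> norm (v 1 t) + norm (v (-1) t)"
      by (metis norm_triangle_ineq4)
    moreover have "norm (2 * \<i> * (lam - r t) * y t) = 2 * norm (lam - r t) * norm (y t)" by (simp add: norm_mult)
    moreover have "norm lam \<le> 2 * norm (lam - r t)"
      using norm_triangle_ineq2[of lam "r t"] Br[OF t] lam(1) by linarith
    then have "norm lam * norm (y t) \<le> 2 * norm (lam - r t) * norm (y t)" by (rule mult_right_mono) simp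
    ultimately have "norm lam * norm (y t) \<le> norm (v 1 t) + norm (v (-1) t)" by linarith
    also have "\<dots> = exp (\<tau> * t) * u t" by (simp add: u_def mult.assoc[symmetric] exp_add[symmetric])
    finally show ?thesis .
  qed
  have \<rho>k: "norm (\<rho> s t) \<le> norm lam * k t" if s: "s \<in> {1,-1}" and t: "t \<in> {0..pi}" for s t
  proof -
    have "\<rho> s t = q t + 2 * lam * (p t - r t) + (r t)\<^sup>2 - s * \<i> * r' t"
      by (simp add: \<rho>_def pot_def algebra_simps power2_eq_square)
    also have "norm \<dots> \<le> norm (q t) + norm (2 * lam * (p t - r t)) + norm ((r t)\<^sup>2) + norm (s * \<i> * r' t)"
      by (meson add_mono norm_triangle_ineq norm_triangle_ineq4 order_refl order_trans)
    also have "\<dots> \<le> norm (q t) + 2 * norm lam * \<delta> + Br\<^sup>2 + Br'"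
    proof -
      have "norm (2 * lam * (p t - r t)) \<le> 2 * norm lam * \<delta>" using \<delta>[OF t] by (simp add: norm_mult mult_left_mono)
      moreover have "norm ((r t)\<^sup>2) \<le> Br\<^sup>2" using Br[OF t] by (simp add: norm_power power_mono)
      moreover have "norm (s * \<i> * r' t) \<le> Br'" using Br'[OF t] s by (auto simp: norm_mult)
      ultimately show ?thesis by linarith
    qed
    also have "\<dots> = norm lam * k t" using lam(2) by (simp add: k_def)
    finally show ?thesis .
  qed
  have qn: "(\<lambda>t. norm (q t)) integrable_on {0..pi}" using q by (simp add: absolutely_integrable_on_def)
  have ki: "(k has_integral \<eta>) {0..pi}"
  proof -
    have "((\<lambda>t. norm (q t) + (2 * norm lam * \<delta> + Br\<^sup>2 + Br')) has_integral
       (integral {0..pi} (\<lambda>t. norm (q t)) + pi * (2 * norm lam * \<delta> + Br\<^sup>2 + Br'))) {0..pi}"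
      using has_integral_add[OF integrable_integral[OF qn] has_integral_const_real[of "2 * norm lam * \<delta> + Br\<^sup>2 + Br'" 0 pi]]
      by simp
    from has_integral_divide[OF this, of "norm lam"] show ?thesis by (simp add: k_def[abs_def] \<eta>_def)
  qed
  have k: "k integrable_on {0..pi}" "0 \<le> k t" for t
    using has_integral_integrable[OF ki] Br'0 \<delta>0 by (auto simp: k_def)
  have \<eta>: "integral {0..pi} k = \<eta>" using ki by (rule integral_unique)
  have \<eta>0: "\<eta> \<ge> 0" using integral_nonneg[OF k(1)] k(2) \<eta> by simp
  have kui: "(\<lambda>t. k t * u t) integrable_on {0..t'}" if "t' \<in> {0..pi}" for t'
    by (rule integrable_on_subinterval[OF integrable_times_continuous_real[OF k uc]]) (use that in auto)
  have err: "norm (v s x - exp (s * \<i> * (lam * x - R x)) * v s 0) \<le> M\<^sup>2 * exp (\<tau> * x) * integral {0..x} (\<lambda>t. k t * u t)"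
    if s: "s \<in> {1,-1}" and x: "x \<in> {0..pi}" for s x
  proof -
    have "norm (integral {0..x} (\<lambda>t. exp (s * \<i> * (lam * x - R x)) * (exp (- s * \<i> * (lam * t - R t)) * (\<rho> s t * y t))))
       \<le> integral {0..x} (\<lambda>t. (M\<^sup>2 * exp (\<tau> * x)) * (k t * u t))"
    proof (rule Henstock_Kurzweil_Integration.integral_norm_bound_integral[OF duhamel_int[OF s x]])
      show "(\<lambda>t. (M\<^sup>2 * exp (\<tau> * x)) * (k t * u t)) integrable_on {0..x}"
        by (rule integrable_on_mult_right[OF kui[OF x]])
      fix t assume t: "t \<in> {0..x}"
      then have t': "t \<in> {0..pi}" using x by auto
      have "norm (exp (s * \<i> * (lam * x - R x)) * (exp (- s * \<i> * (lam * t - R t)) * (\<rho> s t * y t)))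
        = norm (exp (s * \<i> * (lam * x - R x)) * exp (- s * \<i> * (lam * t - R t))) * (norm (\<rho> s t) * norm (y t))"
        by (simp only: norm_mult mult.assoc)
      also have "\<dots> \<le> (M\<^sup>2 * exp (\<tau> * (x - t))) * ((norm lam * k t) * norm (y t))"
        by (intro mult_mono phase[OF s x t] \<rho>k[OF s t'] mult_right_mono) (auto intro!: mult_nonneg_nonneg k(2))
      also have "\<dots> = (M\<^sup>2 * exp (\<tau> * (x - t)) * k t) * (norm lam * norm (y t))" by (simp add: mult_ac)
      also have "\<dots> \<le> (M\<^sup>2 * exp (\<tau> * (x - t)) * k t) * (exp (\<tau> * t) * u t)"
        using k(2) by (intro mult_left_mono yu[OF t']) auto
      also have "\<dots> = (M\<^sup>2 * (exp (\<tau> * (x - t)) * exp (\<tau> * t))) * (k t * u t)" by (simp add: mult_ac)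
      also have "exp (\<tau> * (x - t)) * exp (\<tau> * t) = exp (\<tau> * x)" by (simp add: exp_add[symmetric] algebra_simps)
      finally show "norm (exp (s * \<i> * (lam * x - R x)) * (exp (- s * \<i> * (lam * t - R t)) * (\<rho> s t * y t)))
         \<le> (M\<^sup>2 * exp (\<tau> * x)) * (k t * u t)" .
    qed
    also have "\<dots> = M\<^sup>2 * exp (\<tau> * x) * integral {0..x} (\<lambda>t. k t * u t)" by simp
    finally show ?thesis using duhamel[OF s x] by simp
  qed
  have uU: "u t \<le> U" if t: "t \<in> {0..pi}" for t
  proof -
    have "u t \<le> 2 * (M\<^sup>2 * (norm (v 1 0) + norm (v (-1) 0))) * exp (2 * integral {0..pi} (\<lambda>t. 2 * M\<^sup>2 * k t))"
    proof (rule gronwall[OF _ _ uc u0 _ t])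
      show "(\<lambda>t. 2 * M\<^sup>2 * k t) integrable_on {0..pi}" by (rule integrable_on_mult_right[OF k(1)])
      show "0 \<le> 2 * M\<^sup>2 * k t" for t using k(2) by simp
      fix x assume x: "x \<in> {0..pi}"
      have each: "exp (- \<tau> * x) * norm (v s x) \<le> M\<^sup>2 * norm (v s 0) + M\<^sup>2 * integral {0..x} (\<lambda>t. k t * u t)"
        if s: "s \<in> {1,-1}" for s
      proof -
        have R0: "R 0 = 0" by (simp add: R_def)
        have "norm (exp (s * \<i> * (lam * x - R x))) \<le> M\<^sup>2 * exp (\<tau> * x)"
          using phase[OF s x, of 0] x by (simp add: R0)
        then have "norm (exp (s * \<i> * (lam * x - R x)) * v s 0) \<le> M\<^sup>2 * exp (\<tau> * x) * norm (v s 0)"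
          by (simp add: norm_mult mult_right_mono)
        then have "norm (v s x) \<le> exp (\<tau> * x) * (M\<^sup>2 * norm (v s 0) + M\<^sup>2 * integral {0..x} (\<lambda>t. k t * u t))"
          using err[OF s x] norm_triangle_sub[of "v s x" "exp (s * \<i> * (lam * x - R x)) * v s 0"]
          by (simp add: algebra_simps)
        then have "exp (- \<tau> * x) * norm (v s x) \<le> exp (- \<tau> * x) * (exp (\<tau> * x) * (M\<^sup>2 * norm (v s 0) + M\<^sup>2 * integral {0..x} (\<lambda>t. k t * u t)))"
          by (rule mult_left_mono) simp
        then show ?thesis by (simp add: mult.assoc[symmetric] exp_add[symmetric])
      qed
      have "u x = exp (- \<tau> * x) * norm (v 1 x) + exp (- \<tau> * x) * norm (v (-1) x)" by (simp add: u_def distrib_left)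
      also have "\<dots> \<le> M\<^sup>2 * (norm (v 1 0) + norm (v (-1) 0)) + 2 * M\<^sup>2 * integral {0..x} (\<lambda>t. k t * u t)"
        using each[of 1] each[of "-1"] by (simp add: distrib_left)
      also have "2 * M\<^sup>2 * integral {0..x} (\<lambda>t. k t * u t) = integral {0..x} (\<lambda>t. 2 * M\<^sup>2 * k t * u t)"
        by (simp add: mult.assoc)
      finally show "u x \<le> M\<^sup>2 * (norm (v 1 0) + norm (v (-1) 0)) + integral {0..x} (\<lambda>t. 2 * M\<^sup>2 * k t * u t)" .
    qed
    also have "\<dots> = U" by (simp add: U_def \<eta>)
    finally show ?thesis .
  qed
  have "norm lam * norm (y x) \<le> exp (\<tau> * x) * u x" by (rule yu[OF x])
  also have "\<dots> \<le> exp (\<tau> * x) * U" by (intro mult_left_mono uU x) auto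
  finally show "norm lam * norm (y x) \<le> exp (\<bar>Im lam\<bar> * x) * U" by (simp add: \<tau>_def)
  assume s: "s \<in> {1,-1}"
  have U0: "U \<ge> 0" using u0[of 0] uU[of 0] by simp
  have "integral {0..x} (\<lambda>t. k t * u t) \<le> integral {0..x} (\<lambda>t. k t * U)"
  proof (rule integral_le[OF kui[OF x]])
    show "(\<lambda>t. k t * U) integrable_on {0..x}"
      by (rule integrable_on_mult_left, rule integrable_on_subinterval[OF k(1)]) (use x in auto)
    show "k t * u t \<le> k t * U" if "t \<in> {0..x}" for t using that x k(2) by (intro mult_left_mono uU) auto
  qed
  also have "\<dots> = integral {0..x} k * U" by simp
  also have "\<dots> \<le> \<eta> * U"
    using indefinite_integral_nonneg_mono[OF k, of x pi] x U0 \<eta> by (intro mult_right_mono) auto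
  finally have "M\<^sup>2 * exp (\<tau> * x) * integral {0..x} (\<lambda>t. k t * u t) \<le> M\<^sup>2 * exp (\<tau> * x) * (\<eta> * U)"
    by (intro mult_left_mono) auto
  with err[OF s x] show "norm (v s x - exp (s * \<i> * (lam * x - integral {0..x} r)) * v s 0) \<le> exp (\<bar>Im lam\<bar> * x) * (M\<^sup>2 * \<eta> * U)"
    by (simp add: R_def \<tau>_def mult_ac)
qed

text \<open>Approximate \<open>p\<close> uniformly by a polynomial \<open>r\<close> within \<open>\<delta>\<close>. With \<open>r\<close> fixed, the quantity \<open>\<eta>\<close> of the
  previous lemma is of order \<open>\<delta>\<close> as soon as \<open>\<lambda>\<close> is large, and replacing the integral of \<open>r\<close> by that of \<open>p\<close> in the
  phase costs another multiple of \<open>\<delta>\<close>. The trigonometric form follows by solving for \<open>y\<close> and \<open>y'\<close>.\<close>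

lemma edge_asymptotics:
  assumes p: "continuous_on {0..pi} p" and q: "q absolutely_integrable_on {0..pi}" and \<epsilon>: "\<epsilon> > 0"
  shows "\<exists>R0>0. \<forall>lam y dy. \<forall>x\<in>{0..pi}. R0 \<le> norm lam \<longrightarrow> edge_solution p q lam y dy \<longrightarrow>
     norm (lam * y x - (lam * y 0 * cos (lam * x - integral {0..x} p) + dy 0 * sin (lam * x - integral {0..x} p)))
       \<le> \<epsilon> * exp (\<bar>Im lam\<bar> * x) * (norm (lam * y 0) + norm (dy 0)) \<and>
     norm (dy x - (dy 0 * cos (lam * x - integral {0..x} p) - lam * y 0 * sin (lam * x - integral {0..x} p)))
       \<le> \<epsilon> * exp (\<bar>Im lam\<bar> * x) * (norm (lam * y 0) + norm (dy 0))"
proof -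
  obtain Bp where Bp: "Bp > 0" "\<And>x. x \<in> {0..pi} \<Longrightarrow> norm (p x) \<le> Bp"
    using continuous_on_Icc_norm_bound[OF p] by blast
  define Br where "Br = Bp + 1"
  define M where "M = exp (pi * Br)"
  define K where "K = 2 * M\<^sup>2 * exp (36 * M\<^sup>2)"
  define C where "C = 36 * M\<^sup>2 * K + 17 * M + 4 * K"
  have M1: "M \<ge> 1" using Bp(1) by (simp add: M_def Br_def)
  have K0: "K > 0" using M1 by (simp add: K_def)
  have C0: "C > 0" using M1 K0 by (simp add: C_def add_pos_pos)
  define \<delta> where "\<delta> = min 1 (\<epsilon> / C)"
  have \<delta>: "\<delta> > 0" "\<delta> \<le> 1" "\<delta> * C \<le> \<epsilon>" using \<epsilon> C0 by (auto simp: \<delta>_def min_def field_simps)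
  obtain r where r0: "polynomial_function r" "\<And>x. x \<in> {0..pi} \<Longrightarrow> norm (p x - r x) < \<delta>"
    using Stone_Weierstrass_polynomial_function[OF compact_Icc p \<delta>(1)] by blast
  obtain r' where r': "polynomial_function r'" "\<And>x. (r has_vector_derivative r' x) (at x)"
    using has_vector_derivative_polynomial_function[OF r0(1)] by blast
  have r'c: "continuous_on {0..pi} r'" by (rule continuous_on_polymonial_function[OF r'(1)])
  have rc: "continuous_on {0..pi} r" by (rule continuous_on_polymonial_function[OF r0(1)])
  obtain Br' where Br': "Br' > 0" "\<And>x. x \<in> {0..pi} \<Longrightarrow> norm (r' x) \<le> Br'"
    using continuous_on_Icc_norm_bound[OF r'c] by blast
  have Brb: "norm (r x) \<le> Br" if "x \<in> {0..pi}" for x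
    using r0(2)[OF that] Bp(2)[OF that] norm_triangle_ineq2[of "r x" "p x"] \<delta>(2) by (simp add: Br_def norm_minus_commute)
  have rd: "norm (p x - r x) \<le> \<delta>" if "x \<in> {0..pi}" for x using r0(2)[OF that] by simp
  define Cq where "Cq = integral {0..pi} (\<lambda>t. norm (q t)) + pi * (Br\<^sup>2 + Br')"
  have Cq0: "Cq \<ge> 0"
  proof -
    have "0 \<le> integral {0..pi} (\<lambda>t. norm (q t))"
      by (rule integral_nonneg) (use q in \<open>auto simp: absolutely_integrable_on_def\<close>)
    then show ?thesis using Br'(1) by (simp add: Cq_def)
  qed
  \<comment> \<open>beyond \<open>R0\<close> the terms of \<open>\<eta>\<close> without \<open>p - r\<close>, and \<open>r / \<lambda>\<close>, are at most \<open>\<delta>\<close>\<close>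
  define R0 where "R0 = 2 * Br + Br / \<delta> + Cq / \<delta> + 1"
  have Br0: "Br > 0" using Bp(1) by (simp add: Br_def)
  show ?thesis
  proof (intro exI[of _ R0] conjI allI ballI impI)
    show "R0 > 0" using Br0 \<delta> Cq0 by (simp add: R0_def add_pos_nonneg)
  next
    fix lam y dy x
    assume x: "x \<in> {0..pi}" and lam: "R0 \<le> norm lam" and sol: "edge_solution p q lam y dy"
    define E where "E = exp (\<bar>Im lam\<bar> * x)"
    have E1: "E > 0" by (simp add: E_def)
    have q1: "Br / \<delta> \<ge> 0" "Cq / \<delta> \<ge> 0" using Br0 \<delta> Cq0 by auto
    have L1: "norm lam \<ge> 2 * Br" "norm lam \<ge> Br / \<delta>" "norm lam \<ge> Cq / \<delta>" "norm lam > 0" "norm lam \<ge> Br"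
      using lam q1 Br0 by (auto simp: R0_def)
    have lam0: "lam \<noteq> 0" using L1 by auto
    define a b where "a = lam * y 0" and "b = dy 0"
    define N0 where "N0 = norm a + norm b"
    have N0: "N0 \<ge> 0" by (simp add: N0_def)
    define v where "v s x = dy x + s * \<i> * (lam - r x) * y x" for s x
    define \<eta> where "\<eta> = (integral {0..pi} (\<lambda>t. norm (q t)) + pi * (2 * norm lam * \<delta> + Br\<^sup>2 + Br')) / norm lam"
    define U where "U = 2 * M\<^sup>2 * (norm (v 1 0) + norm (v (-1) 0)) * exp (4 * M\<^sup>2 * \<eta>)"
    note step = wkb_step[OF p q sol r'(2) r'c Brb Br'(2) rd L1(1) lam0 x,
        folded v_def M_def \<eta>_def, folded U_def]
    \<comment> \<open>\<open>2 \<pi> + 1 \<le> 9\<close>\<close>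
    have \<eta>9: "\<eta> \<le> 9 * \<delta>"
    proof -
      have "\<eta> = 2 * pi * \<delta> + Cq / norm lam" using L1(4) by (simp add: \<eta>_def Cq_def field_simps)
      moreover have "Cq / norm lam \<le> \<delta>" using L1(3,4) \<delta>(1) by (simp add: field_simps)
      moreover have "2 * pi * \<delta> \<le> 8 * \<delta>" using pi_less_4 \<delta>(1) by simp
      ultimately show ?thesis by linarith
    qed
    have ry: "norm (r 0 * y 0) \<le> \<delta> * N0"
    proof -
      have "norm (r 0 * y 0) = norm (r 0) * (norm a / norm lam)" using L1(4) by (simp add: a_def norm_mult)
      also have "\<dots> \<le> Br * (norm a / norm lam)" by (intro mult_right_mono Brb) auto
      also have "\<dots> = (Br / norm lam) * norm a" by simp
      also have "\<dots> \<le> \<delta> * N0"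
        using L1(2,4) \<delta>(1) by (intro mult_mono) (auto simp: N0_def field_simps)
      finally show ?thesis .
    qed
    have v0: "v s 0 = b + s * \<i> * a - s * \<i> * (r 0 * y 0)" for s by (simp add: v_def a_def b_def algebra_simps)
    have v0b: "norm (v s 0) \<le> 2 * N0" if s: "s \<in> {1,-1}" for s
    proof -
      have "norm (v s 0) \<le> norm (b + s * \<i> * a) + norm (s * \<i> * (r 0 * y 0))" unfolding v0 by (rule norm_triangle_ineq4)
      also have "\<dots> \<le> norm b + norm (s * \<i> * a) + norm (s * \<i> * (r 0 * y 0))" by (intro add_right_mono norm_triangle_ineq)
      also have "\<dots> = norm b + norm a + norm (r 0 * y 0)" using s by (auto simp: norm_mult)
      also have "\<dots> \<le> N0 + 1 * N0" using ry mult_right_mono[OF \<delta>(2) N0] by (simp add: N0_def)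
      finally show ?thesis by simp
    qed
    have UK: "U \<le> 4 * K * N0"
    proof -
      have "4 * M\<^sup>2 * \<eta> \<le> 36 * M\<^sup>2"
        using mult_left_mono[of \<eta> 9 "4 * M\<^sup>2"] \<eta>9 \<delta>(2) by simp
      then have "U \<le> 2 * M\<^sup>2 * (4 * N0) * exp (36 * M\<^sup>2)"
        unfolding U_def using v0b[of 1] v0b[of "-1"] N0 by (intro mult_mono) auto
      then show ?thesis by (simp add: K_def mult_ac)
    qed
    have U0: "U \<ge> 0" by (simp add: U_def)
    define \<theta> \<theta>r where "\<theta> = lam * x - integral {0..x} p" and "\<theta>r = lam * x - integral {0..x} r"
    have fin: "norm (v s x - exp (s * \<i> * \<theta>) * (b + s * \<i> * a)) \<le> E * (\<delta> * (36 * M\<^sup>2 * K + 17 * M) * N0)"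
      if s: "s \<in> {1,-1}" for s
    proof -
      have 1: "norm (v s x - exp (s * \<i> * \<theta>r) * v s 0) \<le> E * (\<delta> * (36 * M\<^sup>2 * K) * N0)"
      proof -
        have "norm (v s x - exp (s * \<i> * \<theta>r) * v s 0) \<le> E * (M\<^sup>2 * \<eta> * U)"
          using step(2)[OF _ _ _ s] by (simp add: \<theta>r_def E_def)
        also have "\<dots> \<le> E * (M\<^sup>2 * (9 * \<delta>) * (4 * K * N0))"
          using \<eta>9 UK U0 E1 M1 \<delta>(1) by (intro mult_left_mono mult_mono) auto
        finally show ?thesis by (simp add: mult_ac)
      qed
      have ib: "norm (integral {0..x} f) \<le> B * pi" if "continuous_on {0..pi} f" "\<And>t. t \<in> {0..pi} \<Longrightarrow> norm (f t) \<le> B" for f :: "real \<Rightarrow> complex" and B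
        by (rule norm_integral_le_pi[OF that x])
      have Pb: "norm (integral {0..x} p) \<le> pi * Br"
        using ib[OF p, of Br] Bp(2) by (force simp: Br_def mult.commute)
      have Rb: "norm (integral {0..x} r) \<le> pi * Br" using ib[OF rc, of Br] Brb by (simp add: mult.commute)
      have PR: "norm (integral {0..x} r - integral {0..x} p) \<le> 4 * \<delta>"
      proof -
        have "p integrable_on {0..x}" "r integrable_on {0..x}"
          by (rule integrable_continuous_real, rule continuous_on_subset[OF p], use x in auto)
            (rule integrable_continuous_real, rule continuous_on_subset[OF rc], use x in auto)
        then have "integral {0..x} p - integral {0..x} r = integral {0..x} (\<lambda>t. p t - r t)"
          by (rule Henstock_Kurzweil_Integration.integral_diff[symmetric])
        also have "norm \<dots> \<le> \<delta> * pi" by (rule ib) (use rd in \<open>auto intro!: continuous_intros p rc\<close>)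
        also have "\<dots> \<le> 4 * \<delta>" using pi_less_4 \<delta>(1) by simp
        finally show ?thesis by (simp add: norm_minus_commute)
      qed
      have nE: "norm (exp (s * \<i> * (lam * x))) \<le> E"
        using Re_phase_le[OF s, of x lam] x by (simp add: E_def norm_exp_eq_Re)
      have dif: "norm (exp (s * \<i> * \<theta>r) - exp (s * \<i> * \<theta>)) \<le> E * (M * (4 * \<delta>))"
      proof -
        have "exp (s * \<i> * \<theta>r) - exp (s * \<i> * \<theta>) = exp (s * \<i> * (lam * x)) * (exp (- s * \<i> * integral {0..x} r) - exp (- s * \<i> * integral {0..x} p))"
          by (simp add: \<theta>r_def \<theta>_def right_diff_distrib exp_add[symmetric])
        also have "norm \<dots> = norm (exp (s * \<i> * (lam * x))) * norm (exp (- s * \<i> * integral {0..x} r) - exp (- s * \<i> * integral {0..x} p))"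
          by (rule norm_mult)
        also have "norm (exp (- s * \<i> * integral {0..x} r) - exp (- s * \<i> * integral {0..x} p))
           \<le> exp (pi * Br) * norm (- s * \<i> * integral {0..x} r - (- s * \<i> * integral {0..x} p))"
          by (rule exp_lipschitz) (use Pb Rb s in \<open>auto simp: norm_mult\<close>)
        also have "- s * \<i> * integral {0..x} r - (- s * \<i> * integral {0..x} p) = - s * \<i> * (integral {0..x} r - integral {0..x} p)"
          by (simp add: algebra_simps)
        also have "norm \<dots> = norm (integral {0..x} r - integral {0..x} p)" using s by (auto simp: norm_mult)
        also have "norm (exp (s * \<i> * (lam * x))) * (exp (pi * Br) * norm (integral {0..x} r - integral {0..x} p)) \<le> E * (M * (4 * \<delta>))"
          using nE PR E1 by (intro mult_mono) (auto simp: M_def)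
        finally show ?thesis by (simp add: mult_left_mono)
      qed
      have th: "norm (exp (s * \<i> * \<theta>)) \<le> E * M"
      proof -
        have "exp (s * \<i> * \<theta>) = exp (s * \<i> * (lam * x)) * exp (- s * \<i> * integral {0..x} p)"
          by (simp add: \<theta>_def right_diff_distrib exp_add[symmetric])
        moreover have "norm (exp (- s * \<i> * integral {0..x} p)) \<le> M"
        proof -
          have "norm (- s * \<i> * integral {0..x} p) \<le> pi * Br" using Pb s by (auto simp: norm_mult)
          then show ?thesis unfolding M_def using order_trans[OF norm_exp] by (metis exp_le_cancel_iff)
        qed
        ultimately show ?thesis using nE E1 by (simp add: norm_mult mult_mono)
      qed
      have 2: "norm ((exp (s * \<i> * \<theta>r) - exp (s * \<i> * \<theta>)) * v s 0) \<le> E * (\<delta> * (8 * M) * N0)"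
      proof -
        have "norm ((exp (s * \<i> * \<theta>r) - exp (s * \<i> * \<theta>)) * v s 0) \<le> (E * (M * (4 * \<delta>))) * (2 * N0)"
          unfolding norm_mult using dif v0b[OF s] E1 M1 \<delta>(1) by (intro mult_mono) auto
        then show ?thesis by (simp add: mult_ac)
      qed
      have 3: "norm (exp (s * \<i> * \<theta>) * (s * \<i> * (r 0 * y 0))) \<le> E * (\<delta> * M * N0)"
      proof -
        have "norm (s * \<i> * (r 0 * y 0)) \<le> \<delta> * N0" using ry s by (auto simp: norm_mult)
        then have "norm (exp (s * \<i> * \<theta>) * (s * \<i> * (r 0 * y 0))) \<le> (E * M) * (\<delta> * N0)"
          unfolding norm_mult[of "exp (s * \<i> * \<theta>)"] using th E1 M1 by (intro mult_mono) auto
        then show ?thesis by (simp add: mult_ac)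
      qed
      have "v s x - exp (s * \<i> * \<theta>) * (b + s * \<i> * a) = (v s x - exp (s * \<i> * \<theta>r) * v s 0)
         + (exp (s * \<i> * \<theta>r) - exp (s * \<i> * \<theta>)) * v s 0 - exp (s * \<i> * \<theta>) * (s * \<i> * (r 0 * y 0))"
        unfolding v0 by (simp add: algebra_simps)
      also have "norm \<dots> \<le> norm (v s x - exp (s * \<i> * \<theta>r) * v s 0)
         + norm ((exp (s * \<i> * \<theta>r) - exp (s * \<i> * \<theta>)) * v s 0) + norm (exp (s * \<i> * \<theta>) * (s * \<i> * (r 0 * y 0)))"
        by (meson add_mono norm_triangle_ineq norm_triangle_ineq4 order_refl order_trans)
      also have "\<dots> \<le> E * (\<delta> * (36 * M\<^sup>2 * K) * N0) + E * (\<delta> * (8 * M) * N0) + E * (\<delta> * M * N0)"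
        using 1 2 3 by linarith
      also have "\<dots> \<le> E * (\<delta> * (36 * M\<^sup>2 * K + 17 * M) * N0)"
      proof -
        have "0 \<le> E * (\<delta> * (8 * M) * N0)" using E1 \<delta>(1) M1 N0 by simp
        then show ?thesis by (simp add: algebra_simps)
      qed
      finally show ?thesis .
    qed
    have ryx: "norm (r x * y x) \<le> E * (\<delta> * (4 * K) * N0)"
    proof -
      have yb: "norm (y x) \<le> E * (4 * K * N0) / norm lam"
      proof -
        have "norm lam * norm (y x) \<le> E * U" using step(1) by (simp add: E_def)
        also have "\<dots> \<le> E * (4 * K * N0)" using UK E1 by (intro mult_left_mono) auto
        finally show ?thesis using L1(4) by (simp add: field_simps)
      qed
      have "norm (r x * y x) \<le> Br * (E * (4 * K * N0) / norm lam)"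
        unfolding norm_mult using Brb[OF x] yb Br0 by (intro mult_mono) auto
      also have "\<dots> = (Br / norm lam) * (E * (4 * K * N0))" by simp
      also have "\<dots> \<le> \<delta> * (E * (4 * K * N0))"
        using L1(2,4) \<delta>(1) E1 K0 N0 by (intro mult_right_mono) (auto simp: field_simps)
      finally show ?thesis by (simp add: mult_ac)
    qed
    define X where "X s = v s x - exp (s * \<i> * \<theta>) * (b + s * \<i> * a)" for s
    have Xb: "norm (X 1) \<le> E * (\<delta> * (36 * M\<^sup>2 * K + 17 * M) * N0)" "norm (X (-1)) \<le> E * (\<delta> * (36 * M\<^sup>2 * K + 17 * M) * N0)"
      using fin[of 1] fin[of "-1"] unfolding X_def by simp_all
    have cs: "cos \<theta> = (exp (\<i> * \<theta>) + exp (- (\<i> * \<theta>))) / 2" "sin \<theta> = (exp (\<i> * \<theta>) - exp (- (\<i> * \<theta>))) / (2 * \<i>)"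
      by (simp_all add: cos_exp_eq sin_exp_eq)
    have eqA: "dy x - (b * cos \<theta> - a * sin \<theta>) = (X 1 + X (-1)) / 2"
      unfolding X_def v_def cs by (simp add: field_simps) (simp add: algebra_simps power2_eq_square)?
    have A: "norm (dy x - (b * cos \<theta> - a * sin \<theta>)) \<le> E * (\<delta> * (36 * M\<^sup>2 * K + 17 * M) * N0)"
      unfolding eqA using Xb norm_triangle_ineq[of "X 1" "X (-1)"] by (simp add: norm_divide)
    have "lam * y x - (a * cos \<theta> + b * sin \<theta>) = (X 1 - X (-1)) / (2 * \<i>) + r x * y x"
      unfolding X_def v_def cs by (simp add: field_simps) (simp add: algebra_simps power2_eq_square)?
    also have "norm \<dots> \<le> norm ((X 1 - X (-1)) / (2 * \<i>)) + norm (r x * y x)" by (rule norm_triangle_ineq)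
    also have "norm ((X 1 - X (-1)) / (2 * \<i>)) \<le> E * (\<delta> * (36 * M\<^sup>2 * K + 17 * M) * N0)"
      using Xb norm_triangle_ineq4[of "X 1" "X (-1)"] by (simp add: norm_divide norm_mult)
    finally have B: "norm (lam * y x - (a * cos \<theta> + b * sin \<theta>)) \<le> E * (\<delta> * C * N0)"
      using ryx by (simp add: C_def algebra_simps)
    have A': "norm (dy x - (b * cos \<theta> - a * sin \<theta>)) \<le> E * (\<delta> * C * N0)"
    proof -
      have "0 \<le> E * (\<delta> * (4 * K) * N0)" using E1 \<delta>(1) K0 N0 by simp
      then show ?thesis using A by (simp add: C_def algebra_simps)
    qed
    have lst: "E * (\<delta> * C * N0) \<le> \<epsilon> * E * N0"
      using mult_right_mono[OF \<delta>(3), of "E * N0"] E1 N0 by (simp add: mult_ac)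
    show "norm (lam * y x - (lam * y 0 * cos (lam * x - integral {0..x} p) + dy 0 * sin (lam * x - integral {0..x} p)))
       \<le> \<epsilon> * exp (\<bar>Im lam\<bar> * x) * (norm (lam * y 0) + norm (dy 0))"
      using order_trans[OF B lst] unfolding a_def b_def N0_def \<theta>_def E_def .
    show "norm (dy x - (dy 0 * cos (lam * x - integral {0..x} p) - lam * y 0 * sin (lam * x - integral {0..x} p)))
       \<le> \<epsilon> * exp (\<bar>Im lam\<bar> * x) * (norm (lam * y 0) + norm (dy 0))"
      using order_trans[OF A' lst] unfolding a_def b_def N0_def \<theta>_def E_def .
  qed
qed

section \<open>Entire functions with too many zeros\<close>

lemma entire_divide_linear:
  assumes g: "g holomorphic_on UNIV" and "g v = 0"
  shows "\<exists>h. h holomorphic_on UNIV \<and> (\<forall>z. g z = (z - v) * h z)"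
proof (intro exI conjI allI)
  show "(\<lambda>z. if z = v then deriv g v else (g z - g v) / (z - v)) holomorphic_on UNIV"
    by (rule pole_lemma_open[OF g]) simp
  show "g z = (z - v) * (if z = v then deriv g v else (g z - g v) / (z - v))" for z
    using assms(2) by simp
qed

lemma entire_divide_distinct:
  assumes "finite S" "f holomorphic_on UNIV" "\<And>v. v \<in> S \<Longrightarrow> f v = 0"
  shows "\<exists>g. g holomorphic_on UNIV \<and> (\<forall>z. f z = g z * (\<Prod>v\<in>S. z - v))"
  using assms
proof (induction S)
  case empty
  then show ?case by (intro exI[of _ f]) simp
next
  case (insert v S)
  then obtain g where g: "g holomorphic_on UNIV" "\<And>z. f z = g z * (\<Prod>v\<in>S. z - v)" by force
  have "(\<Prod>w\<in>S. v - w) \<noteq> 0" using insert.hyps by auto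
  moreover have "f v = 0" using insert.prems by simp
  ultimately have "g v = 0" using g(2)[of v] by simp
  from entire_divide_linear[OF g(1) this] obtain h where h: "h holomorphic_on UNIV" "\<And>z. g z = (z - v) * h z" by blast
  show ?case using h g(2) insert.hyps by (intro exI[of _ h]) (simp add: mult_ac)
qed

text \<open>The growth bound near \<open>v\<close> says that \<open>g\<close> is of first order small there once the factor \<open>(z - v)\<^sup>m\<close>
  is cancelled.\<close>

lemma entire_zero_of_bound:
  assumes g: "g holomorphic_on UNIV" and k: "k holomorphic_on UNIV" "k v \<noteq> 0"
    and ev: "\<forall>\<^sub>F z in at v. norm (g z * ((z - v) ^ m * k z)) \<le> C * norm (z - v) ^ Suc m"
  shows "g v = 0"
proof -
  have cont: "isCont (\<lambda>z. g z * k z) v"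
    using holomorphic_on_imp_continuous_on[OF holomorphic_on_mult[OF g k(1)]]
    by (simp add: continuous_on_eq_continuous_at)
  have "((\<lambda>z. g z * k z) \<longlongrightarrow> 0) (at v)"
  proof (rule Lim_null_comparison)
    have "\<forall>\<^sub>F z in at v. z \<noteq> v" by (simp add: eventually_at_filter)
    with ev show "\<forall>\<^sub>F z in at v. norm (g z * k z) \<le> C * norm (z - v)"
    proof eventually_elim
      case (elim z)
      then have "norm (z - v) ^ m * norm (g z * k z) \<le> norm (z - v) ^ m * (C * norm (z - v))"
        by (simp add: norm_mult norm_power mult_ac)
      then show ?case using elim(2) by (simp add: mult_le_cancel_left_pos)
    qed
    have "((\<lambda>z. C * norm (z - v)) \<longlongrightarrow> C * norm (v - v)) (at v)" by (intro tendsto_intros)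
    then show "((\<lambda>z. C * norm (z - v)) \<longlongrightarrow> 0) (at v)" by simp
  qed
  moreover have "((\<lambda>z. g z * k z) \<longlongrightarrow> g v * k v) (at v)" using cont by (simp add: isCont_def)
  ultimately have "g v * k v = 0" using tendsto_unique[OF at_neq_bot] by blast
  then show ?thesis using k(2) by simp
qed

lemma eventually_at_norm_diff_le_1: "\<forall>\<^sub>F z in at (v::complex). norm (z - v) \<le> 1"
  unfolding eventually_at by (rule exI[of _ 1]) (auto simp: dist_norm)

text \<open>Orders of vanishing are expressed by growth bounds instead of \<open>zorder\<close>, which is not meaningful for the
  zero function; the function to which this is applied turns out to be zero. Removing the points one at a
  time, each quotient still vanishes at the next point.\<close>

lemma entire_divide_family:
  fixes f :: "complex \<Rightarrow> complex" and w :: "'i \<Rightarrow> complex"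
  assumes "finite I" "f holomorphic_on UNIV"
    "\<And>i. i \<in> I \<Longrightarrow> \<exists>C. \<forall>\<^sub>F z in at (w i). norm (f z) \<le> C * norm (z - w i) ^ card {j\<in>I. w j = w i}"
  shows "\<exists>g. g holomorphic_on UNIV \<and> (\<forall>z. f z = g z * (\<Prod>i\<in>I. z - w i))"
  using assms
proof (induction I)
  case empty
  then show ?case by (intro exI[of _ f]) simp
next
  case (insert i I)
  have "\<exists>C. \<forall>\<^sub>F z in at (w k). norm (f z) \<le> C * norm (z - w k) ^ card {j\<in>I. w j = w k}" if k: "k \<in> I" for k
  proof -
    obtain C where C: "\<forall>\<^sub>F z in at (w k). norm (f z) \<le> C * norm (z - w k) ^ card {j\<in>insert i I. w j = w k}"
      using insert.prems(2)[of k] k by auto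
    have le: "card {j\<in>I. w j = w k} \<le> card {j\<in>insert i I. w j = w k}"
      by (rule card_mono) (use insert.hyps in auto)
    have "\<forall>\<^sub>F z in at (w k). norm (f z) \<le> \<bar>C\<bar> * norm (z - w k) ^ card {j\<in>I. w j = w k}"
      using C eventually_at_norm_diff_le_1
    proof eventually_elim
      case (elim z)
      have "norm (f z) \<le> \<bar>C\<bar> * norm (z - w k) ^ card {j\<in>insert i I. w j = w k}"
        using elim(1) mult_right_mono[OF abs_ge_self[of C], of "norm (z - w k) ^ card {j\<in>insert i I. w j = w k}"] by simp
      also have "\<dots> \<le> \<bar>C\<bar> * norm (z - w k) ^ card {j\<in>I. w j = w k}"
        by (intro mult_left_mono power_decreasing le elim(2)) auto
      finally show ?case .
    qed
    then show ?thesis by blast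
  qed
  with insert.IH insert.prems(1) obtain g where g: "g holomorphic_on UNIV" "\<And>z. f z = g z * (\<Prod>i\<in>I. z - w i)" by blast
  define v m where "v = w i" and "m = card {j\<in>I. w j = v}"
  define k where "k z = (\<Prod>j\<in>{j\<in>I. w j \<noteq> v}. z - w j)" for z
  have split: "(\<Prod>j\<in>I. z - w j) = (z - v) ^ m * k z" for z
  proof -
    have "(\<Prod>j\<in>I. z - w j) = (\<Prod>j\<in>{j\<in>I. w j = v}. z - w j) * k z"
      unfolding k_def by (subst prod.union_disjoint[symmetric]) (use insert.hyps in \<open>auto intro!: prod.cong\<close>)
    also have "(\<Prod>j\<in>{j\<in>I. w j = v}. z - w j) = (\<Prod>j\<in>{j\<in>I. w j = v}. z - v)" by (rule prod.cong) auto
    finally show ?thesis by (simp add: m_def)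
  qed
  have cd: "card {j\<in>insert i I. w j = w i} = Suc m"
  proof -
    have "{j\<in>insert i I. w j = w i} = insert i {j\<in>I. w j = v}" by (auto simp: v_def)
    then show ?thesis using insert.hyps by (simp add: m_def)
  qed
  obtain C where C: "\<forall>\<^sub>F z in at v. norm (f z) \<le> C * norm (z - v) ^ Suc m"
    using insert.prems(2)[of i] unfolding cd v_def by auto
  have "g v = 0"
  proof (rule entire_zero_of_bound[OF g(1)])
    show "k holomorphic_on UNIV" unfolding k_def by (intro holomorphic_intros)
    show "k v \<noteq> 0" unfolding k_def using insert.hyps by auto
    show "\<forall>\<^sub>F z in at v. norm (g z * ((z - v) ^ m * k z)) \<le> C * norm (z - v) ^ Suc m"
      using C unfolding g(2) split by simp
  qed
  from entire_divide_linear[OF g(1) this] obtain h where h: "h holomorphic_on UNIV" "\<And>z. g z = (z - v) * h z" by blast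
  show ?case using h g(2) insert.hyps by (intro exI[of _ h]) (simp add: mult_ac v_def)
qed

lemma norm_sin_ge_im:
  fixes w :: complex
  assumes "\<bar>Im w\<bar> \<ge> 1"
  shows "norm (sin w) \<ge> exp \<bar>Im w\<bar> / 4"
proof -
  have gen: "norm (sin w) \<ge> (exp \<bar>Im w\<bar> - exp (- \<bar>Im w\<bar>)) / 2" for w :: complex
  proof -
    have "norm (sin w) = norm (exp (\<i> * w) - exp (- (\<i> * w))) / 2"
      by (simp add: sin_exp_eq norm_divide norm_mult)
    moreover have "\<bar>norm (exp (\<i> * w)) - norm (exp (- (\<i> * w)))\<bar> \<le> norm (exp (\<i> * w) - exp (- (\<i> * w)))"
      by (rule norm_triangle_ineq3)
    moreover have "norm (exp (\<i> * w)) = exp (- Im w)" "norm (exp (- (\<i> * w))) = exp (Im w)"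
      by (simp_all add: norm_exp_eq_Re)
    ultimately show ?thesis by (cases "Im w \<ge> 0") auto
  qed
  have "2 \<le> exp \<bar>Im w\<bar>" using exp_ge_add_one_self[of "\<bar>Im w\<bar>"] assms by linarith
  moreover have "exp (- \<bar>Im w\<bar>) * 2 \<le> 1 * 2" by (intro mult_right_mono) auto
  ultimately have "exp (- \<bar>Im w\<bar>) * 2 \<le> exp \<bar>Im w\<bar>" by (simp only: mult_1)
  then have "exp \<bar>Im w\<bar> / 4 \<le> (exp \<bar>Im w\<bar> - exp (- \<bar>Im w\<bar>)) / 2" by simp
  then show ?thesis using gen[of w] by linarith
qed

lemma norm_sin_shift_pi: "norm (sin (w - of_int n * of_real pi)) = norm (sin (w::complex))"
proof -
  have "sin (w - of_int n * of_real pi) = sin w * cos (of_int n * of_real pi)"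
    using sin_diff[of w "of_int n * of_real pi"] sin_eq_0[of "of_int n * of_real pi :: complex"] by auto
  moreover have "norm (cos (of_int n * of_real pi :: complex)) = 1"
  proof -
    have s0: "sin (of_int n * of_real pi :: complex) = 0"
      using sin_eq_0[of "of_int n * of_real pi :: complex"] by auto
    have "(sin (of_int n * of_real pi :: complex))\<^sup>2 + (cos (of_int n * of_real pi :: complex))\<^sup>2 = 1"
      by (rule sin_cos_squared_add)
    then have "cos (of_int n * of_real pi :: complex) = 1 \<or> cos (of_int n * of_real pi :: complex) = - 1"
      unfolding s0 by (simp add: power2_eq_1_iff)
    then show ?thesis by (elim disjE) (simp_all only: norm_one norm_minus_cancel)
  qed
  ultimately show ?thesis by (simp add: norm_mult)
qed

text \<open>Far from the real axis one of the two exponentials in the sine dominates. Near it, periodicity reduces to a compact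
  set without zeros of the sine.\<close>

lemma norm_sin_lower_bound:
  assumes "\<eta> > 0"
  shows "\<exists>c>0. \<forall>w::complex. (\<forall>n::int. norm (w - of_int n * of_real pi) \<ge> \<eta>) \<longrightarrow> norm (sin w) \<ge> c * exp \<bar>Im w\<bar>"
proof -
  define K where "K = cbox (Complex (-pi) (-1)) (Complex pi 1) \<inter> (\<Inter>n::int. {w. \<eta> \<le> norm (w - of_int n * of_real pi)})"
  have "closed {w :: complex. \<eta> \<le> norm (w - of_int n * of_real pi)}" for n :: int
    by (intro closed_Collect_le continuous_intros)
  then have "compact K" unfolding K_def by (intro compact_Int_closed compact_cbox closed_INT) auto
  have nz: "sin w \<noteq> 0" if "w \<in> K" for w
  proof
    assume "sin w = 0"
    then obtain n :: int where n: "w = of_real (of_int n * pi)" using sin_eq_0[of w] by auto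
    have "\<eta> \<le> norm (w - of_int n * of_real pi)" using that unfolding K_def by blast
    then show False using assms n by simp
  qed
  have "\<exists>m>0. \<forall>w\<in>K. m \<le> norm (sin w)"
  proof (cases "K = {}")
    case False
    have "\<exists>w0\<in>K. \<forall>w\<in>K. norm (sin w0) \<le> norm (sin w)"
      by (rule continuous_attains_inf[OF \<open>compact K\<close> False]) (intro continuous_intros)
    then obtain w0 where "w0 \<in> K" "\<forall>w\<in>K. norm (sin w0) \<le> norm (sin w)" by blast
    then show ?thesis using nz[of w0] by (intro exI[of _ "norm (sin w0)"]) auto
  qed (auto intro: exI[of _ 1])
  then obtain m where m: "m > 0" "\<And>w. w \<in> K \<Longrightarrow> m \<le> norm (sin w)" by blast
  show ?thesis
  proof (intro exI[of _ "min (1/4) (m / exp 1)"] conjI allI impI)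
    show "0 < min (1/4) (m / exp 1)" using m by simp
    fix w :: complex assume far: "\<forall>n::int. norm (w - of_int n * of_real pi) \<ge> \<eta>"
    show "norm (sin w) \<ge> min (1/4) (m / exp 1) * exp \<bar>Im w\<bar>"
    proof (cases "\<bar>Im w\<bar> \<ge> 1")
      case True
      have "min (1/4) (m / exp 1) * exp \<bar>Im w\<bar> \<le> 1/4 * exp \<bar>Im w\<bar>"
        by (intro mult_right_mono min.cobounded1) simp
      then show ?thesis by (rule order_trans) (use norm_sin_ge_im[OF True] in simp)
    next
      case False
      define N where "N = \<lfloor>Re w / pi\<rfloor>"
      define w' where "w' = w - of_int N * of_real pi"
      have fl: "of_int N * pi \<le> Re w" "Re w \<le> of_int N * pi + pi"
      proof -
        have "of_int N \<le> Re w / pi" "Re w / pi \<le> of_int N + 1" unfolding N_def by linarith+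
        then show "of_int N * pi \<le> Re w" "Re w \<le> of_int N * pi + pi" by (simp_all add: field_simps)
      qed
      have "w' \<in> cbox (Complex (-pi) (-1)) (Complex pi 1)"
        using fl False by (auto simp: w'_def in_cbox_complex_iff)
      moreover have "\<eta> \<le> norm (w' - of_int n * of_real pi)" for n :: int
      proof -
        have "w' - of_int n * of_real pi = w - of_int (N + n) * of_real pi" by (simp add: w'_def algebra_simps)
        then show ?thesis using far by metis
      qed
      ultimately have "m \<le> norm (sin w')" by (intro m(2)) (auto simp: K_def)
      then have ms: "m \<le> norm (sin w)" by (simp add: w'_def norm_sin_shift_pi)
      have "min (1/4) (m / exp 1) * exp \<bar>Im w\<bar> \<le> m / exp 1 * exp 1"
        using False m(1) by (intro mult_mono) auto
      then show ?thesis using ms by simp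
    qed
  qed
qed

text \<open>The stronger bound with \<open>2 / (N + 1)\<close> subtracted makes the induction go through by telescoping.\<close>

lemma sum_inverse_square_int_le: "(\<Sum>n\<in>{- int N..int N}. 1 / (real_of_int \<bar>n\<bar> + 1)\<^sup>2) \<le> 4 - 2 / (real N + 1)"
proof (induction N)
  case (Suc N)
  have "{- int (Suc N)..int (Suc N)} = insert (int (Suc N)) (insert (- int (Suc N)) {- int N..int N})" by auto
  then have "(\<Sum>n\<in>{- int (Suc N)..int (Suc N)}. 1 / (real_of_int \<bar>n\<bar> + 1)\<^sup>2)
     = 2 / (real N + 2)\<^sup>2 + (\<Sum>n\<in>{- int N..int N}. 1 / (real_of_int \<bar>n\<bar> + 1)\<^sup>2)"
    by (simp add: algebra_simps)
  also have "\<dots> \<le> 2 / (real N + 2)\<^sup>2 + (4 - 2 / (real N + 1))" using Suc by simp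
  also have "2 / (real N + 2)\<^sup>2 \<le> 2 / ((real N + 1) * (real N + 2))"
    by (intro divide_left_mono) (auto simp: power2_eq_square)
  also have "2 / ((real N + 1) * (real N + 2)) = 2 / (real N + 1) - 2 / (real N + 2)" by (simp add: field_simps)
  finally show ?case by (simp add: add.commute)
qed simp

text \<open>The zeros of this sine are the points \<open>2 n + b\<close>, all simple; those in the disc of radius \<open>2 N + 1\<close> are
  exactly the ones with \<open>|n| \<le> N\<close>, because \<open>|b| < 1\<close>.\<close>

lemma sin_linear_factor:
  fixes b :: real and N :: nat
  assumes "\<bar>b\<bar> < 1"
  shows "\<exists>s. s holomorphic_on UNIV \<and>
     (\<forall>z. sin (of_real pi * (z - of_real b) / 2) = s z * (\<Prod>n\<in>{- int N..int N}. z - (2 * of_int n + of_real b))) \<and>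
     (\<forall>z\<in>cball 0 (2 * real N + 1). s z \<noteq> 0)"
proof -
  define f where "f z = sin (of_real pi * (z - of_real b) / 2)" for z :: complex
  define c where "c n = 2 * of_int n + complex_of_real b" for n :: int
  have inj: "inj_on c A" for A by (auto simp: inj_on_def c_def)
  have zero_iff: "f z = 0 \<longleftrightarrow> (\<exists>n. z = c n)" for z
  proof -
    have "f z = 0 \<longleftrightarrow> (\<exists>n::int. of_real pi * (z - of_real b) / 2 = of_real (of_int n * pi))"
      unfolding f_def sin_eq_0 by simp
    also have "\<dots> \<longleftrightarrow> (\<exists>n. z = c n)"
    proof (intro ex_cong1)
      fix n :: int
      have "of_real pi * (z - of_real b) / 2 - of_real (of_int n * pi) = of_real (pi / 2) * (z - c n)"
        by (simp add: c_def field_simps)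
      then show "of_real pi * (z - of_real b) / 2 = of_real (of_int n * pi) \<longleftrightarrow> z = c n"
        by (metis divide_eq_0_iff eq_iff_diff_eq_0 mult_eq_0_iff of_real_eq_0_iff pi_neq_zero zero_neq_numeral)
    qed
    finally show ?thesis .
  qed
  have fh: "f holomorphic_on UNIV" unfolding f_def by (intro holomorphic_intros) simp
  have "\<exists>g. g holomorphic_on UNIV \<and> (\<forall>z. f z = g z * (\<Prod>v\<in>c ` {- int N..int N}. z - v))"
    by (rule entire_divide_distinct[OF _ fh]) (use zero_iff in auto)
  then obtain s where s: "s holomorphic_on UNIV" "\<And>z. f z = s z * (\<Prod>v\<in>c ` {- int N..int N}. z - v)" by blast
  have s2: "f z = s z * (\<Prod>n\<in>{- int N..int N}. z - c n)" for z
    using s(2)[of z] by (simp add: prod.reindex[OF inj])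
  have "s z \<noteq> 0" if z: "z \<in> cball 0 (2 * real N + 1)" for z
  proof
    assume sz: "s z = 0"
    then have "f z = 0" using s2 by simp
    then obtain n where n: "z = c n" using zero_iff by blast
    have nz: "norm z = \<bar>2 * real_of_int n + b\<bar>"
    proof -
      have "z = of_real (2 * real_of_int n + b)" by (simp add: n c_def)
      then show ?thesis by (simp only: norm_of_real)
    qed
    have "\<bar>n\<bar> \<le> int N"
    proof (rule ccontr)
      assume "\<not> ?thesis"
      then have "real_of_int \<bar>n\<bar> \<ge> real N + 1" by linarith
      then show False using z nz assms by (simp add: dist_norm)
    qed
    then have P0: "(\<Prod>n\<in>{- int N..int N}. z - c n) = 0" using n by (intro prod_zero) (auto intro!: bexI[of _ n])
    define P where "P z = (\<Prod>n\<in>{- int N..int N}. z - c n)" for z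
    have "P holomorphic_on UNIV" unfolding P_def by (intro holomorphic_intros)
    then have dP: "(P has_field_derivative deriv P z) (at z)" by (rule holomorphic_derivI) auto
    have ds: "(s has_field_derivative deriv s z) (at z)" by (rule holomorphic_derivI[OF s(1)]) auto
    have "(f has_field_derivative deriv s z * P z + deriv P z * s z) (at z)"
    proof -
      have "f = (\<lambda>z. s z * P z)" by (simp add: fun_eq_iff s2 P_def)
      then show ?thesis using DERIV_mult[OF ds dP] by simp
    qed
    then have "(f has_field_derivative 0) (at z)" using P0 sz by (simp add: P_def)
    moreover have "(f has_field_derivative cos (of_real pi * (z - of_real b) / 2) * (of_real pi / 2)) (at z)"
      unfolding f_def by (auto intro!: derivative_eq_intros)
    ultimately have "cos (of_real pi * (z - of_real b) / 2) * (of_real pi / 2) = 0" by (metis DERIV_unique)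
    then have "cos (of_real pi * (z - of_real b) / 2) = 0" by simp
    moreover have "sin (of_real pi * (z - of_real b) / 2) = 0" using \<open>f z = 0\<close> by (simp add: f_def)
    ultimately show False using sin_cos_squared_add[of "of_real pi * (z - of_real b) / 2"] by simp
  qed
  then show ?thesis using s(1) s2 by (intro exI[of _ s]) (auto simp: f_def c_def)
qed

lemma prod_le_exp_sum:
  assumes "finite I" "\<And>i. i \<in> I \<Longrightarrow> 0 \<le> f i \<and> f i \<le> (1 + x i) * (g i :: real) \<and> 0 \<le> g i \<and> 0 \<le> x i"
  shows "(\<Prod>i\<in>I. f i) \<le> exp (\<Sum>i\<in>I. x i) * (\<Prod>i\<in>I. g i)"
proof -
  have "(\<Prod>i\<in>I. f i) \<le> (\<Prod>i\<in>I. exp (x i) * g i)"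
  proof (rule prod_mono)
    fix i assume i: "i \<in> I"
    have "(1 + x i) * g i \<le> exp (x i) * g i" using assms(2)[OF i] by (intro mult_right_mono exp_ge_add_one_self) auto
    then show "0 \<le> f i \<and> f i \<le> exp (x i) * g i" using assms(2)[OF i] by auto
  qed
  then show ?thesis using assms(1) by (simp add: prod.distrib exp_sum)
qed

text \<open>Let \<open>F\<close> be the product of the four sines with zeros at the model points \<open>b\<^sub>n\<^sub>k = 2 n + \<beta>\<^sub>k\<close>. On the circle
  \<open>|z| = R = 2 N + 1\<close>, which keeps a fixed distance from all model points, \<open>|F|\<close> is at least a multiple of
  \<open>exp (2 \<pi> |Im z|)\<close>. Divide \<open>D\<close> by its zeros \<open>\<Lambda>\<^sub>n\<^sub>k\<close> with \<open>|n| \<le> N\<close>, obtaining \<open>g\<close>, and \<open>F\<close> by all its zeros in the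
  disc, obtaining \<open>G\<close>. Products over the true and over the model zeros are comparable up to constants, both on
  the circle and at a fixed point of the imaginary axis, so on the circle \<open>|g / G|\<close> is at most a constant times
  \<open>R |D / F|\<close>, where the factor \<open>R\<close> comes from the one extra zero of \<open>F\<close>. The growth bound
  makes this small where \<open>|Im z|\<close> is large, but only bounded near the real axis. Multiplying by \<open>1 - z\<^sup>2 / R\<^sup>2\<close>, of modulus
  \<open>2 |Im z| / R\<close> on the circle, cures this; the maximum principle carries the smallness to points \<open>i t\<close>, and
  \<open>N \<rightarrow> \<infinity>\<close> gives \<open>D (i t) = 0\<close>.\<close>

lemma entire_zero_if_too_many_zeros:
  fixes D :: "complex \<Rightarrow> complex" and \<Lambda> :: "int \<times> nat \<Rightarrow> complex" and \<beta> :: "nat \<Rightarrow> real"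
  assumes D: "D holomorphic_on UNIV"
    and \<beta>: "\<And>k. k \<in> {1..4} \<Longrightarrow> \<bar>\<beta> k\<bar> < 1"
    and asy: "\<And>n k. (n,k) \<in> four_index_set \<Longrightarrow> norm (\<Lambda> (n,k) - (2 * of_int n + of_real (\<beta> k))) \<le> C / (real_of_int \<bar>n\<bar> + 1)"
    and dv: "\<And>I. finite I \<Longrightarrow> I \<subseteq> four_index_set \<Longrightarrow> \<exists>g. g holomorphic_on UNIV \<and> (\<forall>z. D z = g z * (\<Prod>i\<in>I. z - \<Lambda> i))"
    and growth: "\<And>\<epsilon>. \<epsilon> > 0 \<Longrightarrow> \<exists>R. \<forall>z. norm z \<ge> R \<longrightarrow> norm (z * D z) \<le> K + \<epsilon> * exp (2 * pi * \<bar>Im z\<bar>)"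
  shows "D z = 0"
proof -
  define b where "b i = 2 * of_int (fst i) + complex_of_real (\<beta> (snd i))" for i :: "int \<times> nat"
  \<comment> \<open>the circles of radius \<open>2 N + 1\<close> stay at distance \<open>\<delta>\<close> from the model points\<close>
  define \<delta> where "\<delta> = Min ((\<lambda>k. 1 - \<bar>\<beta> k\<bar>) ` {1..4})"
  have \<delta>: "\<delta> > 0" "\<And>k. k \<in> {1..4} \<Longrightarrow> \<bar>\<beta> k\<bar> \<le> 1 - \<delta>" "\<delta> \<le> 1"
  proof -
    show "\<delta> > 0" unfolding \<delta>_def by (subst Min_gr_iff) (use \<beta> in auto)
    show 1: "\<bar>\<beta> k\<bar> \<le> 1 - \<delta>" if "k \<in> {1..4}" for k
    proof -
      have "\<delta> \<le> 1 - \<bar>\<beta> k\<bar>" unfolding \<delta>_def by (rule Min_le) (use that in auto)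
      then show ?thesis by simp
    qed
    show "\<delta> \<le> 1" using 1[of 1] by auto
  qed
  have C0: "C \<ge> 0"
  proof -
    have "(0, 2) \<in> four_index_set" by (auto simp: four_index_set_def)
    from order_trans[OF norm_ge_zero asy[OF this]] show ?thesis by simp
  qed
  have nb: "b (n,k) = of_real (2 * real_of_int n + \<beta> k)" for n k by (simp add: b_def)
  obtain c where c: "c > 0" "\<And>w::complex. (\<And>n::int. norm (w - of_int n * of_real pi) \<ge> pi * \<delta> / 2) \<Longrightarrow> norm (sin w) \<ge> c * exp \<bar>Im w\<bar>"
    using norm_sin_lower_bound[of "pi * \<delta> / 2"] \<delta>(1) by auto
  define F where "F z = (\<Prod>k\<in>{1..4}. sin (of_real pi * (z - of_real (\<beta> k)) / 2))" for z :: complex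
  \<comment> \<open>the removed index is the zero that the model product has in excess\<close>
  define I where "I N = {- int N..int N} \<times> {1..4::nat} - {(0,1)}" for N :: nat
  have If: "finite (I N)" for N by (simp add: I_def)
  have Isub: "I N \<subseteq> four_index_set" for N
  proof
    fix i assume "i \<in> I N"
    moreover obtain n k where nk: "i = (n,k)" by force
    ultimately have i: "i = (n,k)" "k \<in> {1..4}" "(n,k) \<noteq> (0,1)" unfolding I_def by blast+
    then have "k = 1 \<or> k = 2 \<or> k = 3 \<or> k = 4" by auto
    then show "i \<in> four_index_set" using i by (auto simp: four_index_set_def)
  qed
  have Ik: "snd i \<in> {1..4}" "\<bar>fst i\<bar> \<le> int N" if "i \<in> I N" for i N using that by (auto simp: I_def)
  have asyI: "norm (\<Lambda> i - b i) \<le> C / (real_of_int \<bar>fst i\<bar> + 1)" if "i \<in> I N" for i N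
    using asy[of "fst i" "snd i"] Isub[of N] that by (auto simp: b_def)
  have sumI: "(\<Sum>i\<in>I N. h (fst i)) \<le> 4 * (\<Sum>n\<in>{- int N..int N}. h n)" if "\<And>n. h n \<ge> (0::real)" for h N
  proof -
    have "(\<Sum>i\<in>I N. h (fst i)) \<le> (\<Sum>i\<in>{- int N..int N} \<times> {1..4::nat}. h (fst i))"
      by (rule sum_mono2) (use that in \<open>auto simp: I_def\<close>)
    also have "\<dots> = (\<Sum>n\<in>{- int N..int N}. \<Sum>k\<in>{1..4::nat}. h n)"
      unfolding sum.cartesian_product split_def by (rule refl)
    finally show ?thesis by (simp add: sum_distrib_left)
  qed
  have dist_b: "norm (z - b (n,k)) \<ge> \<delta>" if "norm z = 2 * real N + 1" "k \<in> {1..4}" for z n k N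
  proof -
    have "\<bar>norm z - \<bar>2 * real_of_int n + \<beta> k\<bar>\<bar> \<le> norm (z - b (n,k))"
      using norm_triangle_ineq3[of z "b (n,k)"] unfolding nb norm_of_real .
    moreover have "\<bar>2 * real N + 1 - \<bar>2 * real_of_int n + \<beta> k\<bar>\<bar> \<ge> \<delta>"
    proof (cases "\<bar>n\<bar> \<le> int N")
      case True
      then have "real_of_int \<bar>n\<bar> \<le> real N" by linarith
      then show ?thesis using \<delta>(2)[OF that(2)] by linarith
    next
      case False
      then have "real_of_int \<bar>n\<bar> \<ge> real N + 1" by linarith
      then show ?thesis using \<delta>(2)[OF that(2)] by linarith
    qed
    ultimately show ?thesis using that(1) by linarith
  qed
  have dist_b2: "norm (z - b i) \<ge> 2 * (real N - real_of_int \<bar>fst i\<bar>) + \<delta>" if "norm z = 2 * real N + 1" "i \<in> I N" for z i N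
  proof -
    have "norm z - \<bar>2 * real_of_int (fst i) + \<beta> (snd i)\<bar> \<le> norm (z - b i)"
      using norm_triangle_ineq2[of z "b i"] nb[of "fst i" "snd i"] by (metis norm_of_real prod.collapse)
    moreover have "\<bar>2 * real_of_int (fst i) + \<beta> (snd i)\<bar> \<le> 2 * real_of_int \<bar>fst i\<bar> + \<bar>\<beta> (snd i)\<bar>"
      unfolding of_int_abs by linarith
    ultimately show ?thesis using that(1) \<delta>(2)[OF Ik(1)[OF that(2)]] by argo
  qed
  have F_lower: "norm (F z) \<ge> c ^ 4 * exp (2 * pi * \<bar>Im z\<bar>)" if z: "norm z = 2 * real N + 1" for z N
  proof -
    have "(\<Prod>k\<in>{1..4::nat}. c * exp (pi * \<bar>Im z\<bar> / 2)) \<le> (\<Prod>k\<in>{1..4}. norm (sin (of_real pi * (z - of_real (\<beta> k)) / 2)))"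
    proof (rule prod_mono)
      fix k :: nat assume k: "k \<in> {1..4}"
      have "c * exp \<bar>Im (of_real pi * (z - of_real (\<beta> k)) / 2)\<bar> \<le> norm (sin (of_real pi * (z - of_real (\<beta> k)) / 2))"
      proof (rule c(2))
        fix n :: int
        have eq: "of_real pi * (z - of_real (\<beta> k)) / 2 - of_int n * of_real pi = of_real (pi / 2) * (z - b (n,k))"
          by (simp add: b_def field_simps)
        have "norm (of_real pi * (z - of_real (\<beta> k)) / 2 - of_int n * of_real pi) = pi / 2 * norm (z - b (n,k))"
          unfolding eq norm_mult norm_of_real by simp
        then show "pi * \<delta> / 2 \<le> norm (of_real pi * (z - of_real (\<beta> k)) / 2 - of_int n * of_real pi)"
          using dist_b[OF z k, of n] by simp
      qed
      moreover have "\<bar>Im (of_real pi * (z - of_real (\<beta> k)) / 2)\<bar> = pi * \<bar>Im z\<bar> / 2" by (simp add: abs_mult)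
      ultimately show "0 \<le> c * exp (pi * \<bar>Im z\<bar> / 2) \<and> c * exp (pi * \<bar>Im z\<bar> / 2) \<le> norm (sin (of_real pi * (z - of_real (\<beta> k)) / 2))"
        using c(1) by simp
    qed
    moreover have "(\<Prod>k\<in>{1..4::nat}. c * exp (pi * \<bar>Im z\<bar> / 2)) = c ^ 4 * exp (2 * pi * \<bar>Im z\<bar>)"
    proof -
      have "(exp (pi * \<bar>Im z\<bar> / 2)) ^ 4 = exp (2 * pi * \<bar>Im z\<bar>)" by (simp add: exp_of_nat_mult[symmetric])
      then show ?thesis by (simp add: power_mult_distrib)
    qed
    ultimately show ?thesis by (simp add: F_def prod_norm)
  qed
  define X where "X = 16 * C / \<delta>"
  \<comment> \<open>on the circle each factor deviates by a relative error of order \<open>1 / N\<close>, and there are of order \<open>N\<close> factors\<close>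
  have ratio: "(\<Prod>i\<in>I N. norm (z - b i)) \<le> exp X * (\<Prod>i\<in>I N. norm (z - \<Lambda> i))"
    if z: "norm z = 2 * real N + 1" and N: "real N \<ge> 4 * C / \<delta>" "real N \<ge> 2 * C" for z N
  proof -
    define x where "x n = 2 * C / (\<delta> * (real N + 1))" for n :: int
    have each: "norm (z - b i) \<le> (1 + x (fst i)) * norm (z - \<Lambda> i)" if i: "i \<in> I N" for i
    proof -
      define a a1 where "a = real_of_int \<bar>fst i\<bar>" and "a1 = a + 1"
      have a: "0 \<le> a" "a \<le> real N" using Ik(2)[OF i] by (auto simp: a_def)
      have a1: "a1 > 0" "a1 \<ge> 1" using a by (auto simp: a1_def)
      define N1 where "N1 = real N + 1"
      have N1: "N1 > 0" by (simp add: N1_def)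
      define qq where "qq = C / a1"
      have B: "norm (z - b i) \<ge> 2 * (real N - a) + \<delta>" using dist_b2[OF z i] by (simp add: a_def)
      have A: "norm (\<Lambda> i - b i) \<le> qq" using asyI[OF i] by (simp add: a_def a1_def qq_def)
      have "2 * qq \<le> 2 * (real N - a) + \<delta>"
      proof (cases "2 * a \<ge> real N")
        case True
        have "4 * C \<le> real N * \<delta>" using N(1) \<delta>(1) by (simp add: field_simps)
        also have "\<dots> \<le> (2 * a1) * \<delta>" using True \<delta>(1) by (intro mult_right_mono) (auto simp: a1_def)
        finally have "2 * qq \<le> \<delta>" using a1 by (simp add: qq_def field_simps)
        moreover have "0 \<le> 2 * (real N - a)" using a by simp
        ultimately show ?thesis by argo
      next
        case False
        have "qq \<le> C" using mult_left_mono[OF a1(2) C0] a1 by (simp add: qq_def field_simps)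
        then show ?thesis using False N(2) \<delta>(1) by argo
      qed
      then have half: "2 * norm (\<Lambda> i - b i) \<le> norm (z - b i)" using A B by linarith
      have t: "norm (z - b i) \<le> norm (z - \<Lambda> i) + norm (\<Lambda> i - b i)"
        using norm_triangle_ineq[of "z - \<Lambda> i" "\<Lambda> i - b i"] by simp
      then have lam: "2 * norm (z - \<Lambda> i) \<ge> 2 * (real N - a) + \<delta>" using half B by linarith
      have "a1 * (real N - a + 1) \<ge> N1"
      proof -
        have "a1 * (real N - a + 1) = N1 + a * (real N - a)" by (simp add: a1_def N1_def algebra_simps)
        then show ?thesis using a by simp
      qed
      then have "\<delta> * N1 \<le> \<delta> * (a1 * (real N - a + 1))" using \<delta>(1) by (intro mult_left_mono) auto
      also have "\<dots> = a1 * (\<delta> * (real N - a) + \<delta>)" by (simp add: algebra_simps)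
      also have "\<dots> \<le> a1 * (2 * (real N - a) + \<delta>)"
        using \<delta> a a1 by (intro mult_left_mono add_right_mono mult_right_mono) auto
      also have "\<dots> \<le> a1 * (2 * norm (z - \<Lambda> i))" using lam a1 by (intro mult_left_mono) auto
      finally have key: "\<delta> * N1 \<le> a1 * (2 * norm (z - \<Lambda> i))" .
      have "qq \<le> x (fst i) * norm (z - \<Lambda> i)"
      proof -
        have "C * (\<delta> * N1) \<le> C * (a1 * (2 * norm (z - \<Lambda> i)))" using key C0 by (rule mult_left_mono)
        then have "C \<le> C * (a1 * (2 * norm (z - \<Lambda> i))) / (\<delta> * N1)"
          using \<delta>(1) N1 by (simp add: pos_le_divide_eq)
        also have "\<dots> = x (fst i) * norm (z - \<Lambda> i) * a1" by (simp add: x_def N1_def[symmetric])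
        finally show ?thesis using a1 by (simp add: qq_def pos_divide_le_eq)
      qed
      then show ?thesis using t A by (simp add: algebra_simps)
    qed
    have x0: "x n \<ge> 0" for n using C0 \<delta>(1) by (simp add: x_def)
    have "(\<Prod>i\<in>I N. norm (z - b i)) \<le> exp (\<Sum>i\<in>I N. x (fst i)) * (\<Prod>i\<in>I N. norm (z - \<Lambda> i))"
      by (rule prod_le_exp_sum[OF If]) (use each x0 in auto)
    also have "\<dots> \<le> exp X * (\<Prod>i\<in>I N. norm (z - \<Lambda> i))"
    proof (intro mult_right_mono prod_nonneg)
      have "(\<Sum>i\<in>I N. x (fst i)) \<le> 4 * (\<Sum>n\<in>{- int N..int N}. x n)" by (rule sumI[OF x0])
      also have "\<dots> = 4 * ((2 * real N + 1) * (2 * C / (\<delta> * (real N + 1))))" by (simp add: x_def)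
      also have "\<dots> \<le> 4 * ((2 * (real N + 1)) * (2 * C / (\<delta> * (real N + 1))))"
        using C0 \<delta>(1) by (intro mult_left_mono mult_right_mono) auto
      also have "\<dots> = X"
      proof -
        have N1: "real N + 1 \<noteq> 0" by simp
        define N1 where "N1 = real N + 1"
        then show ?thesis using \<delta>(1) N1 unfolding N1_def[symmetric] by (simp add: X_def)
      qed
      finally show "exp (\<Sum>i\<in>I N. x (fst i)) \<le> exp X" by simp
    qed auto
    finally show ?thesis .
  qed
  have zero_it: "D (\<i> * of_real t) = 0" if t: "t \<ge> 1" for t :: real
  proof -
    define z0 where "z0 = \<i> * complex_of_real t"
    define Y where "Y = 32 * C"
    \<comment> \<open>at a fixed point the relative errors are of order \<open>1 / n\<^sup>2\<close>, hence summable\<close>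
    have ratio0: "(\<Prod>i\<in>I N. norm (z0 - \<Lambda> i)) \<le> exp Y * (\<Prod>i\<in>I N. norm (z0 - b i))" for N
    proof -
      define x where "x n = 2 * C * (1 / (real_of_int \<bar>n\<bar> + 1)\<^sup>2)" for n
      have each: "norm (z0 - \<Lambda> i) \<le> (1 + x (fst i)) * norm (z0 - b i)" if i: "i \<in> I N" for i
      proof -
        define a where "a = real_of_int \<bar>fst i\<bar>"
        have a: "0 \<le> a" by (simp add: a_def)
        have r: "z0 - b i = Complex (- (2 * real_of_int (fst i) + \<beta> (snd i))) t"
          using nb[of "fst i" "snd i"] by (simp add: z0_def complex_eq_iff)
        have n1: "norm (z0 - b i) \<ge> t" using abs_Im_le_cmod[of "z0 - b i"] t by (simp add: r)
        have n2: "norm (z0 - b i) \<ge> 2 * a - 1"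
          using abs_Re_le_cmod[of "z0 - b i"] \<delta>(1) \<delta>(2)[OF Ik(1)[OF i]] unfolding r a_def complex.sel by linarith
        have n3: "norm (z0 - b i) \<ge> (a + 1) / 2"
        proof (cases "fst i = 0")
          case True
          then show ?thesis using n1 t by (simp add: a_def)
        next
          case False
          then have "a \<ge> 1" by (simp add: a_def)
          then show ?thesis using n2 by simp
        qed
        have "norm (\<Lambda> i - b i) \<le> C / (a + 1)" using asyI[OF i] by (simp add: a_def)
        also have "\<dots> = x (fst i) * ((a + 1) / 2)"
        proof -
          define a1 where "a1 = a + 1"
          have "x (fst i) = 2 * C * (1 / a1\<^sup>2)" by (simp add: x_def a1_def a_def)
          then show ?thesis using a unfolding a1_def[symmetric] by (simp add: power2_eq_square)
        qed
        also have "\<dots> \<le> x (fst i) * norm (z0 - b i)" using n3 C0 by (intro mult_left_mono) (auto simp: x_def)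
        finally have "norm (\<Lambda> i - b i) \<le> x (fst i) * norm (z0 - b i)" .
        moreover have "norm (z0 - \<Lambda> i) \<le> norm (z0 - b i) + norm (\<Lambda> i - b i)"
          using norm_triangle_ineq4[of "z0 - b i" "\<Lambda> i - b i"] by simp
        ultimately show ?thesis by (simp add: algebra_simps)
      qed
      have x0: "x n \<ge> 0" for n using C0 by (simp add: x_def)
      have "(\<Prod>i\<in>I N. norm (z0 - \<Lambda> i)) \<le> exp (\<Sum>i\<in>I N. x (fst i)) * (\<Prod>i\<in>I N. norm (z0 - b i))"
        by (rule prod_le_exp_sum[OF If]) (use each x0 in auto)
      also have "\<dots> \<le> exp Y * (\<Prod>i\<in>I N. norm (z0 - b i))"
      proof (intro mult_right_mono prod_nonneg)
        have "(\<Sum>i\<in>I N. x (fst i)) \<le> 4 * (\<Sum>n\<in>{- int N..int N}. x n)" by (rule sumI[OF x0])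
        also have "\<dots> = 8 * C * (\<Sum>n\<in>{- int N..int N}. 1 / (real_of_int \<bar>n\<bar> + 1)\<^sup>2)"
          unfolding x_def by (simp add: sum_distrib_left mult.assoc)
        also have "\<dots> \<le> 8 * C * 4"
        proof (rule mult_left_mono)
          have "0 \<le> 2 / (real N + 1)" by simp
          then show "(\<Sum>n\<in>{- int N..int N}. 1 / (real_of_int \<bar>n\<bar> + 1)\<^sup>2) \<le> 4"
            using sum_inverse_square_int_le[of N] by linarith
        qed (use C0 in simp)
        finally show "exp (\<Sum>i\<in>I N. x (fst i)) \<le> exp Y" by (simp add: Y_def)
      qed auto
      finally show ?thesis .
    qed
    define B where "B = exp Y * norm (F z0) * (4 * exp X / c ^ 4)"
    have B0: "B \<ge> 0" using c(1) by (simp add: B_def)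
    have main: "norm (D z0) \<le> B * (\<bar>K\<bar> / (2 * real N + 1) + \<epsilon>)"
      if \<epsilon>: "\<epsilon> > 0" and N: "real N \<ge> 4 * C / \<delta>" "real N \<ge> 2 * C" "2 * real N + 1 \<ge> t"
        and gr: "\<And>z. norm z = 2 * real N + 1 \<Longrightarrow> norm (z * D z) \<le> K + \<epsilon> * exp (2 * pi * \<bar>Im z\<bar>)" for \<epsilon> N
    proof -
      define R where "R = 2 * real N + 1"
      have R1: "R \<ge> 1" by (simp add: R_def)
      obtain g where g: "g holomorphic_on UNIV" "\<And>z. D z = g z * (\<Prod>i\<in>I N. z - \<Lambda> i)"
        using dv[OF If Isub] by blast
      have "\<forall>k\<in>{1..4}. \<exists>s. s holomorphic_on UNIV \<and>
         (\<forall>z. sin (of_real pi * (z - of_real (\<beta> k)) / 2) = s z * (\<Prod>n\<in>{- int N..int N}. z - (2 * of_int n + of_real (\<beta> k)))) \<and>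
         (\<forall>z\<in>cball 0 (2 * real N + 1). s z \<noteq> 0)" using sin_linear_factor \<beta> by blast
      from bchoice[OF this] obtain s where s: "\<And>k. k \<in> {1..4} \<Longrightarrow> s k holomorphic_on UNIV"
        "\<And>k z. k \<in> {1..4} \<Longrightarrow> sin (of_real pi * (z - of_real (\<beta> k)) / 2) = s k z * (\<Prod>n\<in>{- int N..int N}. z - (2 * of_int n + of_real (\<beta> k)))"
        "\<And>k z. k \<in> {1..4} \<Longrightarrow> z \<in> cball 0 R \<Longrightarrow> s k z \<noteq> 0" unfolding R_def by blast
      define G where "G z = (\<Prod>k\<in>{1..4}. s k z)" for z
      have Gh: "G holomorphic_on UNIV" unfolding G_def by (intro holomorphic_intros s(1))
      have Gnz: "G z \<noteq> 0" if "z \<in> cball 0 R" for z unfolding G_def using s(3) that by auto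
      have FG: "F z = G z * ((z - b (0,1)) * (\<Prod>i\<in>I N. z - b i))" for z
      proof -
        have "F z = (\<Prod>k\<in>{1..4}. s k z * (\<Prod>n\<in>{- int N..int N}. z - b (n,k)))"
          unfolding F_def by (rule prod.cong) (use s(2) in \<open>auto simp: b_def\<close>)
        also have "\<dots> = G z * (\<Prod>k\<in>{1..4}. \<Prod>n\<in>{- int N..int N}. z - b (n,k))"
          by (simp add: prod.distrib G_def)
        also have "(\<Prod>k\<in>{1..4}. \<Prod>n\<in>{- int N..int N}. z - b (n,k)) = (\<Prod>i\<in>{- int N..int N} \<times> {1..4}. z - b i)"
          by (subst prod.swap) (simp add: prod.cartesian_product split_def)
        also have "\<dots> = (z - b (0,1)) * (\<Prod>i\<in>I N. z - b i)"
          unfolding I_def by (rule prod.remove) auto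
        finally show ?thesis .
      qed
      define H where "H z = g z / G z * (1 - z\<^sup>2 / of_real R ^ 2)" for z
      have Hh: "H holomorphic_on cball 0 R" unfolding H_def
        by (intro holomorphic_intros holomorphic_on_subset[OF g(1)] holomorphic_on_subset[OF Gh] Gnz) (use R1 in auto)
      have bd: "norm (H z) \<le> 4 * exp X / c ^ 4 * (\<bar>K\<bar> / R + \<epsilon>)" if z: "norm z = R" for z
      proof -
        define e where "e = exp (2 * pi * \<bar>Im z\<bar>)"
        have e0: "e > 0" by (simp add: e_def)
        have zR: "norm z = 2 * real N + 1" using z by (simp add: R_def)
        define PL PB where "PL = (\<Prod>i\<in>I N. norm (z - \<Lambda> i))" and "PB = (\<Prod>i\<in>I N. norm (z - b i))"
        have PB0: "PB > 0" unfolding PB_def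
        proof (rule prod_pos)
          fix i assume i: "i \<in> I N"
          have "\<delta> \<le> norm (z - b i)" using dist_b[OF zR, of "snd i" "fst i"] Ik(1)[OF i] by simp
          then show "0 < norm (z - b i)" using \<delta>(1) by linarith
        qed
        have rat: "PB \<le> exp X * PL" unfolding PB_def PL_def by (rule ratio[OF zR N(1,2)])
        have PL0: "PL > 0"
        proof -
          have "PL \<ge> 0" unfolding PL_def by (intro prod_nonneg) auto
          moreover have "PL \<noteq> 0" using rat PB0 by auto
          ultimately show ?thesis by simp
        qed
        have gD: "norm (g z) * PL = norm (D z)" by (simp add: g(2) PL_def norm_mult prod_norm)
        have b01: "norm (z - b (0,1)) \<le> 2 * R"
        proof -
          have "norm (b (0,1)) \<le> 1" using \<beta>[of 1] by (simp add: b_def)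
          then show ?thesis using norm_triangle_ineq4[of z "b (0,1)"] z R1 by linarith
        qed
        have GF: "norm (F z) \<le> norm (G z) * (2 * R * PB)"
        proof -
          have "norm (F z) = norm (G z) * (norm (z - b (0,1)) * PB)" by (simp add: FG norm_mult PB_def prod_norm)
          also have "\<dots> \<le> norm (G z) * (2 * R * PB)" using b01 PB0 by (intro mult_left_mono mult_right_mono) auto
          finally show ?thesis .
        qed
        have Fl: "c ^ 4 * e \<le> norm (F z)" using F_lower[OF zR] by (simp add: e_def)
        have G0: "norm (G z) > 0" using Gnz[of z] z by (simp add: dist_norm)
        have c4: "c ^ 4 > 0" using c(1) by simp
        have D1: "norm (D z) * R \<le> \<bar>K\<bar> + \<epsilon> * e"
          using gr[OF zR] z by (simp add: norm_mult e_def mult.commute)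
        have chain: "norm (g z) * (c ^ 4 * e) \<le> norm (G z) * (2 * exp X * (\<bar>K\<bar> + \<epsilon> * e))"
        proof -
          have "norm (g z) * (c ^ 4 * e) \<le> norm (g z) * (norm (G z) * (2 * R * PB))"
            using Fl GF by (intro mult_left_mono) auto
          also have "\<dots> \<le> norm (g z) * (norm (G z) * (2 * R * (exp X * PL)))"
            using rat R1 by (intro mult_left_mono) auto
          also have "\<dots> = norm (G z) * (2 * exp X * (norm (D z) * R))" unfolding gD[symmetric] by (simp add: mult_ac)
          also have "\<dots> \<le> norm (G z) * (2 * exp X * (\<bar>K\<bar> + \<epsilon> * e))" using D1 by (intro mult_left_mono) auto
          finally show ?thesis .
        qed
        then have q: "norm (g z / G z) \<le> 2 * exp X / c ^ 4 * ((\<bar>K\<bar> + \<epsilon> * e) / e)"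
          using G0 c4 e0 by (simp add: norm_divide field_simps)
        \<comment> \<open>\<open>R\<^sup>2 - z\<^sup>2 = z (cnj z - z)\<close> on the circle\<close>
        have fac: "norm (1 - z\<^sup>2 / of_real R ^ 2) = 2 * \<bar>Im z\<bar> / R"
        proof -
          have zc: "z * cnj z = of_real (R ^ 2)" using complex_norm_square[of z] z by simp
          have "1 - z\<^sup>2 / of_real R ^ 2 = (of_real (R ^ 2) - z\<^sup>2) / of_real R ^ 2" using R1 by (simp add: field_simps)
          also have "of_real (R ^ 2) - z\<^sup>2 = z * (cnj z - z)" using zc by (simp add: power2_eq_square algebra_simps)
          also have "cnj z - z = - (2 * \<i> * of_real (Im z))" by (simp add: complex_eq_iff)
          finally have "norm (1 - z\<^sup>2 / of_real R ^ 2) = norm z * (2 * \<bar>Im z\<bar>) / R ^ 2"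
            using R1 by (simp add: norm_divide norm_mult norm_power)
          then show ?thesis using z R1 by (simp add: power2_eq_square)
        qed
        have Imz: "\<bar>Im z\<bar> \<le> R" using abs_Im_le_cmod[of z] z by simp
        \<comment> \<open>the bounded part \<open>|K| / e\<close> of the quotient is tamed by the factor \<open>|Im z|\<close>\<close>
        have ye: "\<bar>Im z\<bar> \<le> e"
        proof -
          have "1 \<le> 2 * pi" using pi_gt3 by simp
          then have "1 * \<bar>Im z\<bar> \<le> 2 * pi * \<bar>Im z\<bar>" by (intro mult_right_mono) auto
          then show ?thesis using exp_ge_add_one_self[of "2 * pi * \<bar>Im z\<bar>"] unfolding e_def by linarith
        qed
        have "norm (H z) = norm (g z / G z) * (2 * \<bar>Im z\<bar> / R)" by (simp only: H_def norm_mult fac)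
        also have "\<dots> \<le> 2 * exp X / c ^ 4 * ((\<bar>K\<bar> + \<epsilon> * e) / e) * (2 * \<bar>Im z\<bar> / R)"
          using q R1 by (intro mult_right_mono) auto
        also have "\<dots> = 4 * exp X / c ^ 4 * (\<bar>K\<bar> * (\<bar>Im z\<bar> / e) / R + \<epsilon> * (\<bar>Im z\<bar> / R))"
          using e0 R1 c4 by (simp add: field_simps)
        also have "\<dots> \<le> 4 * exp X / c ^ 4 * (\<bar>K\<bar> * 1 / R + \<epsilon> * 1)"
          using c4 e0 R1 ye Imz \<epsilon> by (intro mult_left_mono add_mono divide_right_mono) auto
        finally show ?thesis by simp
      qed
      have z0R: "z0 \<in> cball 0 R" using t N(3) by (simp add: z0_def R_def norm_mult)
      have H0: "norm (H z0) \<le> 4 * exp X / c ^ 4 * (\<bar>K\<bar> / R + \<epsilon>)"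
      proof (rule maximum_modulus_frontier[of H "cball 0 R"])
        show "H holomorphic_on interior (cball 0 R)" by (rule holomorphic_on_subset[OF Hh]) auto
        show "continuous_on (closure (cball 0 R)) H" using holomorphic_on_imp_continuous_on[OF Hh] by simp
        show "norm (H z) \<le> 4 * exp X / c ^ 4 * (\<bar>K\<bar> / R + \<epsilon>)" if "z \<in> frontier (cball 0 R)" for z
          using that R1 by (intro bd) (simp add: dist_norm)
      qed (use z0R in auto)
      have one: "norm (1 - z0\<^sup>2 / of_real R ^ 2) \<ge> 1"
      proof -
        have "1 - z0\<^sup>2 / of_real R ^ 2 = of_real (1 + t\<^sup>2 / R\<^sup>2)" by (simp add: z0_def power_mult_distrib)
        then show ?thesis by (simp only: norm_of_real) simp
      qed
      have gG: "norm (g z0) \<le> norm (H z0) * norm (G z0)"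
      proof -
        have "norm (g z0) * 1 \<le> norm (g z0) * norm (1 - z0\<^sup>2 / of_real R ^ 2)" using one by (intro mult_left_mono) auto
        also have "\<dots> = norm (H z0) * norm (G z0)" using Gnz[OF z0R] by (simp add: H_def norm_mult norm_divide)
        finally show ?thesis by simp
      qed
      define PB where "PB = (\<Prod>i\<in>I N. norm (z0 - b i))"
      have PB0: "PB \<ge> 0" unfolding PB_def by (intro prod_nonneg) auto
      have b1: "norm (z0 - b (0,1)) \<ge> 1" using abs_Im_le_cmod[of "z0 - b (0,1)"] t by (simp add: z0_def b_def)
      have GF0: "norm (G z0) * PB \<le> norm (F z0)"
      proof -
        have "norm (G z0) * (1 * PB) \<le> norm (G z0) * (norm (z0 - b (0,1)) * PB)"
          using b1 PB0 by (intro mult_left_mono mult_right_mono) auto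
        then show ?thesis by (simp add: FG norm_mult PB_def prod_norm)
      qed
      have "norm (D z0) = norm (g z0) * (\<Prod>i\<in>I N. norm (z0 - \<Lambda> i))" by (simp add: g(2) norm_mult prod_norm)
      also have "\<dots> \<le> (norm (H z0) * norm (G z0)) * (exp Y * PB)"
        using gG ratio0[of N] by (intro mult_mono) (auto simp: PB_def intro!: prod_nonneg)
      also have "\<dots> = norm (H z0) * exp Y * (norm (G z0) * PB)" by (simp add: mult_ac)
      also have "\<dots> \<le> (4 * exp X / c ^ 4 * (\<bar>K\<bar> / R + \<epsilon>)) * exp Y * norm (F z0)"
        using H0 GF0 PB0 c(1) R1 \<epsilon> by (intro mult_mono) auto
      also have "\<dots> = B * (\<bar>K\<bar> / R + \<epsilon>)" by (simp add: B_def mult_ac)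
      finally show ?thesis by (simp add: R_def)
    qed
    have "norm (D z0) \<le> 0 + e" if e: "e > 0" for e :: real
    proof -
      define \<epsilon> where "\<epsilon> = e / (2 * (B + 1))"
      have \<epsilon>: "\<epsilon> > 0" using e B0 by (simp add: \<epsilon>_def)
      obtain R0 where R0: "\<And>z. norm z \<ge> R0 \<Longrightarrow> norm (z * D z) \<le> K + \<epsilon> * exp (2 * pi * \<bar>Im z\<bar>)"
        using growth[OF \<epsilon>] by blast
      obtain N :: nat where N: "real N \<ge> \<bar>R0\<bar> + 4 * C / \<delta> + 2 * C + t + \<bar>K\<bar> / \<epsilon>" using real_arch_simple by blast
      have nn: "4 * C / \<delta> \<ge> 0" "\<bar>K\<bar> / \<epsilon> \<ge> 0" using C0 \<delta>(1) \<epsilon> by auto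
      have ge: "real N \<ge> 4 * C / \<delta>" "real N \<ge> 2 * C" "real N \<ge> t" "real N \<ge> R0" "real N \<ge> \<bar>K\<bar> / \<epsilon>"
        using N nn C0 t by linarith+
      have "norm (D z0) \<le> B * (\<bar>K\<bar> / (2 * real N + 1) + \<epsilon>)"
        by (rule main[OF \<epsilon>]) (use ge t in \<open>auto intro!: R0\<close>)
      also have "\<dots> \<le> B * (\<epsilon> + \<epsilon>)"
      proof (intro mult_left_mono add_right_mono B0)
        have "\<bar>K\<bar> \<le> real N * \<epsilon>" using ge(5) \<epsilon> by (simp add: pos_divide_le_eq)
        also have "\<dots> \<le> (2 * real N + 1) * \<epsilon>" using \<epsilon> by (intro mult_right_mono) auto
        finally show "\<bar>K\<bar> / (2 * real N + 1) \<le> \<epsilon>" by (simp add: pos_divide_le_eq mult.commute)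
      qed
      also have "\<dots> = B * (e / (B + 1))"
      proof -
        define B1 where "B1 = B + 1"
        have "B1 \<noteq> 0" using B0 by (simp add: B1_def)
        then show ?thesis by (simp add: \<epsilon>_def B1_def[symmetric])
      qed
      also have "\<dots> \<le> e" using B0 e by (simp add: field_simps)
      finally show ?thesis by simp
    qed
    then have "norm (D z0) \<le> 0" by (rule field_le_epsilon)
    then show ?thesis by (simp add: z0_def)
  qed
  \<comment> \<open>\<open>2 i\<close> is one of the accumulation points of the zeros on the imaginary axis\<close>
  show "D z = 0"
  proof (rule analytic_continuation[OF D, of "(\<lambda>t. \<i> * of_real t) ` {1..}" "2 * \<i>"])
    show "2 * \<i> islimpt (\<lambda>t. \<i> * of_real t) ` {1..}"
      unfolding islimpt_approachable
    proof (intro allI impI)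
      fix e :: real assume "e > 0"
      then show "\<exists>x'\<in>(\<lambda>t. \<i> * of_real t) ` {1..}. x' \<noteq> 2 * \<i> \<and> dist x' (2 * \<i>) < e"
        by (intro bexI[of _ "\<i> * of_real (2 + e / 2)"]) (auto simp: dist_norm complex_eq_iff cmod_def image_iff intro!: exI[of _ "2 + e / 2"])
    qed
    show "D z = 0" if "z \<in> (\<lambda>t. \<i> * of_real t) ` {1..}" for z using that zero_it by auto
  qed auto
qed

section \<open>Characteristic solutions and the characteristic function\<close>

lemma norm_sin_le_exp: "norm (sin w) \<le> exp \<bar>Im (w::complex)\<bar>"
  and norm_cos_le_exp: "norm (cos w) \<le> exp \<bar>Im (w::complex)\<bar>"
proof -
  have e: "norm (exp (\<i> * w)) \<le> exp \<bar>Im w\<bar>" "norm (exp (- (\<i> * w))) \<le> exp \<bar>Im w\<bar>"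
    by (simp_all add: norm_exp_eq_Re)
  have "2 * norm (sin w) = norm (exp (\<i> * w) - exp (- (\<i> * w)))"
    by (simp add: sin_exp_eq norm_divide norm_mult)
  then show "norm (sin w) \<le> exp \<bar>Im w\<bar>"
    using norm_triangle_ineq4[of "exp (\<i> * w)" "exp (- (\<i> * w))"] e by linarith
  have "2 * norm (cos w) = norm (exp (\<i> * w) + exp (- (\<i> * w)))"
    by (simp add: cos_exp_eq norm_divide norm_mult)
  then show "norm (cos w) \<le> exp \<bar>Im w\<bar>"
    using norm_triangle_ineq[of "exp (\<i> * w)" "exp (- (\<i> * w))"] e by linarith
qed

lemma exp_decay_at_top:
  assumes "c < 0"
  shows "((\<lambda>t. complex_of_real (exp (c * t))) \<longlongrightarrow> 0) at_top"
proof -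
  have "filterlim (\<lambda>t::real. c * t) at_bot at_top"
    by (rule filterlim_tendsto_neg_mult_at_bot[OF tendsto_const assms filterlim_ident])
  from filterlim_compose[OF exp_at_bot this] have "((\<lambda>t. exp (c * t)) \<longlongrightarrow> 0) at_top" .
  from tendsto_of_real[OF this, where 'a=complex] show ?thesis by simp
qed

definition edge_coeffs :: "(real \<Rightarrow> complex) \<Rightarrow> (real \<Rightarrow> complex) \<Rightarrow> bool" where
  "edge_coeffs p q \<longleftrightarrow> continuous_on {0..pi} p \<and> q absolutely_integrable_on {0..pi}"

lemma coefficients_edge_coeffs:
  assumes "coefficients m p q" "j \<in> {1..m}"
  shows "edge_coeffs (p j) (q j)"
proof -
  have "abs_cont_on 0 pi (p j)" "q j absolutely_integrable_on {0<..<pi}" using assms by (auto simp: coefficients_def)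
  then show ?thesis
    by (simp add: edge_coeffs_def abs_cont_on_imp_continuous_on absolutely_integrable_on_Icc_iff_Ioo)
qed

lemma sol_S_edge_solution:
  assumes "edge_coeffs p q"
  shows "edge_solution p q lam (\<lambda>x. sol_S p q x lam) (\<lambda>x. deriv_S p q x lam)"
    "sol_S p q 0 lam = 0" "deriv_S p q 0 lam = 1"
  using ivp_edge_solution[where p = p and q = q and lam = lam and a = 0 and b = 1] assms by (auto simp: edge_coeffs_def sol_S_def deriv_S_def)

lemma sol_C_edge_solution:
  assumes "edge_coeffs p q"
  shows "edge_solution p q lam (\<lambda>x. sol_C p q x lam) (\<lambda>x. snd (ivp p q 1 0 lam) x)"
    "sol_C p q 0 lam = 1" "snd (ivp p q 1 0 lam) 0 = 0"
  using ivp_edge_solution[where p = p and q = q and lam = lam and a = 1 and b = 0] assms by (auto simp: edge_coeffs_def sol_C_def)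

lemma sol_holomorphic:
  assumes "edge_coeffs p q" "x \<in> {0..pi}"
  shows "(\<lambda>lam. sol_S p q x lam) holomorphic_on UNIV" "(\<lambda>lam. deriv_S p q x lam) holomorphic_on UNIV"
    "(\<lambda>lam. sol_C p q x lam) holomorphic_on UNIV"
  using ivp_holomorphic[of p q x 0 1] ivp_holomorphic[of p q x 1 0] assms
  by (auto simp: edge_coeffs_def sol_S_def deriv_S_def sol_C_def)

lemma d_loop_holomorphic:
  assumes "edge_coeffs p q"
  shows "d_loop p q holomorphic_on UNIV"
  unfolding d_loop_def[abs_def] by (intro holomorphic_intros sol_holomorphic assms) auto

text \<open>The coefficient of \<open>y\<close> in the equation is the same for both solutions, so the Wronskian has derivative zero
  almost everywhere, and it is absolutely continuous.\<close>

lemma wronskian_const: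
  assumes y: "edge_solution p q lam y dy" and z: "edge_solution p q lam z dz" and x: "x \<in> {0..pi}"
  shows "y x * dz x - dy x * z x = y 0 * dz 0 - dy 0 * z 0"
proof -
  have ac: "ac_deriv 0 pi y dy" "ac_deriv 0 pi dy (\<lambda>x. pot p q lam x * y x)"
    "ac_deriv 0 pi z dz" "ac_deriv 0 pi dz (\<lambda>x. pot p q lam x * z x)"
    using y z by (simp_all add: edge_solution_iff_ac_deriv)
  have "ac_deriv 0 pi (\<lambda>x. y x * dz x - dy x * z x)
     (\<lambda>x. (y x * (pot p q lam x * z x) + dy x * dz x) - (dy x * dz x + (pot p q lam x * y x) * z x))"
    by (intro ac_deriv_diff ac_deriv_mult ac)
  then have "ac_deriv 0 pi (\<lambda>x. y x * dz x - dy x * z x) (\<lambda>x. 0)"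
    by (rule ac_deriv_cong) (auto simp: algebra_simps)
  from ac_deriv_integral(2)[OF this, of 0 x] x show ?thesis by simp
qed

lemma wronskian_C_S:
  assumes "edge_coeffs p q" "x \<in> {0..pi}"
  shows "sol_C p q x lam * deriv_S p q x lam - snd (ivp p q 1 0 lam) x * sol_S p q x lam = 1"
  using wronskian_const[OF sol_C_edge_solution(1)[OF assms(1)] sol_S_edge_solution(1)[OF assms(1)] assms(2), of lam]
  by (simp add: sol_C_edge_solution[OF assms(1)] sol_S_edge_solution[OF assms(1)])

lemma sol_asymptotics:
  assumes c: "edge_coeffs p q" and \<epsilon>: "\<epsilon> > 0"
  shows "\<exists>R>0. \<forall>lam. \<forall>x\<in>{0..pi}. R \<le> norm lam \<longrightarrow>
     norm (lam * sol_S p q x lam - sin (lam * x - integral {0..x} p)) \<le> \<epsilon> * exp (\<bar>Im lam\<bar> * x) \<and>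
     norm (deriv_S p q x lam - cos (lam * x - integral {0..x} p)) \<le> \<epsilon> * exp (\<bar>Im lam\<bar> * x) \<and>
     norm (sol_C p q x lam - cos (lam * x - integral {0..x} p)) \<le> \<epsilon> * exp (\<bar>Im lam\<bar> * x)"
proof -
  have pq: "continuous_on {0..pi} p" "q absolutely_integrable_on {0..pi}" using c by (auto simp: edge_coeffs_def)
  from edge_asymptotics[OF pq \<epsilon>] obtain R where R: "R > 0" "\<And>lam y dy x. x\<in>{0..pi} \<Longrightarrow> R \<le> norm lam \<Longrightarrow> edge_solution p q lam y dy \<Longrightarrow>
     norm (lam * y x - (lam * y 0 * cos (lam * x - integral {0..x} p) + dy 0 * sin (lam * x - integral {0..x} p)))
       \<le> \<epsilon> * exp (\<bar>Im lam\<bar> * x) * (norm (lam * y 0) + norm (dy 0)) \<and>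
     norm (dy x - (dy 0 * cos (lam * x - integral {0..x} p) - lam * y 0 * sin (lam * x - integral {0..x} p)))
       \<le> \<epsilon> * exp (\<bar>Im lam\<bar> * x) * (norm (lam * y 0) + norm (dy 0))" by blast
  show ?thesis
  proof (intro exI[of _ R] conjI allI ballI impI, fact R(1))
    fix lam :: complex and x :: real assume x: "x \<in> {0..pi}" and lam: "R \<le> norm lam"
    note S = R(2)[OF x lam sol_S_edge_solution(1)[OF c]]
    note C = R(2)[OF x lam sol_C_edge_solution(1)[OF c], THEN conjunct1]
    show "norm (lam * sol_S p q x lam - sin (lam * x - integral {0..x} p)) \<le> \<epsilon> * exp (\<bar>Im lam\<bar> * x)"
      "norm (deriv_S p q x lam - cos (lam * x - integral {0..x} p)) \<le> \<epsilon> * exp (\<bar>Im lam\<bar> * x)"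
      using S by (simp_all add: sol_S_edge_solution[OF c])
    have l0: "norm lam > 0" using lam R(1) by linarith
    have "norm (lam * (sol_C p q x lam - cos (lam * x - integral {0..x} p))) \<le> \<epsilon> * exp (\<bar>Im lam\<bar> * x) * norm lam"
      using C by (simp add: sol_C_edge_solution[OF c] right_diff_distrib)
    then have "norm lam * norm (sol_C p q x lam - cos (lam * x - integral {0..x} p)) \<le> norm lam * (\<epsilon> * exp (\<bar>Im lam\<bar> * x))"
      by (simp only: norm_mult mult_ac)
    then show "norm (sol_C p q x lam - cos (lam * x - integral {0..x} p)) \<le> \<epsilon> * exp (\<bar>Im lam\<bar> * x)"
      using l0 by (simp only: mult_le_cancel_left_pos)
  qed
qed

lemma sol_upper_bounds:
  assumes c: "edge_coeffs p q"
  shows "\<exists>R>0. \<exists>K>0. \<forall>lam. \<forall>x\<in>{0..pi}. R \<le> norm lam \<longrightarrow>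
     norm (lam * sol_S p q x lam) \<le> K * exp (\<bar>Im lam\<bar> * x) \<and> norm (sol_C p q x lam) \<le> K * exp (\<bar>Im lam\<bar> * x)"
proof -
  have pc: "continuous_on {0..pi} p" using c by (simp add: edge_coeffs_def)
  obtain B where B: "B > 0" "\<And>x. x \<in> {0..pi} \<Longrightarrow> norm (p x) \<le> B"
    using continuous_on_Icc_norm_bound[OF pc] by blast
  from sol_asymptotics[OF c, of 1] obtain R where R: "R > 0" "\<And>lam x. x\<in>{0..pi} \<Longrightarrow> R \<le> norm lam \<Longrightarrow>
     norm (lam * sol_S p q x lam - sin (lam * x - integral {0..x} p)) \<le> exp (\<bar>Im lam\<bar> * x) \<and>
     norm (sol_C p q x lam - cos (lam * x - integral {0..x} p)) \<le> exp (\<bar>Im lam\<bar> * x)" by auto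
  define K where "K = 1 + exp (B * pi)"
  show ?thesis
  proof (rule exI[of _ R], intro conjI, fact R(1), rule exI[of _ K], intro conjI allI ballI impI)
    show "K > 0" by (simp add: K_def add_pos_pos)
    fix lam :: complex and x :: real assume x: "x \<in> {0..pi}" and lam: "R \<le> norm lam"
    define E where "E = exp (\<bar>Im lam\<bar> * x)"
    have "\<bar>Im (lam * x - integral {0..x} p)\<bar> \<le> \<bar>Im lam\<bar> * x + B * pi"
    proof -
      have "\<bar>Im (lam * x)\<bar> = \<bar>Im lam\<bar> * x" using x by (simp add: abs_mult)
      moreover have "\<bar>Im (integral {0..x} p)\<bar> \<le> B * pi"
        using norm_integral_le_pi[OF pc B(2) x] abs_Im_le_cmod[of "integral {0..x} p"] by linarith
      ultimately show ?thesis unfolding minus_complex.sel by linarith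
    qed
    then have "exp \<bar>Im (lam * x - integral {0..x} p)\<bar> \<le> exp (\<bar>Im lam\<bar> * x + B * pi)" by (simp only: exp_le_cancel_iff)
    then have e: "exp \<bar>Im (lam * x - integral {0..x} p)\<bar> \<le> E * exp (B * pi)" by (simp add: E_def exp_add)
    have K: "K * E = E + E * exp (B * pi)" by (simp add: K_def algebra_simps)
    show "norm (lam * sol_S p q x lam) \<le> K * exp (\<bar>Im lam\<bar> * x)"
      using R(2)[OF x lam] norm_sin_le_exp[of "lam * x - integral {0..x} p"] e
        norm_triangle_sub[of "lam * sol_S p q x lam" "sin (lam * x - integral {0..x} p)"]
      unfolding E_def[symmetric] K by linarith
    show "norm (sol_C p q x lam) \<le> K * exp (\<bar>Im lam\<bar> * x)"
      using R(2)[OF x lam] norm_cos_le_exp[of "lam * x - integral {0..x} p"] e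
        norm_triangle_sub[of "sol_C p q x lam" "cos (lam * x - integral {0..x} p)"]
      unfolding E_def[symmetric] K by linarith
  qed
qed

text \<open>Because the mean of \<open>p\<close> is real, the phase \<open>\<lambda> \<pi> - \<integral> p\<close> has imaginary part exactly \<open>\<pi> Im \<lambda>\<close>.\<close>

lemma sol_S_lower_bound:
  assumes c: "edge_coeffs p q" and re: "Im (integral {0..pi} p) = 0"
  shows "\<exists>R>0. \<forall>lam. R \<le> norm lam \<longrightarrow> \<bar>Im lam\<bar> \<ge> 1 \<longrightarrow> norm (lam * sol_S p q pi lam) \<ge> exp (\<bar>Im lam\<bar> * pi) / 8"
proof -
  from sol_asymptotics[OF c, of "1/8"] obtain R where R: "R > 0" "\<And>lam x. x\<in>{0..pi} \<Longrightarrow> R \<le> norm lam \<Longrightarrow>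
     norm (lam * sol_S p q x lam - sin (lam * x - integral {0..x} p)) \<le> 1/8 * exp (\<bar>Im lam\<bar> * x)" by auto
  show ?thesis
  proof (intro exI[of _ R] conjI allI impI, fact R(1))
    fix lam assume lam: "R \<le> norm lam" and im: "\<bar>Im lam\<bar> \<ge> 1"
    define w where "w = lam * pi - integral {0..pi} p"
    have Imw: "\<bar>Im w\<bar> = \<bar>Im lam\<bar> * pi" using re by (simp add: w_def abs_mult)
    have "1 * 1 \<le> \<bar>Im lam\<bar> * pi" using im pi_gt3 by (intro mult_mono) auto
    then have "norm (sin w) \<ge> exp (\<bar>Im lam\<bar> * pi) / 4" using norm_sin_ge_im[of w] Imw by simp
    moreover have "norm (lam * sol_S p q pi lam - sin w) \<le> 1/8 * exp (\<bar>Im lam\<bar> * pi)"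
      unfolding w_def by (rule R(2)[OF _ lam]) simp
    ultimately show "norm (lam * sol_S p q pi lam) \<ge> exp (\<bar>Im lam\<bar> * pi) / 8"
      using norm_triangle_sub[of "sin w" "lam * sol_S p q pi lam"] by (simp add: norm_minus_commute)
  qed
qed

text \<open>The leading terms combine by the addition theorem to \<open>sin\<close> of the difference of the two phases, a
  constant; all the other terms contain an error factor. The constant \<open>K\<close> is thus the modulus of that sine.\<close>

lemma cross_growth:
  assumes c: "edge_coeffs p q" "edge_coeffs p' q'"
    and re: "Im (integral {0..pi} p) = 0" "Im (integral {0..pi} p') = 0"
  shows "\<exists>K. \<forall>\<epsilon>>0. \<exists>R. \<forall>z. norm z \<ge> R \<longrightarrow>
    norm (z * (sol_S p q pi z * deriv_S p' q' pi z - sol_S p' q' pi z * deriv_S p q pi z)) \<le> K + \<epsilon> * exp (2 * pi * \<bar>Im z\<bar>)"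
proof (rule exI[of _ "norm (sin (integral {0..pi} p' - integral {0..pi} p))"], intro allI impI)
  fix \<epsilon> :: real assume "\<epsilon> > 0"
  define \<eta> where "\<eta> = min 1 (\<epsilon> / 6)"
  have \<eta>: "\<eta> > 0" "\<eta> \<le> 1" "6 * \<eta> \<le> \<epsilon>" using \<open>\<epsilon> > 0\<close> by (auto simp: \<eta>_def)
  from sol_asymptotics[OF c(1) \<eta>(1)] obtain R1 where R1: "\<And>lam x. x\<in>{0..pi} \<Longrightarrow> R1 \<le> norm lam \<Longrightarrow>
     norm (lam * sol_S p q x lam - sin (lam * x - integral {0..x} p)) \<le> \<eta> * exp (\<bar>Im lam\<bar> * x) \<and>
     norm (deriv_S p q x lam - cos (lam * x - integral {0..x} p)) \<le> \<eta> * exp (\<bar>Im lam\<bar> * x)" by blast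
  from sol_asymptotics[OF c(2) \<eta>(1)] obtain R2 where R2: "\<And>lam x. x\<in>{0..pi} \<Longrightarrow> R2 \<le> norm lam \<Longrightarrow>
     norm (lam * sol_S p' q' x lam - sin (lam * x - integral {0..x} p')) \<le> \<eta> * exp (\<bar>Im lam\<bar> * x) \<and>
     norm (deriv_S p' q' x lam - cos (lam * x - integral {0..x} p')) \<le> \<eta> * exp (\<bar>Im lam\<bar> * x)" by blast
  show "\<exists>R. \<forall>z. norm z \<ge> R \<longrightarrow>
    norm (z * (sol_S p q pi z * deriv_S p' q' pi z - sol_S p' q' pi z * deriv_S p q pi z))
      \<le> norm (sin (integral {0..pi} p' - integral {0..pi} p)) + \<epsilon> * exp (2 * pi * \<bar>Im z\<bar>)"
  proof (intro exI[of _ "max R1 R2"] allI impI)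
    fix z :: complex assume z: "max R1 R2 \<le> norm z"
    define \<theta> \<theta>' where "\<theta> = z * pi - integral {0..pi} p" and "\<theta>' = z * pi - integral {0..pi} p'"
    define E where "E = exp (\<bar>Im z\<bar> * pi)"
    have E0: "E > 0" by (simp add: E_def)
    have EE: "E * E = exp (2 * pi * \<bar>Im z\<bar>)" by (simp add: E_def exp_add[symmetric] algebra_simps)
    have im: "\<bar>Im \<theta>\<bar> = \<bar>Im z\<bar> * pi" "\<bar>Im \<theta>'\<bar> = \<bar>Im z\<bar> * pi" using re by (simp_all add: \<theta>_def \<theta>'_def abs_mult)
    define e1 e2 f1 f2 where "e1 = z * sol_S p q pi z - sin \<theta>" and "e2 = deriv_S p q pi z - cos \<theta>"
      and "f1 = z * sol_S p' q' pi z - sin \<theta>'" and "f2 = deriv_S p' q' pi z - cos \<theta>'"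
    have b1: "norm e1 \<le> \<eta> * E" "norm e2 \<le> \<eta> * E" using R1[of pi z] z by (auto simp: e1_def e2_def \<theta>_def E_def)
    have b2: "norm f1 \<le> \<eta> * E" "norm f2 \<le> \<eta> * E" using R2[of pi z] z by (auto simp: f1_def f2_def \<theta>'_def E_def)
    have t: "norm (sin \<theta>) \<le> E" "norm (cos \<theta>) \<le> E" "norm (sin \<theta>') \<le> E" "norm (cos \<theta>') \<le> E"
      using norm_sin_le_exp[of \<theta>] norm_cos_le_exp[of \<theta>] norm_sin_le_exp[of \<theta>'] norm_cos_le_exp[of \<theta>']
      by (simp_all only: im E_def)
    have "z * (sol_S p q pi z * deriv_S p' q' pi z - sol_S p' q' pi z * deriv_S p q pi z)
       = (sin \<theta> + e1) * (cos \<theta>' + f2) - (sin \<theta>' + f1) * (cos \<theta> + e2)"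
      by (simp add: e1_def e2_def f1_def f2_def algebra_simps)
    also have "\<dots> = sin (\<theta> - \<theta>') + (e1 * cos \<theta>' + sin \<theta> * f2 + e1 * f2 - (f1 * cos \<theta> + sin \<theta>' * e2 + f1 * e2))"
      by (simp add: sin_diff algebra_simps)
    also have "norm \<dots> \<le> norm (sin (\<theta> - \<theta>')) + norm (e1 * cos \<theta>' + sin \<theta> * f2 + e1 * f2 - (f1 * cos \<theta> + sin \<theta>' * e2 + f1 * e2))"
      by (rule norm_triangle_ineq)
    also have "norm (e1 * cos \<theta>' + sin \<theta> * f2 + e1 * f2 - (f1 * cos \<theta> + sin \<theta>' * e2 + f1 * e2))
      \<le> (norm (e1 * cos \<theta>') + norm (sin \<theta> * f2) + norm (e1 * f2)) + (norm (f1 * cos \<theta>) + norm (sin \<theta>' * e2) + norm (f1 * e2))"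
      by (intro order_trans[OF norm_triangle_ineq4] add_mono order_trans[OF norm_triangle_ineq] order_refl)
    also have "\<dots> \<le> (\<eta> * E * E + E * (\<eta> * E) + \<eta> * E * (1 * E)) + (\<eta> * E * E + E * (\<eta> * E) + \<eta> * E * (1 * E))"
    proof -
      have c: "norm f2 \<le> 1 * E" "norm e2 \<le> 1 * E"
        using b1(2) b2(2) mult_right_mono[OF \<eta>(2), of E] E0 by linarith+
      show ?thesis unfolding norm_mult using b1 b2 t c E0 \<eta>(1) by (intro add_mono mult_mono) auto
    qed
    also have "\<dots> = 6 * \<eta> * (E * E)" by (simp add: algebra_simps)
    also have "\<dots> \<le> \<epsilon> * (E * E)" using \<eta>(3) E0 by (intro mult_right_mono) auto
    finally show "norm (z * (sol_S p q pi z * deriv_S p' q' pi z - sol_S p' q' pi z * deriv_S p q pi z))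
      \<le> norm (sin (integral {0..pi} p' - integral {0..pi} p)) + \<epsilon> * exp (2 * pi * \<bar>Im z\<bar>)"
      unfolding EE by (simp add: \<theta>_def \<theta>'_def)
  qed
qed

text \<open>At \<open>\<lambda> = i t\<close> one of the exponentials in the leading term decays, so after scaling by \<open>exp (- \<pi> t)\<close> all
  solutions have explicit nonzero limits.\<close>

lemma imaginary_axis_limits:
  assumes c: "edge_coeffs p q"
  defines "e \<equiv> exp (\<i> * integral {0..pi} p)"
  shows "((\<lambda>t. \<i> * of_real t * sol_S p q pi (\<i> * of_real t) * of_real (exp (- pi * t))) \<longlongrightarrow> \<i> / 2 * e) at_top"
    and "((\<lambda>t. deriv_S p q pi (\<i> * of_real t) * of_real (exp (- pi * t))) \<longlongrightarrow> e / 2) at_top"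
    and "((\<lambda>t. sol_C p q pi (\<i> * of_real t) * of_real (exp (- pi * t))) \<longlongrightarrow> e / 2) at_top"
proof -
  define P where "P = integral {0..pi} p"
  define th where "th t = \<i> * of_real t * pi - P" for t :: real
  have dec: "((\<lambda>t. complex_of_real (exp (- 2 * pi * t))) \<longlongrightarrow> 0) at_top"
    by (rule exp_decay_at_top) simp
  have e1: "exp (\<i> * th t) * of_real (exp (- pi * t)) = of_real (exp (- 2 * pi * t)) * exp (- \<i> * P)" for t
  proof -
    have "\<i> * th t + of_real (- pi * t) = of_real (- 2 * pi * t) + - \<i> * P" by (simp add: th_def algebra_simps)
    then have "exp (\<i> * th t + of_real (- pi * t)) = exp (of_real (- 2 * pi * t) + - \<i> * P)" by (simp only:)
    then show ?thesis by (simp only: exp_add exp_of_real)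
  qed
  have e2: "exp (- (\<i> * th t)) * of_real (exp (- pi * t)) = e" for t
  proof -
    have "- (\<i> * th t) + of_real (- pi * t) = \<i> * P" by (simp add: th_def algebra_simps)
    then have "exp (- (\<i> * th t) + of_real (- pi * t)) = exp (\<i> * P)" by (simp only:)
    then show ?thesis by (simp only: exp_add exp_of_real e_def P_def)
  qed
  have sinl: "((\<lambda>t. sin (th t) * of_real (exp (- pi * t))) \<longlongrightarrow> \<i> / 2 * e) at_top"
  proof -
    have "sin (th t) * of_real (exp (- pi * t)) = (of_real (exp (- 2 * pi * t)) * exp (- \<i> * P) - e) / (2 * \<i>)" for t
      unfolding e1[symmetric] e2[of t, symmetric] by (simp add: sin_exp_eq left_diff_distrib)
    moreover have "((\<lambda>t. (of_real (exp (- 2 * pi * t)) * exp (- \<i> * P) - e) / (2 * \<i>)) \<longlongrightarrow> (0 * exp (- \<i> * P) - e) / (2 * \<i>)) at_top"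
      by (intro tendsto_intros dec) auto
    moreover have "(0 * exp (- \<i> * P) - e) / (2 * \<i>) = \<i> / 2 * e" by (simp add: field_simps)
    ultimately show ?thesis by simp
  qed
  have cosl: "((\<lambda>t. cos (th t) * of_real (exp (- pi * t))) \<longlongrightarrow> e / 2) at_top"
  proof -
    have eq: "cos (th t) * of_real (exp (- pi * t)) = (of_real (exp (- 2 * pi * t)) * exp (- \<i> * P) + e) / 2" for t
      unfolding e1[symmetric] e2[of t, symmetric] by (simp add: cos_exp_eq distrib_right)
    have "((\<lambda>t. (of_real (exp (- 2 * pi * t)) * exp (- \<i> * P) + e) / 2) \<longlongrightarrow> (0 * exp (- \<i> * P) + e) / 2) at_top"
      by (intro tendsto_intros dec) auto
    then show ?thesis unfolding eq by simp
  qed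
  have small: "((\<lambda>t. (f t - g t) * of_real (exp (- pi * t))) \<longlongrightarrow> 0) at_top"
    if h: "\<And>\<epsilon>. \<epsilon> > 0 \<Longrightarrow> \<exists>R>0. \<forall>t\<ge>R. norm (f t - g t) \<le> \<epsilon> * exp (t * pi)" for f g :: "real \<Rightarrow> complex"
  proof (rule tendstoI)
    fix \<epsilon> :: real assume "\<epsilon> > 0"
    then obtain R where R: "R > 0" "\<And>t. t \<ge> R \<Longrightarrow> norm (f t - g t) \<le> \<epsilon> / 2 * exp (t * pi)" using h[of "\<epsilon> / 2"] by auto
    show "\<forall>\<^sub>F t in at_top. dist ((f t - g t) * of_real (exp (- pi * t))) 0 < \<epsilon>"
      using eventually_ge_at_top[of R]
    proof eventually_elim
      case (elim t)
      have "norm ((f t - g t) * of_real (exp (- pi * t))) = norm (f t - g t) * exp (- pi * t)" by (simp add: norm_mult)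
      also have "\<dots> \<le> \<epsilon> / 2 * exp (t * pi) * exp (- pi * t)" using R(2)[OF elim] by (intro mult_right_mono) auto
      also have "\<dots> = \<epsilon> / 2" by (simp add: mult.assoc exp_add[symmetric] mult.commute)
      also have "\<dots> < \<epsilon>" using \<open>\<epsilon> > 0\<close> by simp
      finally show ?case by simp
    qed
  qed
  have asy: "\<exists>R>0. \<forall>t\<ge>R. norm (\<i> * of_real t * sol_S p q pi (\<i> * of_real t) - sin (th t)) \<le> \<epsilon> * exp (t * pi) \<and>
      norm (deriv_S p q pi (\<i> * of_real t) - cos (th t)) \<le> \<epsilon> * exp (t * pi) \<and>
      norm (sol_C p q pi (\<i> * of_real t) - cos (th t)) \<le> \<epsilon> * exp (t * pi)" if "\<epsilon> > 0" for \<epsilon>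
  proof -
    from sol_asymptotics[OF c that] obtain R where R: "R > 0" "\<And>lam x. x\<in>{0..pi} \<Longrightarrow> R \<le> norm lam \<Longrightarrow>
     norm (lam * sol_S p q x lam - sin (lam * x - integral {0..x} p)) \<le> \<epsilon> * exp (\<bar>Im lam\<bar> * x) \<and>
     norm (deriv_S p q x lam - cos (lam * x - integral {0..x} p)) \<le> \<epsilon> * exp (\<bar>Im lam\<bar> * x) \<and>
     norm (sol_C p q x lam - cos (lam * x - integral {0..x} p)) \<le> \<epsilon> * exp (\<bar>Im lam\<bar> * x)" by blast
    show ?thesis
    proof (intro exI[of _ R] conjI allI impI, fact R(1))
      fix t assume t: "R \<le> t"
      have "R \<le> norm (\<i> * complex_of_real t)" "\<bar>Im (\<i> * complex_of_real t)\<bar> = t" using t R(1) by (simp_all add: norm_mult)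
      from R(2)[OF _ this(1), of pi] this(2)
      show "norm (\<i> * of_real t * sol_S p q pi (\<i> * of_real t) - sin (th t)) \<le> \<epsilon> * exp (t * pi)"
        "norm (deriv_S p q pi (\<i> * of_real t) - cos (th t)) \<le> \<epsilon> * exp (t * pi)"
        "norm (sol_C p q pi (\<i> * of_real t) - cos (th t)) \<le> \<epsilon> * exp (t * pi)"
        by (simp_all add: th_def P_def)
    qed
  qed
  have "((\<lambda>t. (\<i> * of_real t * sol_S p q pi (\<i> * of_real t) - sin (th t)) * of_real (exp (- pi * t))) \<longlongrightarrow> 0) at_top"
    by (rule small) (use asy in blast)
  from tendsto_add[OF this sinl]
  show "((\<lambda>t. \<i> * of_real t * sol_S p q pi (\<i> * of_real t) * of_real (exp (- pi * t))) \<longlongrightarrow> \<i> / 2 * e) at_top"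
    by (simp add: left_diff_distrib)
  have "((\<lambda>t. (deriv_S p q pi (\<i> * of_real t) - cos (th t)) * of_real (exp (- pi * t))) \<longlongrightarrow> 0) at_top"
    by (rule small) (use asy in blast)
  from tendsto_add[OF this cosl]
  show "((\<lambda>t. deriv_S p q pi (\<i> * of_real t) * of_real (exp (- pi * t))) \<longlongrightarrow> e / 2) at_top"
    by (simp add: left_diff_distrib)
  have "((\<lambda>t. (sol_C p q pi (\<i> * of_real t) - cos (th t)) * of_real (exp (- pi * t))) \<longlongrightarrow> 0) at_top"
    by (rule small) (use asy in blast)
  from tendsto_add[OF this cosl]
  show "((\<lambda>t. sol_C p q pi (\<i> * of_real t) * of_real (exp (- pi * t))) \<longlongrightarrow> e / 2) at_top"
    by (simp add: left_diff_distrib)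
qed

lemma char_fun_holomorphic:
  assumes "coefficients m p q" "m \<ge> 1"
  shows "char_fun m p q holomorphic_on UNIV"
  unfolding char_fun_def[abs_def]
  by (intro holomorphic_intros sol_holomorphic d_loop_holomorphic coefficients_edge_coeffs[OF assms(1)]) (use assms(2) in auto)

text \<open>Scaled along the imaginary axis, each of the \<open>m - 1\<close> terms of the sum tends to the same nonzero number
  and the loop term to twice that number, since \<open>d\<^sub>m\<close> has two dominant summands; there is no cancellation.
  Nonvanishing matters because \<open>zorder\<close> carries information only for functions that are not
  identically zero.\<close>

lemma char_fun_not_identically_zero:
  assumes c: "coefficients m p q" and m: "m \<ge> 1"
  shows "\<exists>z. char_fun m p q z \<noteq> 0"
proof (rule ccontr)
  assume "\<not> ?thesis"
  then have z: "char_fun m p q z = 0" for z by blast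
  define E where "E t = complex_of_real (exp (- pi * t))" for t
  define e where "e j = exp (\<i> * integral {0..pi} (p j))" for j
  define s where "s k t = \<i> * of_real t * sol_S (p k) (q k) pi (\<i> * of_real t) * E t" for k t
  define d where "d k t = deriv_S (p k) (q k) pi (\<i> * of_real t) * E t" for k t
  define l where "l t = d_loop (p m) (q m) (\<i> * of_real t) * E t" for t
  have cj: "edge_coeffs (p j) (q j)" if "j \<in> {1..m}" for j by (rule coefficients_edge_coeffs[OF c that])
  have sl: "(s k \<longlongrightarrow> \<i> / 2 * e k) at_top" if "k \<in> {1..m}" for k
    unfolding s_def e_def E_def using imaginary_axis_limits(1)[OF cj[OF that]] .
  have dl: "(d k \<longlongrightarrow> e k / 2) at_top" if "k \<in> {1..m}" for k
    unfolding d_def e_def E_def using imaginary_axis_limits(2)[OF cj[OF that]] .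
  have ll: "(l \<longlongrightarrow> e m) at_top"
  proof -
    have mm: "m \<in> {1..m}" using m by simp
    have E0: "(E \<longlongrightarrow> 0) at_top" unfolding E_def by (rule exp_decay_at_top) simp
    have "((\<lambda>t. d m t + sol_C (p m) (q m) pi (\<i> * of_real t) * E t - 2 * E t) \<longlongrightarrow> e m / 2 + e m / 2 - 2 * 0) at_top"
      using imaginary_axis_limits(3)[OF cj[OF mm]] unfolding E_def[symmetric] e_def[symmetric]
      by (intro tendsto_intros dl[OF mm] E0)
    moreover have "l = (\<lambda>t. d m t + sol_C (p m) (q m) pi (\<i> * of_real t) * E t - 2 * E t)"
      by (simp add: fun_eq_iff l_def d_def d_loop_def algebra_simps)
    ultimately show ?thesis by simp
  qed
  have eq: "(\<Sum>j=1..m-1. d j t * (\<Prod>k\<in>{1..m} - {j}. s k t)) + l t * (\<Prod>k=1..m-1. s k t) = 0" for t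
  proof -
    \<comment> \<open>every term of the characteristic function has \<open>m - 1\<close> factors \<open>S\<close>, each scaled by \<open>i t\<close>, and one further factor\<close>
    define u where "u = (\<i> * complex_of_real t) ^ (m-1) * E t ^ m"
    have mS: "Suc (m - 1) = m" using m by simp
    have split: "(\<Prod>k\<in>A. s k t) = (\<i> * of_real t) ^ card A * E t ^ card A * (\<Prod>k\<in>A. sol_S (p k) (q k) pi (\<i> * of_real t))"
      if "finite A" for A
      unfolding s_def prod.distrib by (simp add: power_mult_distrib)
    have Em: "E t ^ m = E t * E t ^ (m - 1)" using mS by (metis power_Suc)
    have "d j t * (\<Prod>k\<in>{1..m} - {j}. s k t) = u * (deriv_S (p j) (q j) pi (\<i> * of_real t) * (\<Prod>k\<in>{1..m} - {j}. sol_S (p k) (q k) pi (\<i> * of_real t)))"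
      if j: "j \<in> {1..m-1}" for j
    proof -
      have "card ({1..m} - {j}) = m - 1" using j by auto
      then show ?thesis using split[of "{1..m} - {j}"] by (simp add: d_def u_def Em)
    qed
    moreover have "l t * (\<Prod>k=1..m-1. s k t) = u * (d_loop (p m) (q m) (\<i> * of_real t) * (\<Prod>k=1..m-1. sol_S (p k) (q k) pi (\<i> * of_real t)))"
      using split[of "{1..m-1}"] by (simp add: l_def u_def Em)
    ultimately have "(\<Sum>j=1..m-1. d j t * (\<Prod>k\<in>{1..m} - {j}. s k t)) + l t * (\<Prod>k=1..m-1. s k t) = u * char_fun m p q (\<i> * of_real t)"
      unfolding char_fun_def distrib_left sum_distrib_left by (intro arg_cong2[where f="(+)"] sum.cong) auto
    then show ?thesis by (simp add: z)
  qed
  have "((\<lambda>t. (\<Sum>j=1..m-1. d j t * (\<Prod>k\<in>{1..m} - {j}. s k t)) + l t * (\<Prod>k=1..m-1. s k t))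
     \<longlongrightarrow> (\<Sum>j=1..m-1. e j / 2 * (\<Prod>k\<in>{1..m} - {j}. \<i> / 2 * e k)) + e m * (\<Prod>k=1..m-1. \<i> / 2 * e k)) at_top"
    by (intro tendsto_add tendsto_sum tendsto_mult tendsto_prod sl dl ll) (use m in auto)
  then have lim: "(\<Sum>j=1..m-1. e j / 2 * (\<Prod>k\<in>{1..m} - {j}. \<i> / 2 * e k)) + e m * (\<Prod>k=1..m-1. \<i> / 2 * e k) = 0"
    unfolding eq by (simp add: tendsto_const_iff)
  define PP where "PP = (\<Prod>k\<in>{1..m}. e k)"
  define I where "I = (\<i> / 2) ^ (m - 1)"
  have 1: "e j / 2 * (\<Prod>k\<in>{1..m} - {j}. \<i> / 2 * e k) = I * PP / 2" if j: "j \<in> {1..m-1}" for j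
  proof -
    have "card ({1..m} - {j}) = m - 1" using j by auto
    then have "(\<Prod>k\<in>{1..m} - {j}. \<i> / 2 * e k) = I * (\<Prod>k\<in>{1..m} - {j}. e k)"
      by (simp only: prod.distrib prod_constant I_def)
    moreover have "PP = e j * (\<Prod>k\<in>{1..m} - {j}. e k)" unfolding PP_def by (rule prod.remove) (use j in auto)
    ultimately show ?thesis by (simp only: mult_ac times_divide_eq_left times_divide_eq_right)
  qed
  have 2: "e m * (\<Prod>k=1..m-1. \<i> / 2 * e k) = I * PP"
  proof -
    have "{1..m} = insert m {1..m-1}" using m by auto
    then have "PP = e m * (\<Prod>k\<in>{1..m-1}. e k)" unfolding PP_def by (subst prod.insert[symmetric]) (use m in auto)
    moreover have "(\<Prod>k=1..m-1. \<i> / 2 * e k) = I * (\<Prod>k\<in>{1..m-1}. e k)"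
      by (simp only: prod.distrib prod_constant I_def card_atLeastAtMost) simp
    ultimately show ?thesis by (simp only: mult_ac)
  qed
  have "(\<Sum>j=1..m-1. e j / 2 * (\<Prod>k\<in>{1..m} - {j}. \<i> / 2 * e k)) = (\<Sum>j=1..m-1. I * PP / 2)"
    by (rule sum.cong) (use 1 in auto)
  also have "\<dots> = of_nat (m - 1) * (I * PP / 2)" by simp
  finally have A: "(\<Sum>j=1..m-1. e j / 2 * (\<Prod>k\<in>{1..m} - {j}. \<i> / 2 * e k)) = of_nat (m - 1) * (I * PP / 2)" .
  have "of_nat (m - 1) * (I * PP / 2) + I * PP = 0" using lim unfolding A 2 .
  then have "I * PP * (of_nat (m - 1 + 2)) = 0" by (simp add: field_simps)
  moreover have "of_nat (m - 1 + 2) \<noteq> (0::complex)" by (subst of_nat_eq_0_iff) simp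
  moreover have "PP \<noteq> 0" by (simp add: PP_def e_def)
  moreover have "I \<noteq> 0" by (simp add: I_def)
  ultimately show False by simp
qed

text \<open>Translates multiplicities into growth bounds, which are stable under linear combinations and make sense for \<open>D\<close> even
  though it is identically zero in the end.\<close>

lemma zorder_bound:
  fixes n :: nat
  assumes f: "f holomorphic_on UNIV" and nz: "\<exists>w. f w \<noteq> 0" and n: "int n \<le> zorder f v"
  shows "\<exists>C. \<forall>\<^sub>F z in at v. norm (f z) \<le> C * norm (z - v) ^ n"
proof -
  have nz': "\<exists>w\<in>UNIV. f w \<noteq> 0" using nz by simp
  from zorder_exist_zero[OF f open_UNIV connected_UNIV UNIV_I nz', where z = v, THEN conjunct2]
  obtain r where r0: "r > 0" "zor_poly f v holomorphic_on cball v r"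
    and fw: "\<forall>w\<in>cball v r. f w = zor_poly f v w * (w - v) ^ nat (zorder f v) \<and> zor_poly f v w \<noteq> 0"
    by (elim exE conjE)
  note r = r0 bspec[OF fw, THEN conjunct1]
  have "compact (zor_poly f v ` cball v r)"
    by (intro compact_continuous_image holomorphic_on_imp_continuous_on r compact_cball)
  then have "bounded (zor_poly f v ` cball v r)" by (rule compact_imp_bounded)
  then obtain B where "\<forall>x\<in>zor_poly f v ` cball v r. norm x \<le> B" unfolding bounded_iff by (elim exE)
  then have B: "\<And>w. w \<in> cball v r \<Longrightarrow> norm (zor_poly f v w) \<le> B" by simp
  have B0: "B \<ge> 0" using B[of v] r(1) order_trans[OF norm_ge_zero] by force
  have "\<forall>\<^sub>F z in at v. z \<in> ball v (min r 1)" using r(1) by (intro eventually_at_in_open') auto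
  then have "\<forall>\<^sub>F z in at v. norm (f z) \<le> B * norm (z - v) ^ n"
  proof eventually_elim
    case (elim z)
    then have z: "z \<in> cball v r" "norm (z - v) \<le> 1" by (auto simp: dist_norm norm_minus_commute)
    have "norm (f z) = norm (zor_poly f v z) * norm (z - v) ^ nat (zorder f v)" by (simp add: r(3)[OF z(1)] norm_mult norm_power)
    also have "\<dots> \<le> B * norm (z - v) ^ n"
      using n B0 B[OF z(1)] z(2) by (intro mult_mono power_decreasing) auto
    finally show ?case .
  qed
  then show ?thesis by blast
qed

lemma order_bound_cancel:
  assumes A: "A holomorphic_on UNIV" "A v \<noteq> 0" and ev: "\<forall>\<^sub>F z in at v. norm (D z * A z) \<le> C * norm (z - v) ^ n"
  shows "\<exists>C. \<forall>\<^sub>F z in at v. norm (D z) \<le> C * norm (z - v) ^ (n::nat)"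
proof -
  have "isCont A v" using holomorphic_on_imp_continuous_on[OF A(1)] by (simp add: continuous_on_eq_continuous_at)
  then have "((\<lambda>z. norm (A z)) \<longlongrightarrow> norm (A v)) (at v)" by (intro tendsto_norm) (simp add: isCont_def)
  then have "\<forall>\<^sub>F z in at v. norm (A v) / 2 < norm (A z)" using A(2) by (intro order_tendstoD) auto
  with ev have "\<forall>\<^sub>F z in at v. norm (D z) \<le> (2 * C / norm (A v)) * norm (z - v) ^ n"
  proof eventually_elim
    case (elim z)
    have "norm (D z) * (norm (A v) / 2) \<le> norm (D z) * norm (A z)" using elim(2) by (intro mult_left_mono) auto
    also have "\<dots> \<le> C * norm (z - v) ^ n" using elim(1) by (simp add: norm_mult)
    finally show ?case using A(2) by (simp add: field_simps)
  qed
  then show ?thesis by blast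
qed

section \<open>The Weyl function of an edge determines its coefficients\<close>

lemma abs_cont_on_reflect:
  assumes "abs_cont_on 0 pi f"
  shows "abs_cont_on 0 pi (\<lambda>x. f (pi - x))"
  unfolding abs_cont_on_def
proof (intro allI impI)
  fix \<epsilon> :: real assume e: "\<epsilon> > 0"
  obtain \<delta> where \<delta>: "\<delta> > 0" and f': "\<forall>(n::nat) u v.
        (\<forall>i<n. 0 \<le> u i \<and> u i \<le> v i \<and> v i \<le> pi) \<and>
        (\<forall>i<n. \<forall>j<n. i \<noteq> j \<longrightarrow> {u i<..<v i} \<inter> {u j<..<v j} = {}) \<and>
        (\<Sum>i<n. v i - u i) < \<delta>
        \<longrightarrow> (\<Sum>i<n. norm (f (v i) - f (u i))) < \<epsilon>"
    using assms[unfolded abs_cont_on_def, rule_format, OF e] by (elim exE conjE)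
  show "\<exists>\<delta>>0. \<forall>(n::nat) u v.
        (\<forall>i<n. 0 \<le> u i \<and> u i \<le> v i \<and> v i \<le> pi) \<and>
        (\<forall>i<n. \<forall>j<n. i \<noteq> j \<longrightarrow> {u i<..<v i} \<inter> {u j<..<v j} = {}) \<and>
        (\<Sum>i<n. v i - u i) < \<delta>
        \<longrightarrow> (\<Sum>i<n. norm (f (pi - v i) - f (pi - u i))) < \<epsilon>"
  proof (intro exI[of _ \<delta>] conjI allI impI, fact \<delta>)
    fix n :: nat and u v
    assume A: "(\<forall>i<n. 0 \<le> u i \<and> u i \<le> v i \<and> v i \<le> pi) \<and>
        (\<forall>i<n. \<forall>j<n. i \<noteq> j \<longrightarrow> {u i<..<v i} \<inter> {u j<..<v j} = {}) \<and>
        (\<Sum>i<n. v i - u i) < \<delta>"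
    have "(\<Sum>i<n. norm (f (pi - u i) - f (pi - v i))) < \<epsilon>"
    proof (rule f'[rule_format, of n "\<lambda>i. pi - v i" "\<lambda>i. pi - u i"], intro conjI allI impI)
      fix i j assume ij: "i < n" "j < n" "i \<noteq> j"
      then have d: "{u i<..<v i} \<inter> {u j<..<v j} = {}" using A by blast
      show "{pi - v i<..<pi - u i} \<inter> {pi - v j<..<pi - u j} = {}"
      proof (rule ccontr)
        assume "\<not> ?thesis"
        then obtain x where "x \<in> {pi - v i<..<pi - u i} \<inter> {pi - v j<..<pi - u j}" by blast
        then have "pi - x \<in> {u i<..<v i} \<inter> {u j<..<v j}" by auto
        then show False using d by blast
      qed
    qed (use A in \<open>auto simp: algebra_simps\<close>)
    then show "(\<Sum>i<n. norm (f (pi - v i) - f (pi - u i))) < \<epsilon>" by (simp add: norm_minus_commute)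
  qed
qed

lemma ac_deriv_reflect:
  assumes "ac_deriv 0 pi f f'"
  shows "ac_deriv 0 pi (\<lambda>x. f (pi - x)) (\<lambda>x. - f' (pi - x))"
proof -
  from ac_derivE[OF assms(1)] obtain N where N: "abs_cont_on 0 pi f" "negligible N"
    "\<And>x. x \<in> {0<..<pi} - N \<Longrightarrow> (f has_vector_derivative f' x) (at x)" by blast
  show ?thesis unfolding ac_deriv_def
  proof (intro conjI exI[of _ "(\<lambda>x. pi - x) ` N"] ballI)
    show "abs_cont_on 0 pi (\<lambda>x. f (pi - x))" by (rule abs_cont_on_reflect[OF N(1)])
    have "(\<lambda>x. pi - x) differentiable_on N" by (intro derivative_intros)
    then show "negligible ((\<lambda>x. pi - x) ` N)"
      by (rule negligible_differentiable_image_negligible[OF order_refl N(2)])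
    fix x assume x: "x \<in> {0<..<pi} - (\<lambda>x. pi - x) ` N"
    then have "pi - x \<in> {0<..<pi} - N" by (auto simp: image_iff)
    from N(3)[OF this] have d: "(f has_vector_derivative f' (pi - x)) (at (pi - x))" .
    have "((\<lambda>x. pi - x) has_vector_derivative - 1) (at x)"
      by (auto intro!: derivative_eq_intros)
    from vector_diff_chain_at[OF this d]
    show "((\<lambda>x. f (pi - x)) has_vector_derivative - f' (pi - x)) (at x)" by (simp add: o_def)
  qed
qed

lemma edge_solution_reflect:
  assumes "edge_solution p q lam y dy"
  shows "edge_solution (\<lambda>x. p (pi - x)) (\<lambda>x. q (pi - x)) lam (\<lambda>x. y (pi - x)) (\<lambda>x. - dy (pi - x))"
proof -
  have ac: "ac_deriv 0 pi y dy" "ac_deriv 0 pi dy (\<lambda>x. pot p q lam x * y x)"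
    using assms by (simp_all add: edge_solution_iff_ac_deriv)
  have "ac_deriv 0 pi (\<lambda>x. - 1 * dy (pi - x)) (\<lambda>x. - 1 * - (pot p q lam (pi - x) * y (pi - x)))"
    by (rule ac_deriv_cmult[OF ac_deriv_reflect[OF ac(2)]])
  then show ?thesis
    using ac_deriv_reflect[OF ac(1)] by (simp add: edge_solution_iff_ac_deriv pot_def)
qed

lemma edge_solution_lincomb:
  assumes "edge_solution p q lam y dy" "edge_solution p q lam z dz"
  shows "edge_solution p q lam (\<lambda>x. a * y x + b * z x) (\<lambda>x. a * dy x + b * dz x)"
proof -
  have ac: "ac_deriv 0 pi y dy" "ac_deriv 0 pi dy (\<lambda>x. pot p q lam x * y x)"
    "ac_deriv 0 pi z dz" "ac_deriv 0 pi dz (\<lambda>x. pot p q lam x * z x)"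
    using assms by (simp_all add: edge_solution_iff_ac_deriv)
  have "ac_deriv 0 pi (\<lambda>x. a * dy x + b * dz x) (\<lambda>x. a * (pot p q lam x * y x) + b * (pot p q lam x * z x))"
    by (intro ac_deriv_add ac_deriv_cmult ac)
  then have "ac_deriv 0 pi (\<lambda>x. a * dy x + b * dz x) (\<lambda>x. pot p q lam x * (a * y x + b * z x))"
    by (rule ac_deriv_cong) (auto simp: algebra_simps)
  moreover have "ac_deriv 0 pi (\<lambda>x. a * y x + b * z x) (\<lambda>x. a * dy x + b * dz x)"
    by (intro ac_deriv_add ac_deriv_cmult ac)
  ultimately show ?thesis by (simp add: edge_solution_iff_ac_deriv)
qed

lemma integrable_reflect_pi:
  fixes f :: "real \<Rightarrow> 'a::banach"
  assumes "f integrable_on {0..pi}"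
  shows "(\<lambda>x. f (pi - x)) integrable_on {0..pi}"
proof -
  have "(f has_integral integral {0..pi} f) (cbox 0 pi)" using assms by (simp add: integrable_integral)
  from has_integral_affinity[OF this, of "-1" pi]
  have "((\<lambda>x. f (pi - x)) has_integral integral {0..pi} f) ((\<lambda>x. pi - x) ` {0..pi})" by simp
  moreover have "(\<lambda>x. pi - x) ` {0..pi} = {0..pi}" by simp
  ultimately show ?thesis by (auto intro: has_integral_integrable)
qed

lemma edge_coeffs_reflect:
  assumes "edge_coeffs p q"
  shows "edge_coeffs (\<lambda>x. p (pi - x)) (\<lambda>x. q (pi - x))"
proof -
  have p: "continuous_on {0..pi} p" and q: "q integrable_on {0..pi}" "(\<lambda>x. norm (q x)) integrable_on {0..pi}"
    using assms by (auto simp: edge_coeffs_def absolutely_integrable_on_def)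
  have "continuous_on {0..pi} (\<lambda>x. p (pi - x))"
    by (rule continuous_on_compose2[OF p]) (auto intro!: continuous_intros)
  then show ?thesis
    using integrable_reflect_pi[OF q(1)] integrable_reflect_pi[OF q(2)]
    by (simp add: edge_coeffs_def absolutely_integrable_on_def)
qed

lemma edge_solution_derivative_within:
  assumes "edge_solution p q lam y dy" "x \<in> {0..pi}"
  shows "(y has_vector_derivative dy x) (at x within {0..pi})"
  using assms(1)[unfolded edge_solution_def, THEN conjunct2, THEN conjunct2, THEN conjunct1] assms(2) by blast

lemma edge_solution_derivative_at:
  assumes "edge_solution p q lam y dy" "x \<in> {0<..<pi}"
  shows "(y has_vector_derivative dy x) (at x)"
proof -
  have "(y has_vector_derivative dy x) (at x within {0..pi})"
    by (rule edge_solution_derivative_within[OF assms(1)]) (use assms(2) in auto)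
  then show ?thesis using assms(2) by (simp add: at_within_Icc_at)
qed

text \<open>The zero set is closed, so an accumulation point would be a zero, and there the derivative would have to vanish.\<close>

lemma finite_simple_zeros:
  fixes s ds :: "real \<Rightarrow> complex"
  assumes d: "\<And>x. x \<in> {a..b} \<Longrightarrow> (s has_vector_derivative ds x) (at x within {a..b})"
    and simple: "\<And>x. x \<in> {a..b} \<Longrightarrow> s x = 0 \<Longrightarrow> ds x \<noteq> 0"
  shows "finite {x\<in>{a..b}. s x = 0}"
proof (rule ccontr)
  assume inf: "infinite {x\<in>{a..b}. s x = 0}"
  define Z where "Z = {x\<in>{a..b}. s x = 0}"
  have "infinite Z" "Z \<subseteq> {a..b}" using inf by (auto simp: Z_def)
  then obtain x where x: "x \<in> {a..b}" "x islimpt Z"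
    using Heine_Borel_imp_Bolzano_Weierstrass[OF compact_Icc] by blast
  have cont: "continuous_on {a..b} s"
    by (rule continuous_on_vector_derivative) (use d in auto)
  have "closed Z" unfolding Z_def using continuous_closed_preimage_constant[OF cont closed_atLeastAtMost] by simp
  then have "x \<in> Z" using x(2) closed_limpt by blast
  then have sx: "s x = 0" and dx: "ds x \<noteq> 0" using simple x(1) by (auto simp: Z_def)
  have "norm (ds x) / 2 > 0" using dx by simp
  with d[OF x(1)] obtain e where e: "e > 0" "\<And>y. y \<in> {a..b} \<Longrightarrow> norm (y - x) < e \<Longrightarrow>
      norm (s y - s x - (y - x) *\<^sub>R ds x) \<le> norm (ds x) / 2 * norm (y - x)"
    unfolding has_vector_derivative_def has_derivative_within_alt by blast
  obtain y where y: "y \<in> Z" "y \<noteq> x" "dist y x < e" using x(2) e(1) unfolding islimpt_approachable by blast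
  have "norm (s y - s x - (y - x) *\<^sub>R ds x) \<le> norm (ds x) / 2 * norm (y - x)"
    by (rule e(2)) (use y in \<open>auto simp: Z_def dist_real_def\<close>)
  then have "\<bar>y - x\<bar> * norm (ds x) \<le> norm (ds x) / 2 * \<bar>y - x\<bar>" using y(1) sx by (simp add: Z_def)
  moreover have "\<bar>y - x\<bar> * norm (ds x) > 0" using y(2) dx by simp
  ultimately show False by (simp add: mult.commute)
qed

text \<open>Differentiating \<open>s c\<^sub>2 = s\<^sub>2 c\<close> and inserting the two Wronskian identities gives \<open>s\<^sup>2 = s\<^sub>2\<^sup>2\<close>. Differentiating
  twice more recovers the coefficient \<open>s'' / s\<close> away from the zeros of \<open>s\<close>, which are finite in number since
  \<open>s\<close> and \<open>s'\<close> do not vanish together.\<close>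

lemma potentials_equal_ae:
  assumes s: "edge_solution p q lam s ds" and c: "edge_solution p q lam c dc"
    and s2: "edge_solution p2 q2 lam s2 ds2" and c2: "edge_solution p2 q2 lam c2 dc2"
    and W: "\<And>x. x \<in> {0..pi} \<Longrightarrow> c x * ds x - dc x * s x = 1"
    and W2: "\<And>x. x \<in> {0..pi} \<Longrightarrow> c2 x * ds2 x - dc2 x * s2 x = 1"
    and cross: "\<And>x. x \<in> {0..pi} \<Longrightarrow> s x * c2 x = s2 x * c x"
  shows "\<exists>N. negligible N \<and> (\<forall>x\<in>{0<..<pi} - N. pot p q lam x = pot p2 q2 lam x)"
proof -
  have op: "open {0<..<pi}" by simp
  note d = edge_solution_derivative_at
  have sq: "s x * s x = s2 x * s2 x" if x: "x \<in> {0<..<pi}" for x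
  proof -
    have x': "x \<in> {0..pi}" using x by auto
    have "((\<lambda>x. s x * c2 x) has_vector_derivative s x * dc2 x + ds x * c2 x) (at x)"
      by (intro has_vector_derivative_mult d[OF s x] d[OF c2 x])
    moreover have "((\<lambda>x. s x * c2 x) has_vector_derivative s2 x * dc x + ds2 x * c x) (at x)"
      by (rule has_vector_derivative_transform_within_open[OF has_vector_derivative_mult[OF d[OF s2 x] d[OF c x]] op x])
        (use cross in auto)
    ultimately have e: "s x * dc2 x + ds x * c2 x = s2 x * dc x + ds2 x * c x" by (rule vector_derivative_unique_at)
    have "s x * s x - s2 x * s2 x = s x * s x * (c2 x * ds2 x - dc2 x * s2 x) - s2 x * s2 x * (c x * ds x - dc x * s x)"
      using W[OF x'] W2[OF x'] by simp
    also have "\<dots> = s x * ds2 x * (s x * c2 x) - s2 x * ds x * (s2 x * c x) - s x * s2 x * (s x * dc2 x) + s x * s2 x * (s2 x * dc x)"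
      by (simp add: algebra_simps)
    also have "\<dots> = s x * ds2 x * (s2 x * c x) - s2 x * ds x * (s x * c2 x) - s x * s2 x * (s x * dc2 x) + s x * s2 x * (s2 x * dc x)"
      by (simp only: cross[OF x'])
    also have "\<dots> = s x * s2 x * ((s2 x * dc x + ds2 x * c x) - (s x * dc2 x + ds x * c2 x))" by (simp add: algebra_simps)
    also have "\<dots> = 0" using e by simp
    finally show ?thesis by simp
  qed
  have sd: "s x * ds x = s2 x * ds2 x" if x: "x \<in> {0<..<pi}" for x
  proof -
    have "((\<lambda>x. s x * s x) has_vector_derivative s x * ds x + ds x * s x) (at x)"
      by (intro has_vector_derivative_mult d[OF s x])
    moreover have "((\<lambda>x. s x * s x) has_vector_derivative s2 x * ds2 x + ds2 x * s2 x) (at x)"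
      by (rule has_vector_derivative_transform_within_open[OF has_vector_derivative_mult[OF d[OF s2 x] d[OF s2 x]] op x])
        (use sq in auto)
    ultimately have "s x * ds x + ds x * s x = s2 x * ds2 x + ds2 x * s2 x" by (rule vector_derivative_unique_at)
    then have "2 * (s x * ds x) = 2 * (s2 x * ds2 x)" by (simp add: mult.commute)
    then show ?thesis by simp
  qed
  have "ac_deriv 0 pi ds (\<lambda>x. pot p q lam x * s x)" using s by (simp add: edge_solution_iff_ac_deriv)
  then obtain N1 where "abs_cont_on 0 pi ds" and N1: "negligible N1"
    "\<And>x. x \<in> {0<..<pi} - N1 \<Longrightarrow> (ds has_vector_derivative pot p q lam x * s x) (at x)"
    by (rule ac_derivE) (rule that; simp)
  have "ac_deriv 0 pi ds2 (\<lambda>x. pot p2 q2 lam x * s2 x)" using s2 by (simp add: edge_solution_iff_ac_deriv)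
  then obtain N2 where "abs_cont_on 0 pi ds2" and N2: "negligible N2"
    "\<And>x. x \<in> {0<..<pi} - N2 \<Longrightarrow> (ds2 has_vector_derivative pot p2 q2 lam x * s2 x) (at x)"
    by (rule ac_derivE) (rule that; simp)
  define Z where "Z = {x\<in>{0..pi}. s x = 0}"
  have "finite Z" unfolding Z_def
  proof (rule finite_simple_zeros)
    show "(s has_vector_derivative ds x) (at x within {0..pi})" if "x \<in> {0..pi}" for x
      by (rule edge_solution_derivative_within[OF s that])
    show "ds x \<noteq> 0" if "x \<in> {0..pi}" "s x = 0" for x
    proof
      assume "ds x = 0"
      then show False using W[OF that(1)] that(2) by simp
    qed
  qed
  show ?thesis
  proof (intro exI[of _ "N1 \<union> N2 \<union> Z"] conjI ballI)
    show "negligible (N1 \<union> N2 \<union> Z)" using N1(1) N2(1) \<open>finite Z\<close> by (simp add: negligible_Un negligible_finite)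
    fix x assume x: "x \<in> {0<..<pi} - (N1 \<union> N2 \<union> Z)"
    then have x1: "x \<in> {0<..<pi}" "x \<in> {0<..<pi} - N1" "x \<in> {0<..<pi} - N2" and sx: "s x \<noteq> 0" by (auto simp: Z_def)
    have "((\<lambda>x. s x * ds x) has_vector_derivative s x * (pot p q lam x * s x) + ds x * ds x) (at x)"
      by (intro has_vector_derivative_mult d[OF s x1(1)] N1(2)[OF x1(2)])
    moreover have "((\<lambda>x. s x * ds x) has_vector_derivative s2 x * (pot p2 q2 lam x * s2 x) + ds2 x * ds2 x) (at x)"
      by (rule has_vector_derivative_transform_within_open[OF has_vector_derivative_mult[OF d[OF s2 x1(1)] N2(2)[OF x1(3)]] op x1(1)])
        (use sd in auto)
    ultimately have e: "s x * (pot p q lam x * s x) + ds x * ds x = s2 x * (pot p2 q2 lam x * s2 x) + ds2 x * ds2 x"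
      by (rule vector_derivative_unique_at)
    have q: "s x * s x = s2 x * s2 x" by (rule sq[OF x1(1)])
    have "(s x * s x) * (ds x * ds x) = (s x * ds x) * (s x * ds x)" by (simp add: mult_ac)
    also have "\<dots> = (s2 x * s2 x) * (ds2 x * ds2 x)" unfolding sd[OF x1(1)] by (simp add: mult_ac)
    finally have "(s x * s x) * (ds x * ds x) = (s x * s x) * (ds2 x * ds2 x)" unfolding q[symmetric] .
    then have "ds x * ds x = ds2 x * ds2 x" using sx by simp
    then have "pot p q lam x * (s x * s x) = pot p2 q2 lam x * (s2 x * s2 x)" using e by (simp add: mult_ac)
    then show "pot p q lam x = pot p2 q2 lam x" using sx unfolding q[symmetric] by simp
  qed
qed

lemma continuous_eq_of_ae_eq:
  fixes f g :: "real \<Rightarrow> complex"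
  assumes f: "continuous_on {0..pi} f" and g: "continuous_on {0..pi} g" and N: "negligible N"
    and eq: "\<And>x. x \<in> {0<..<pi} - N \<Longrightarrow> f x = g x" and x: "x \<in> {0..pi}"
  shows "f x = g x"
proof -
  define T where "T = {0<..<pi} - N"
  have "{0<..<pi} \<subseteq> closure T"
  proof
    fix y assume y: "y \<in> {0<..<pi}"
    show "y \<in> closure T" unfolding closure_approachable
    proof (intro allI impI)
      fix e :: real assume "e > 0"
      then have "open (ball y e \<inter> {0<..<pi})" "y \<in> ball y e \<inter> {0<..<pi}" using y by auto
      then have "\<not> negligible (ball y e \<inter> {0<..<pi})" using open_not_negligible by blast
      then have "\<not> ball y e \<inter> {0<..<pi} \<subseteq> N" using N negligible_subset by blast
      then obtain z where "z \<in> ball y e" "z \<in> {0<..<pi}" "z \<notin> N" by blast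
      then show "\<exists>z\<in>T. dist z y < e" by (intro bexI[of _ z]) (auto simp: T_def dist_commute)
    qed
  qed
  then have "closure {0<..<pi} \<subseteq> closure T" by (rule closure_minimal) simp
  then have cl: "{0..pi} \<subseteq> closure T" by simp
  moreover have "closure T \<subseteq> {0..pi}" by (rule closure_minimal) (auto simp: T_def)
  ultimately have clT: "closure T = {0..pi}" by blast
  have "f x - g x = 0"
    by (rule continuous_constant_on_closure[of T "\<lambda>x. f x - g x"])
      (use clT eq x in \<open>auto intro!: continuous_intros f g simp: T_def\<close>)
  then show ?thesis by simp
qed

text \<open>The reflection \<open>x \<mapsto> \<pi> - x\<close> preserves the form of the equation. It turns solutions normalised at
  \<open>\<pi>\<close> into ones normalised at \<open>0\<close>, so that the latter suffice throughout.\<close>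

lemma sol_S_backward:
  assumes c: "edge_coeffs p q" and t: "t \<in> {0..pi}"
  shows "sol_S p q (pi - t) lam =
    sol_S p q pi lam * sol_C (\<lambda>x. p (pi - x)) (\<lambda>x. q (pi - x)) t lam
    - deriv_S p q pi lam * sol_S (\<lambda>x. p (pi - x)) (\<lambda>x. q (pi - x)) t lam"
proof -
  let ?p = "\<lambda>x. p (pi - x)" and ?q = "\<lambda>x. q (pi - x)"
  have r: "edge_coeffs ?p ?q" by (rule edge_coeffs_reflect[OF c])
  then have pq: "continuous_on {0..pi} ?p" "?q absolutely_integrable_on {0..pi}" by (auto simp: edge_coeffs_def)
  have "sol_S p q (pi - t) lam = sol_S p q pi lam * sol_C ?p ?q t lam + (- deriv_S p q pi lam) * sol_S ?p ?q t lam"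
    by (rule edge_solution_unique(1)[OF pq edge_solution_reflect[OF sol_S_edge_solution(1)[OF c]]
        edge_solution_lincomb[OF sol_C_edge_solution(1)[OF r] sol_S_edge_solution(1)[OF r], of lam "sol_S p q pi lam" "- deriv_S p q pi lam"]])
      (use t sol_S_edge_solution[OF r] sol_C_edge_solution[OF r] in auto)
  then show ?thesis by simp
qed

text \<open>Let \<open>E\<close> be the cross product \<open>s \<kappa> - \<sigma> c\<close> of the solutions started at the vertex \<open>\<pi>\<close>, for a fixed
  position \<open>t\<close>. Equality of the Weyl functions gives \<open>key\<close>, which expresses \<open>E\<close> by quotients in which the
  growth \<open>exp (|Im \<lambda>| t)\<close> of \<open>s\<close>, \<open>\<sigma>\<close> and the growth \<open>exp (|Im \<lambda>| (\<pi> - t))\<close> of the solutions started at \<open>0\<close> are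
  balanced by the denominator. So \<open>E\<close> is of order \<open>1 / |\<lambda>|\<close> for \<open>|Im \<lambda>| \<ge> 1\<close>, while in the remaining strip
  boundedness is immediate.\<close>

lemma edge_uniqueness:
  assumes c: "edge_coeffs p q" and c': "edge_coeffs p' q'"
    and re: "Im (integral {0..pi} p) = 0" and re': "Im (integral {0..pi} p') = 0"
    and M: "\<And>lam. sol_S p q pi lam * deriv_S p' q' pi lam = sol_S p' q' pi lam * deriv_S p q pi lam"
  shows "\<forall>x\<in>{0..pi}. p x = p' x" and "\<exists>N. negligible N \<and> (\<forall>x\<in>{0<..<pi} - N. q x = q' x)"
proof -
  define pr qr pr' qr' where "pr = (\<lambda>x. p (pi - x))" and "qr = (\<lambda>x. q (pi - x))"
    and "pr' = (\<lambda>x. p' (pi - x))" and "qr' = (\<lambda>x. q' (pi - x))"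
  have r: "edge_coeffs pr qr" and r': "edge_coeffs pr' qr'"
    unfolding pr_def qr_def pr'_def qr'_def by (intro edge_coeffs_reflect c c')+
  have cross: "sol_S pr qr t lam * sol_C pr' qr' t lam = sol_S pr' qr' t lam * sol_C pr qr t lam"
    if t: "t \<in> {0..pi}" for t lam
  proof -
    define E where "E lam = sol_S pr qr t lam * sol_C pr' qr' t lam - sol_S pr' qr' t lam * sol_C pr qr t lam" for lam
    have Eh: "E holomorphic_on UNIV" unfolding E_def by (intro holomorphic_intros sol_holomorphic r r' t)
    have key: "sol_S p q pi z * sol_S p' q' pi z * E z =
       sol_S p q pi z * (sol_S pr qr t z * sol_S p' q' (pi - t) z) - sol_S p' q' pi z * (sol_S pr' qr' t z * sol_S p q (pi - t) z)" for z
    proof -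
      have "sol_S p q pi z * (sol_S pr qr t z * sol_S p' q' (pi - t) z) - sol_S p' q' pi z * (sol_S pr' qr' t z * sol_S p q (pi - t) z)
        = sol_S p q pi z * sol_S p' q' pi z * E z
          - sol_S pr qr t z * sol_S pr' qr' t z * (sol_S p q pi z * deriv_S p' q' pi z - sol_S p' q' pi z * deriv_S p q pi z)"
        unfolding sol_S_backward[OF c t, folded pr_def qr_def] sol_S_backward[OF c' t, folded pr'_def qr'_def] E_def
        by (simp add: algebra_simps)
      then show ?thesis using M[of z] by simp
    qed
    obtain R1 K1 where 1: "R1 > 0" "K1 > 0" "\<And>lam x. x\<in>{0..pi} \<Longrightarrow> R1 \<le> norm lam \<Longrightarrow> norm (lam * sol_S p q x lam) \<le> K1 * exp (\<bar>Im lam\<bar> * x)"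
      using sol_upper_bounds[OF c] by blast
    obtain R2 K2 where 2: "R2 > 0" "K2 > 0" "\<And>lam x. x\<in>{0..pi} \<Longrightarrow> R2 \<le> norm lam \<Longrightarrow> norm (lam * sol_S p' q' x lam) \<le> K2 * exp (\<bar>Im lam\<bar> * x)"
      using sol_upper_bounds[OF c'] by blast
    obtain R3 K3 where 3: "R3 > 0" "K3 > 0" "\<And>lam x. x\<in>{0..pi} \<Longrightarrow> R3 \<le> norm lam \<Longrightarrow>
      norm (lam * sol_S pr qr x lam) \<le> K3 * exp (\<bar>Im lam\<bar> * x) \<and> norm (sol_C pr qr x lam) \<le> K3 * exp (\<bar>Im lam\<bar> * x)"
      using sol_upper_bounds[OF r] by blast
    obtain R4 K4 where 4: "R4 > 0" "K4 > 0" "\<And>lam x. x\<in>{0..pi} \<Longrightarrow> R4 \<le> norm lam \<Longrightarrow>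
      norm (lam * sol_S pr' qr' x lam) \<le> K4 * exp (\<bar>Im lam\<bar> * x) \<and> norm (sol_C pr' qr' x lam) \<le> K4 * exp (\<bar>Im lam\<bar> * x)"
      using sol_upper_bounds[OF r'] by blast
    obtain R5 where 5: "R5 > 0" "\<And>lam. R5 \<le> norm lam \<Longrightarrow> \<bar>Im lam\<bar> \<ge> 1 \<Longrightarrow> norm (lam * sol_S p q pi lam) \<ge> exp (\<bar>Im lam\<bar> * pi) / 8"
      using sol_S_lower_bound[OF c re] by blast
    obtain R6 where 6: "R6 > 0" "\<And>lam. R6 \<le> norm lam \<Longrightarrow> \<bar>Im lam\<bar> \<ge> 1 \<Longrightarrow> norm (lam * sol_S p' q' pi lam) \<ge> exp (\<bar>Im lam\<bar> * pi) / 8"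
      using sol_S_lower_bound[OF c' re'] by blast
    define R where "R = R1 + R2 + R3 + R4 + R5 + R6 + 1"
    have Rge: "R \<ge> R1" "R \<ge> R2" "R \<ge> R3" "R \<ge> R4" "R \<ge> R5" "R \<ge> R6" "R \<ge> 1"
      using 1 2 3 4 5 6 by (auto simp: R_def)
    have t': "pi - t \<in> {0..pi}" using t by auto
    have far: "norm (E z) \<le> (8 * K3 * K2 + 8 * K4 * K1) / norm z" if z: "R \<le> norm z" "\<bar>Im z\<bar> \<ge> 1" for z
    proof -
      define e ex et where "e = exp (\<bar>Im z\<bar> * pi)" and "ex = exp (\<bar>Im z\<bar> * (pi - t))" and "et = exp (\<bar>Im z\<bar> * t)"
      have eee: "et * ex = e" by (simp add: e_def ex_def et_def exp_add[symmetric] algebra_simps)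
      have pos: "e > 0" "ex > 0" "et > 0" by (simp_all add: e_def ex_def et_def)
      have nz: "norm z > 0" using z Rge by linarith
      have LB: "norm (z * sol_S p q pi z) \<ge> e / 8" "norm (z * sol_S p' q' pi z) \<ge> e / 8"
        using 5(2)[of z] 6(2)[of z] z Rge by (auto simp: e_def)
      then have S0: "sol_S p q pi z \<noteq> 0" "sol_S p' q' pi z \<noteq> 0" using pos by auto
      have Rz: "R1 \<le> norm z" "R2 \<le> norm z" "R3 \<le> norm z" "R4 \<le> norm z" using z Rge by linarith+
      have u: "norm (z * sol_S p q (pi - t) z) \<le> K1 * ex" "norm (z * sol_S p' q' (pi - t) z) \<le> K2 * ex"
        "norm (z * sol_S pr qr t z) \<le> K3 * et" "norm (z * sol_S pr' qr' t z) \<le> K4 * et"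
        using 1(3)[OF t' Rz(1)] 2(3)[OF t' Rz(2)] 3(3)[OF t Rz(3)] 4(3)[OF t Rz(4)] unfolding ex_def et_def by simp_all
      have frac: "norm (a * b / d) \<le> 8 * Ka * Kb / norm z"
        if "norm (z * a) \<le> Ka * et" "norm (z * b) \<le> Kb * ex" "norm (z * d) \<ge> e / 8" "d \<noteq> 0" "Ka > 0" "Kb > 0" for a b d Ka Kb
      proof -
        have "norm (z * a) * norm (z * b) \<le> (Ka * et) * (Kb * ex)" using that pos by (intro mult_mono) auto
        also have "\<dots> = 8 * Ka * Kb * (e / 8)" unfolding eee[symmetric] by simp
        also have "\<dots> \<le> 8 * Ka * Kb * norm (z * d)" using that by (intro mult_left_mono) auto
        finally have "norm z * norm z * (norm a * norm b) \<le> norm z * (8 * Ka * Kb * norm d)" by (simp add: norm_mult mult_ac)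
        then have "norm z * (norm a * norm b) \<le> 8 * Ka * Kb * norm d" using nz by (simp only: mult.assoc mult_le_cancel_left_pos)
        then show ?thesis using nz that(4) by (simp add: norm_mult norm_divide field_simps)
      qed
      have Ez: "E z = sol_S pr qr t z * sol_S p' q' (pi - t) z / sol_S p' q' pi z - sol_S pr' qr' t z * sol_S p q (pi - t) z / sol_S p q pi z"
        using key[of z] S0 by (simp add: field_simps)
      have "norm (E z) \<le> norm (sol_S pr qr t z * sol_S p' q' (pi - t) z / sol_S p' q' pi z) + norm (sol_S pr' qr' t z * sol_S p q (pi - t) z / sol_S p q pi z)"
        unfolding Ez by (rule norm_triangle_ineq4)
      also have "\<dots> \<le> 8 * K3 * K2 / norm z + 8 * K4 * K1 / norm z"
      proof (rule add_mono)
        show "norm (sol_S pr qr t z * sol_S p' q' (pi - t) z / sol_S p' q' pi z) \<le> 8 * K3 * K2 / norm z"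
          by (rule frac[OF u(3) u(2) LB(2) S0(2) 3(2) 2(2)])
        show "norm (sol_S pr' qr' t z * sol_S p q (pi - t) z / sol_S p q pi z) \<le> 8 * K4 * K1 / norm z"
          by (rule frac[OF u(4) u(1) LB(1) S0(1) 4(2) 1(2)])
      qed
      finally show ?thesis by (simp add: add_divide_distrib)
    qed
    have strip: "norm (E z) \<le> 2 * K3 * K4 * (exp pi * exp pi)" if z: "R \<le> norm z" "\<bar>Im z\<bar> \<le> 1" for z
    proof -
      have ep: "exp (\<bar>Im z\<bar> * t) \<le> exp pi"
      proof -
        have "\<bar>Im z\<bar> * t \<le> 1 * pi" using z(2) t by (intro mult_mono) auto
        then show ?thesis by simp
      qed
      have nz: "norm z \<ge> 1" using z Rge by linarith
      have sb: "norm a \<le> Ka * exp pi" if "norm (z * a) \<le> Ka * exp (\<bar>Im z\<bar> * t)" "Ka > 0" for a Ka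
      proof -
        have "1 * norm a \<le> norm z * norm a" using nz by (intro mult_right_mono) auto
        also have "\<dots> \<le> Ka * exp (\<bar>Im z\<bar> * t)" using that(1) by (simp add: norm_mult)
        also have "\<dots> \<le> Ka * exp pi" using ep that(2) by (intro mult_left_mono) auto
        finally show ?thesis by simp
      qed
      have b: "norm (sol_S pr qr t z) \<le> K3 * exp pi" "norm (sol_S pr' qr' t z) \<le> K4 * exp pi"
        using sb[of "sol_S pr qr t z" K3] sb[of "sol_S pr' qr' t z" K4] 3(2) 3(3)[of t z] 4(2) 4(3)[of t z] t z Rge by auto
      have "norm (sol_C pr qr t z) \<le> K3 * exp (\<bar>Im z\<bar> * t)" "norm (sol_C pr' qr' t z) \<le> K4 * exp (\<bar>Im z\<bar> * t)"
        using 3(3)[of t z] 4(3)[of t z] t z Rge by auto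
      then have b2: "norm (sol_C pr qr t z) \<le> K3 * exp pi" "norm (sol_C pr' qr' t z) \<le> K4 * exp pi"
        using mult_left_mono[OF ep, of K3] mult_left_mono[OF ep, of K4] 3(2) 4(2) by linarith+
      have "norm (E z) \<le> norm (sol_S pr qr t z * sol_C pr' qr' t z) + norm (sol_S pr' qr' t z * sol_C pr qr t z)"
        unfolding E_def by (rule norm_triangle_ineq4)
      also have "\<dots> \<le> (K3 * exp pi) * (K4 * exp pi) + (K4 * exp pi) * (K3 * exp pi)"
        unfolding norm_mult using b b2 3(2) 4(2) by (intro add_mono mult_mono) auto
      also have "\<dots> = 2 * K3 * K4 * (exp pi * exp pi)" by (simp add: algebra_simps)
      finally show ?thesis .
    qed
    have "compact (E ` cball 0 R)"
      by (intro compact_continuous_image compact_cball holomorphic_on_imp_continuous_on holomorphic_on_subset[OF Eh]) auto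
    then have "bounded (E ` cball 0 R)" by (rule compact_imp_bounded)
    then obtain B where B: "\<forall>x\<in>E ` cball 0 R. norm x \<le> B" unfolding bounded_iff by (elim exE)
    define KK where "KK = 8 * K3 * K2 + 8 * K4 * K1"
    have KK: "KK > 0" using 1 2 3 4 by (simp add: KK_def add_pos_pos)
    have "bounded (range E)" unfolding bounded_iff
    proof (intro exI[of _ "max B (max KK (2 * K3 * K4 * (exp pi * exp pi)))"] ballI)
      fix w assume "w \<in> range E"
      then obtain z where w: "w = E z" by blast
      consider "norm z \<le> R" | "norm z \<ge> R" "\<bar>Im z\<bar> \<ge> 1" | "norm z \<ge> R" "\<bar>Im z\<bar> \<le> 1" by linarith
      then show "norm w \<le> max B (max KK (2 * K3 * K4 * (exp pi * exp pi)))"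
      proof cases
        case 1
        then have "norm w \<le> B" using B w by simp
        then show ?thesis by simp
      next
        case 2
        have "norm w \<le> KK / norm z" using far[OF 2] by (simp add: w KK_def)
        also have "\<dots> \<le> KK / 1" using 2 Rge KK by (intro divide_left_mono) auto
        finally show ?thesis by simp
      next
        case 3
        then show ?thesis using strip[OF 3] by (simp add: w)
      qed
    qed
    then have "E constant_on UNIV" by (rule Liouville_theorem[OF Eh])
    then obtain c0 where c0: "\<And>z. E z = c0" unfolding constant_on_def by fast
    have "norm c0 \<le> 0 + \<epsilon>" if "\<epsilon> > 0" for \<epsilon>
    proof -
      define T where "T = R + KK / \<epsilon>"
      have T: "T \<ge> R" "T \<ge> KK / \<epsilon>" "T > 0" using KK that Rge by (auto simp: T_def add_pos_nonneg)
      have "norm (E (\<i> * of_real T)) \<le> KK / norm (\<i> * complex_of_real T)"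
        unfolding KK_def by (rule far) (use T Rge in \<open>auto simp: norm_mult\<close>)
      also have "\<dots> = KK / T" using T(3) by (simp add: norm_mult)
      also have "\<dots> \<le> \<epsilon>" using T that by (simp add: field_simps)
      finally show ?thesis using c0 by simp
    qed
    then have "norm c0 \<le> 0" by (rule field_le_epsilon)
    then show ?thesis using c0[of lam] by (simp add: E_def)
  qed
  have ae: "\<exists>N. negligible N \<and> (\<forall>x\<in>{0<..<pi} - N. pot pr qr lam x = pot pr' qr' lam x)" for lam
  proof (rule potentials_equal_ae[OF sol_S_edge_solution(1)[OF r] sol_C_edge_solution(1)[OF r]
        sol_S_edge_solution(1)[OF r'] sol_C_edge_solution(1)[OF r']])
    fix x assume x: "x \<in> {0..pi}"
    show "sol_C pr qr x lam * deriv_S pr qr x lam - snd (ivp pr qr 1 0 lam) x * sol_S pr qr x lam = 1"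
      by (rule wronskian_C_S[OF r x])
    show "sol_C pr' qr' x lam * deriv_S pr' qr' x lam - snd (ivp pr' qr' 1 0 lam) x * sol_S pr' qr' x lam = 1"
      by (rule wronskian_C_S[OF r' x])
    show "sol_S pr qr x lam * sol_C pr' qr' x lam = sol_S pr' qr' x lam * sol_C pr qr x lam" by (rule cross[OF x])
  qed
  obtain N0 where N0: "negligible N0" "\<And>x. x\<in>{0<..<pi} - N0 \<Longrightarrow> pot pr qr 0 x = pot pr' qr' 0 x" using ae[of 0] by blast
  obtain N1 where N1: "negligible N1" "\<And>x. x\<in>{0<..<pi} - N1 \<Longrightarrow> pot pr qr 1 x = pot pr' qr' 1 x" using ae[of 1] by blast
  have qe: "qr x = qr' x" if "x\<in>{0<..<pi} - (N0 \<union> N1)" for x using N0(2)[of x] that by (simp add: pot_def)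
  have pe: "pr x = pr' x" if "x\<in>{0<..<pi} - (N0 \<union> N1)" for x
    using N1(2)[of x] qe[OF that] that by (simp add: pot_def)
  have N01: "negligible (N0 \<union> N1)" using N0(1) N1(1) by (rule negligible_Un)
  show "\<forall>x\<in>{0..pi}. p x = p' x"
  proof
    fix x assume "x \<in> {0..pi}"
    then have "pi - x \<in> {0..pi}" by auto
    moreover have "continuous_on {0..pi} pr" "continuous_on {0..pi} pr'" using r r' by (simp_all add: edge_coeffs_def)
    ultimately have "pr (pi - x) = pr' (pi - x)" by (intro continuous_eq_of_ae_eq[OF _ _ N01 pe])
    then show "p x = p' x" by (simp add: pr_def pr'_def)
  qed
  have "(\<lambda>x. pi - x) differentiable_on N0 \<union> N1" by (intro derivative_intros)
  then have "negligible ((\<lambda>x. pi - x) ` (N0 \<union> N1))"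
    by (rule negligible_differentiable_image_negligible[OF order_refl N01])
  moreover have "q x = q' x" if x: "x \<in> {0<..<pi} - (\<lambda>x. pi - x) ` (N0 \<union> N1)" for x
  proof -
    have "pi - x \<in> {0<..<pi} - (N0 \<union> N1)"
    proof -
      have "pi - x \<notin> N0 \<union> N1"
      proof
        assume "pi - x \<in> N0 \<union> N1"
        then have "pi - (pi - x) \<in> (\<lambda>x. pi - x) ` (N0 \<union> N1)" by (rule imageI)
        then show False using x by simp
      qed
      then show ?thesis using x by auto
    qed
    from qe[OF this] show ?thesis by (simp add: qr_def qr'_def)
  qed
  ultimately show "\<exists>N. negligible N \<and> (\<forall>x\<in>{0<..<pi} - N. q x = q' x)" by blast
qed

section \<open>Recovering the first edge of the graph\<close>

lemma ac_deriv_cong_ae: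
  assumes "ac_deriv a b f f'" "negligible M" "\<And>x. x \<in> {a<..<b} - M \<Longrightarrow> f' x = g' x"
  shows "ac_deriv a b f g'"
proof -
  from ac_derivE[OF assms(1)] obtain N where N: "abs_cont_on a b f" "negligible N"
    "\<And>x. x \<in> {a<..<b} - N \<Longrightarrow> (f has_vector_derivative f' x) (at x)" by blast
  show ?thesis unfolding ac_deriv_def
  proof (intro conjI exI[of _ "N \<union> M"] ballI N(1))
    show "negligible (N \<union> M)" using N(2) assms(2) by (rule negligible_Un)
    fix x assume "x \<in> {a<..<b} - (N \<union> M)"
    then show "(f has_vector_derivative g' x) (at x)" using N(3)[of x] assms(3)[of x] by auto
  qed
qed

text \<open>Data that agree in \<open>AC[0,\<pi>]\<close> and \<open>L(0,\<pi>)\<close> may differ as functions, but they have the same solutions, hence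
  the choice in \<open>ivp\<close> selects the same pair.\<close>

lemma ivp_cong:
  assumes p: "eq_AC p p'" and q: "eq_L q q'"
  shows "ivp p q = ivp p' q'"
proof -
  have S: "{0<..<pi} \<in> sets lebesgue" by simp
  obtain N where N: "negligible N" "\<And>x. x \<in> {0<..<pi} - N \<Longrightarrow> q x = q' x"
    using q unfolding eq_L_def AE_lebesgue_on_iff_negligible[OF S] by blast
  have pe: "p x = p' x" if "x \<in> {0<..<pi}" for x using p that by (auto simp: eq_AC_def)
  have "ac_deriv 0 pi dy (\<lambda>x. pot p q lam x * y x) \<longleftrightarrow> ac_deriv 0 pi dy (\<lambda>x. pot p' q' lam x * y x)" for lam y dy
  proof
    assume "ac_deriv 0 pi dy (\<lambda>x. pot p q lam x * y x)"
    then show "ac_deriv 0 pi dy (\<lambda>x. pot p' q' lam x * y x)"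
      by (rule ac_deriv_cong_ae[OF _ N(1)]) (simp add: N(2) pe pot_def)
  next
    assume "ac_deriv 0 pi dy (\<lambda>x. pot p' q' lam x * y x)"
    then show "ac_deriv 0 pi dy (\<lambda>x. pot p q lam x * y x)"
      by (rule ac_deriv_cong_ae[OF _ N(1)]) (simp add: N(2) pe pot_def)
  qed
  then have "edge_solution p q lam y dy \<longleftrightarrow> edge_solution p' q' lam y dy" for lam y dy
    by (simp only: edge_solution_iff_ac_deriv)
  then show ?thesis by (simp only: ivp_def fun_eq_iff) simp
qed

text \<open>The cofactors of \<open>S\<^sub>1'\<close> and of \<open>S\<^sub>1\<close> in the characteristic function: the contribution of the edges other than
  the first one.\<close>

definition rest_A :: "nat \<Rightarrow> (nat \<Rightarrow> real \<Rightarrow> complex) \<Rightarrow> (nat \<Rightarrow> real \<Rightarrow> complex) \<Rightarrow> complex \<Rightarrow> complex" where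
  "rest_A m p q z = (\<Prod>k\<in>{2..m}. sol_S (p k) (q k) pi z)"

definition rest_B :: "nat \<Rightarrow> (nat \<Rightarrow> real \<Rightarrow> complex) \<Rightarrow> (nat \<Rightarrow> real \<Rightarrow> complex) \<Rightarrow> complex \<Rightarrow> complex" where
  "rest_B m p q z = (\<Sum>j\<in>{2..m-1}. deriv_S (p j) (q j) pi z * (\<Prod>k\<in>{2..m} - {j}. sol_S (p k) (q k) pi z))
     + d_loop (p m) (q m) z * (\<Prod>k\<in>{2..m-1}. sol_S (p k) (q k) pi z)"

lemma char_fun_split:
  assumes "m \<ge> 2"
  shows "char_fun m p q z = deriv_S (p 1) (q 1) pi z * rest_A m p q z + sol_S (p 1) (q 1) pi z * rest_B m p q z"
proof -
  define s where "s k = sol_S (p k) (q k) pi z" for k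
  define d where "d k = deriv_S (p k) (q k) pi z" for k
  have s1: "{1..m-1} = insert 1 {2..m-1}" "{1..m} - {1} = {2..m}" using assms by auto
  have s2: "{1..m} - {j} = insert 1 ({2..m} - {j})" if "j \<in> {2..m-1}" for j using that assms by auto
  have "(\<Sum>j=1..m-1. d j * (\<Prod>k\<in>{1..m} - {j}. s k)) = d 1 * (\<Prod>k\<in>{2..m}. s k) + (\<Sum>j\<in>{2..m-1}. d j * (\<Prod>k\<in>{1..m} - {j}. s k))"
    unfolding s1(1) by (subst sum.insert) (auto simp: s1(2)[symmetric])
  also have "(\<Sum>j\<in>{2..m-1}. d j * (\<Prod>k\<in>{1..m} - {j}. s k)) = (\<Sum>j\<in>{2..m-1}. s 1 * (d j * (\<Prod>k\<in>{2..m} - {j}. s k)))"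
  proof (rule sum.cong)
    fix j assume "j \<in> {2..m-1}"
    from s2[OF this] show "d j * (\<Prod>k\<in>{1..m} - {j}. s k) = s 1 * (d j * (\<Prod>k\<in>{2..m} - {j}. s k))" by simp
  qed simp
  finally have A: "(\<Sum>j=1..m-1. d j * (\<Prod>k\<in>{1..m} - {j}. s k)) = d 1 * (\<Prod>k\<in>{2..m}. s k) + s 1 * (\<Sum>j\<in>{2..m-1}. d j * (\<Prod>k\<in>{2..m} - {j}. s k))"
    by (simp only: sum_distrib_left)
  have B: "(\<Prod>k=1..m-1. s k) = s 1 * (\<Prod>k\<in>{2..m-1}. s k)" unfolding s1(1) by (subst prod.insert) auto
  show ?thesis
    unfolding char_fun_def rest_A_def rest_B_def using A B unfolding s_def d_def by (simp add: algebra_simps)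
qed

lemma rest_holomorphic:
  assumes "coefficients m p q" "m \<ge> 2"
  shows "rest_A m p q holomorphic_on UNIV" "rest_B m p q holomorphic_on UNIV"
  unfolding rest_A_def[abs_def] rest_B_def[abs_def]
  by (intro holomorphic_intros sol_holomorphic d_loop_holomorphic coefficients_edge_coeffs[OF assms(1)]; use assms(2) in auto)+

text \<open>If no \<open>S\<^sub>j\<close>, \<open>j \<ge> 2\<close>, vanishes then \<open>A \<noteq> 0\<close>. If exactly \<open>S\<^sub>i\<close> vanishes, a single term of \<open>B\<close> survives: the
  loop term when \<open>i = m\<close>, and otherwise the one containing \<open>S\<^sub>i'\<close>, which is nonzero by the Wronskian
  identity.\<close>

lemma rest_not_both_zero:
  assumes c: "coefficients m p q" and m: "m \<ge> 2" and B: "assumption_B m p q \<Theta> \<Lambda>" and th: "\<theta> \<in> \<Theta>"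
  shows "rest_A m p q (\<Lambda> \<theta>) \<noteq> 0 \<or> rest_B m p q (\<Lambda> \<theta>) \<noteq> 0"
proof -
  obtain T1 T2 where T: "\<Theta> = T1 \<union> T2" "\<forall>\<theta>\<in>T1. \<forall>j\<in>{2..m}. sol_S (p j) (q j) pi (\<Lambda> \<theta>) \<noteq> 0"
    "\<forall>\<theta>\<in>T2. \<exists>i\<in>{2..m}. sol_S (p i) (q i) pi (\<Lambda> \<theta>) = 0 \<and>
           (\<forall>j\<in>{2..m} - {i}. sol_S (p j) (q j) pi (\<Lambda> \<theta>) \<noteq> 0) \<and>
           (i = m \<longrightarrow> d_loop (p m) (q m) (\<Lambda> \<theta>) \<noteq> 0)"
    using B unfolding assumption_B_def by (elim exE conjE)
  show ?thesis
  proof (cases "\<theta> \<in> T1")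
    case True
    then have "rest_A m p q (\<Lambda> \<theta>) \<noteq> 0" using T(2) by (auto simp: rest_A_def)
    then show ?thesis by blast
  next
    case False
    then have "\<theta> \<in> T2" using th T(1) by blast
    from bspec[OF T(3) this] obtain i where i: "i \<in> {2..m}" "sol_S (p i) (q i) pi (\<Lambda> \<theta>) = 0"
      "\<And>j. j \<in> {2..m} - {i} \<Longrightarrow> sol_S (p j) (q j) pi (\<Lambda> \<theta>) \<noteq> 0" "i = m \<Longrightarrow> d_loop (p m) (q m) (\<Lambda> \<theta>) \<noteq> 0" by blast
    have z: "(\<Prod>k\<in>K. sol_S (p k) (q k) pi (\<Lambda> \<theta>)) = 0" if "finite K" "i \<in> K" for K
      using that i(2) by (intro prod_zero) auto
    have nz: "(\<Prod>k\<in>K. sol_S (p k) (q k) pi (\<Lambda> \<theta>)) \<noteq> 0" if K: "K \<subseteq> {2..m} - {i}" for K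
    proof -
      have fin: "finite K" using K by (rule finite_subset) simp
      have "\<forall>k\<in>K. sol_S (p k) (q k) pi (\<Lambda> \<theta>) \<noteq> 0"
      proof
        fix k assume "k \<in> K"
        then show "sol_S (p k) (q k) pi (\<Lambda> \<theta>) \<noteq> 0" using K by (intro i(3)) (rule subsetD)
      qed
      then show ?thesis by (simp add: prod_zero_iff[OF fin])
    qed
    have z': "deriv_S (p j) (q j) pi (\<Lambda> \<theta>) * (\<Prod>k\<in>{2..m} - {j}. sol_S (p k) (q k) pi (\<Lambda> \<theta>)) = 0" if "j \<noteq> i" for j
    proof -
      have "i \<in> {2..m} - {j}" using i(1) that by simp
      then show ?thesis by (simp only: z[of "{2..m} - {j}"] finite_Diff finite_atLeastAtMost mult_zero_right)
    qed
    show ?thesis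
    proof (cases "i = m")
      case True
      have "(\<Sum>j\<in>{2..m-1}. deriv_S (p j) (q j) pi (\<Lambda> \<theta>) * (\<Prod>k\<in>{2..m} - {j}. sol_S (p k) (q k) pi (\<Lambda> \<theta>))) = 0"
      proof (rule sum.neutral, intro ballI)
        fix j assume "j \<in> {2..m-1}"
        then have "j \<noteq> i" using True by auto
        then show "deriv_S (p j) (q j) pi (\<Lambda> \<theta>) * (\<Prod>k\<in>{2..m} - {j}. sol_S (p k) (q k) pi (\<Lambda> \<theta>)) = 0" by (rule z')
      qed
      moreover have "(\<Prod>k\<in>{2..m-1}. sol_S (p k) (q k) pi (\<Lambda> \<theta>)) \<noteq> 0" by (rule nz) (use True m in auto)
      ultimately show ?thesis using i(4)[OF True] by (simp add: rest_B_def)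
    next
      case False
      then have im: "i \<in> {2..m-1}" using i(1) by auto
      have ic: "i \<in> {1..m}" using i(1) by auto
      have "(\<Sum>j\<in>{2..m-1}. deriv_S (p j) (q j) pi (\<Lambda> \<theta>) * (\<Prod>k\<in>{2..m} - {j}. sol_S (p k) (q k) pi (\<Lambda> \<theta>)))
         = deriv_S (p i) (q i) pi (\<Lambda> \<theta>) * (\<Prod>k\<in>{2..m} - {i}. sol_S (p k) (q k) pi (\<Lambda> \<theta>))"
      proof -
        have "(\<Sum>j\<in>{2..m-1} - {i}. deriv_S (p j) (q j) pi (\<Lambda> \<theta>) * (\<Prod>k\<in>{2..m} - {j}. sol_S (p k) (q k) pi (\<Lambda> \<theta>))) = 0"
          by (rule sum.neutral, intro ballI, rule z') simp
        then show ?thesis by (simp only: sum.remove[OF finite_atLeastAtMost im] add_0_right)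
      qed
      moreover have "deriv_S (p i) (q i) pi (\<Lambda> \<theta>) \<noteq> 0"
        using wronskian_C_S[OF coefficients_edge_coeffs[OF c ic], of pi "\<Lambda> \<theta>"] i(2) by auto
      moreover have "(\<Prod>k\<in>{2..m} - {i}. sol_S (p k) (q k) pi (\<Lambda> \<theta>)) \<noteq> 0" by (rule nz) auto
      moreover have "(\<Prod>k\<in>{2..m-1}. sol_S (p k) (q k) pi (\<Lambda> \<theta>)) = 0" by (rule z) (use im in auto)
      ultimately show ?thesis by (simp only: rest_B_def mult_zero_right add_0_right mult_eq_0_iff) blast
    qed
  qed
qed

text \<open>Enlarging the constant absorbs the finitely many indices not covered by the asymptotic estimate.\<close>

lemma four_sequence_bound:
  fixes \<beta> :: "nat \<Rightarrow> real"
  assumes "\<And>k. k \<in> {1..4} \<Longrightarrow> (\<lambda>n::int. \<Lambda> (n, k) - (2 * of_int n + of_real (\<beta> k)))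
           \<in> O[sup at_top at_bot](\<lambda>n. complex_of_real (1 / real_of_int \<bar>n\<bar>))"
  shows "\<exists>C. \<forall>n. \<forall>k\<in>{1..4::nat}. norm (\<Lambda> (n,k) - (2 * of_int n + of_real (\<beta> k))) \<le> C / (real_of_int \<bar>n\<bar> + 1)"
proof -
  have "\<exists>C\<ge>0. \<forall>n. norm (\<Lambda> (n,k) - (2 * of_int n + of_real (\<beta> k))) \<le> C / (real_of_int \<bar>n\<bar> + 1)" if k: "k \<in> {1..4}" for k
  proof -
    define f where "f n = \<Lambda> (n,k) - (2 * of_int n + of_real (\<beta> k))" for n :: int
    have "f \<in> O[sup at_top at_bot](\<lambda>n. complex_of_real (1 / real_of_int \<bar>n\<bar>))"
      using assms[OF k] unfolding f_def .
    then obtain c where c: "c > 0" "\<forall>\<^sub>F n in sup at_top at_bot. norm (f n) \<le> c * norm (complex_of_real (1 / real_of_int \<bar>n\<bar>))"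
      by (rule landau_o.bigE)
    then obtain N1 N2 where N: "\<And>n. n \<ge> N1 \<Longrightarrow> norm (f n) \<le> c * norm (complex_of_real (1 / real_of_int \<bar>n\<bar>))"
      "\<And>n. n \<le> N2 \<Longrightarrow> norm (f n) \<le> c * norm (complex_of_real (1 / real_of_int \<bar>n\<bar>))"
      unfolding eventually_sup eventually_at_top_linorder eventually_at_bot_linorder by blast
    define N where "N = \<bar>N1\<bar> + \<bar>N2\<bar> + 1"
    define M where "M = (\<Sum>n\<in>{-N..N}. norm (f n) * (real_of_int \<bar>n\<bar> + 1))"
    have M0: "M \<ge> 0" unfolding M_def by (intro sum_nonneg) auto
    show ?thesis
    proof (intro exI[of _ "2 * c + M"] conjI allI)
      show "2 * c + M \<ge> 0" using c(1) M0 by simp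
      fix n :: int
      have "norm (f n) * (real_of_int \<bar>n\<bar> + 1) \<le> 2 * c + M"
      proof (cases "n \<in> {-N..N}")
        case True
        have "norm (f n) * (real_of_int \<bar>n\<bar> + 1) \<le> M" unfolding M_def by (rule member_le_sum[OF True]) auto
        then show ?thesis using c(1) by simp
      next
        case False
        then have "n \<ge> N1 \<or> n \<le> N2" "\<bar>n\<bar> \<ge> 1" by (auto simp: N_def)
        then have "norm (f n) \<le> c * norm (complex_of_real (1 / real_of_int \<bar>n\<bar>))" using N by blast
        then have "norm (f n) \<le> c / real_of_int \<bar>n\<bar>" by (simp add: norm_divide)
        then have "norm (f n) * (real_of_int \<bar>n\<bar> + 1) \<le> c / real_of_int \<bar>n\<bar> * (real_of_int \<bar>n\<bar> + 1)"
          by (rule mult_right_mono) simp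
        also have "\<dots> \<le> c / real_of_int \<bar>n\<bar> * (2 * real_of_int \<bar>n\<bar>)"
          using \<open>\<bar>n\<bar> \<ge> 1\<close> c(1) by (intro mult_left_mono) auto
        also have "\<dots> = 2 * c" using \<open>\<bar>n\<bar> \<ge> 1\<close> by simp
        finally show ?thesis using M0 by simp
      qed
      then show "norm (\<Lambda> (n,k) - (2 * of_int n + of_real (\<beta> k))) \<le> (2 * c + M) / (real_of_int \<bar>n\<bar> + 1)"
        unfolding f_def by (subst pos_le_divide_eq) auto
    qed
  qed
  then have "\<forall>k\<in>{1..4}. \<exists>C. C \<ge> 0 \<and> (\<forall>n. norm (\<Lambda> (n,k) - (2 * of_int n + of_real (\<beta> k))) \<le> C / (real_of_int \<bar>n\<bar> + 1))" by blast
  from bchoice[OF this] obtain C where C: "\<And>k. k \<in> {1..4} \<Longrightarrow> C k \<ge> 0"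
    "\<And>k n. k \<in> {1..4} \<Longrightarrow> norm (\<Lambda> (n,k) - (2 * of_int n + of_real (\<beta> k))) \<le> C k / (real_of_int \<bar>n\<bar> + 1)" by blast
  show ?thesis
  proof (intro exI[of _ "\<Sum>k\<in>{1..4}. C k"] allI ballI)
    fix n :: int and k :: nat assume k: "k \<in> {1..4}"
    have "C k \<le> (\<Sum>k\<in>{1..4}. C k)" by (rule member_le_sum[OF k]) (use C(1) in auto)
    then have "C k / (real_of_int \<bar>n\<bar> + 1) \<le> (\<Sum>k\<in>{1..4}. C k) / (real_of_int \<bar>n\<bar> + 1)" by (rule divide_right_mono) simp
    then show "norm (\<Lambda> (n,k) - (2 * of_int n + of_real (\<beta> k))) \<le> (\<Sum>k\<in>{1..4}. C k) / (real_of_int \<bar>n\<bar> + 1)"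
      using C(2)[OF k, of n] by linarith
  qed
qed

text \<open>Only the data of the first edge may differ between the two problems. This form serves twice: for the
  given pair of problems, and for comparing an arbitrary solution of the inverse problem with the given
  first edge.\<close>

lemma first_edge_unique:
  fixes m :: nat
    and p q p' q' :: "nat \<Rightarrow> real \<Rightarrow> complex"
    and \<Lambda> :: "int \<times> nat \<Rightarrow> complex"
  assumes m: "m \<ge> 2"
    and c: "coefficients m p q" and c': "coefficients m p' q'"
    and pe: "\<And>j. j \<in> {2..m} \<Longrightarrow> eq_AC (p j) (p' j)"
    and qe: "\<And>j. j \<in> {2..m} \<Longrightarrow> eq_L (q j) (q' j)"
    and sub: "subspectrum m p q \<Theta> \<Lambda>" and sub': "subspectrum m p' q' \<Theta> \<Lambda>"
    and four: "four_sequence_form m p \<Theta> \<Lambda>"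
    and A: "alpha p 1 \<in> \<real>" and A': "alpha p' 1 \<in> \<real>"
    and B: "assumption_B m p q \<Theta> \<Lambda>"
  shows "eq_AC (p 1) (p' 1) \<and> eq_L (q 1) (q' 1)"
proof -
  have e1: "edge_coeffs (p 1) (q 1)" and e1': "edge_coeffs (p' 1) (q' 1)"
    using coefficients_edge_coeffs[OF c, of 1] coefficients_edge_coeffs[OF c', of 1] m by auto
  have re: "Im (integral {0..pi} (p 1)) = 0" "Im (integral {0..pi} (p' 1)) = 0"
    using A A' by (auto simp: alpha_def complex_is_Real_iff)
  have iv: "ivp (p j) (q j) = ivp (p' j) (q' j)" if "j \<in> {2..m}" for j by (rule ivp_cong[OF pe[OF that] qe[OF that]])
  have mm: "m \<in> {2..m}" using m by simp
  have rA: "rest_A m p' q' = rest_A m p q"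
    unfolding rest_A_def[abs_def] by (intro ext prod.cong) (use iv in \<open>auto simp: sol_S_def\<close>)
  have rB: "rest_B m p' q' = rest_B m p q"
    unfolding rest_B_def[abs_def]
    by (intro ext arg_cong2[where f="(+)"] arg_cong2[where f="(*)"] sum.cong prod.cong refl)
      (use iv mm in \<open>auto simp: sol_S_def deriv_S_def d_loop_def sol_C_def\<close>)
  define S dS S' dS' where "S = sol_S (p 1) (q 1) pi" and "dS = deriv_S (p 1) (q 1) pi"
    and "S' = sol_S (p' 1) (q' 1) pi" and "dS' = deriv_S (p' 1) (q' 1) pi"
  define D where "D z = S z * dS' z - S' z * dS z" for z
  have hol: "S holomorphic_on UNIV" "dS holomorphic_on UNIV" "S' holomorphic_on UNIV" "dS' holomorphic_on UNIV"
    using sol_holomorphic[OF e1, of pi] sol_holomorphic[OF e1', of pi] by (auto simp: S_def dS_def S'_def dS'_def)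
  have Dh: "D holomorphic_on UNIV" unfolding D_def by (intro holomorphic_intros hol)
  define X Y where "X = rest_A m p q" and "Y = rest_B m p q"
  define F F' where "F = char_fun m p q" and "F' = char_fun m p' q'"
  have Feq: "F z = dS z * X z + S z * Y z" and Feq': "F' z = dS' z * X z + S' z * Y z" for z
    using char_fun_split[OF m, of p q z] char_fun_split[OF m, of p' q' z]
    by (simp_all add: F_def F'_def X_def Y_def rA rB S_def dS_def S'_def dS'_def)
  have DX: "D z * X z = S z * F' z - S' z * F z" and DY: "D z * Y z = dS' z * F z - dS z * F' z" for z
    by (simp_all add: D_def Feq Feq' algebra_simps)
  \<comment> \<open>the order of vanishing of both characteristic functions passes to \<open>D A\<close> and \<open>D B\<close>, and thence to \<open>D\<close>\<close>
  have ord: "\<exists>C. \<forall>\<^sub>F z in at (\<Lambda> \<theta>). norm (D z) \<le> C * norm (z - \<Lambda> \<theta>) ^ card {\<tau>\<in>\<Theta>. \<Lambda> \<tau> = \<Lambda> \<theta>}"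
    if th: "\<theta> \<in> \<Theta>" for \<theta>
  proof -
    define n v where "n = card {\<tau>\<in>\<Theta>. \<Lambda> \<tau> = \<Lambda> \<theta>}" and "v = \<Lambda> \<theta>"
    have "int n \<le> zorder F v" "int n \<le> zorder F' v"
      using sub sub' th unfolding subspectrum_def n_def v_def F_def F'_def by blast+
    then obtain C1 C2 where C: "\<forall>\<^sub>F z in at v. norm (F z) \<le> C1 * norm (z - v) ^ n" "\<forall>\<^sub>F z in at v. norm (F' z) \<le> C2 * norm (z - v) ^ n"
      using zorder_bound[of F n v] zorder_bound[of F' n v] char_fun_holomorphic[OF c] char_fun_holomorphic[OF c']
        char_fun_not_identically_zero[OF c] char_fun_not_identically_zero[OF c'] m unfolding F_def F'_def by auto
    have comb: "\<exists>C. \<forall>\<^sub>F z in at v. norm (g z * F' z - h z * F z) \<le> C * norm (z - v) ^ n"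
      if g: "g holomorphic_on UNIV" and h: "h holomorphic_on UNIV" for g h
    proof -
      have bd: "\<forall>\<^sub>F z in at v. norm (f z) \<le> norm (f v) + 1" if "f holomorphic_on UNIV" for f :: "complex \<Rightarrow> complex"
      proof -
        have "isCont f v" using holomorphic_on_imp_continuous_on[OF that] by (simp add: continuous_on_eq_continuous_at)
        then have "((\<lambda>z. norm (f z)) \<longlongrightarrow> norm (f v)) (at v)" by (intro tendsto_norm) (simp add: isCont_def)
        then have "\<forall>\<^sub>F z in at v. norm (f z) < norm (f v) + 1" by (rule order_tendstoD) simp
        then show ?thesis by (rule eventually_mono) simp
      qed
      have "\<forall>\<^sub>F z in at v. norm (g z * F' z - h z * F z) \<le> ((norm (g v) + 1) * C2 + (norm (h v) + 1) * C1) * norm (z - v) ^ n"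
        using C(1) C(2) bd[OF g] bd[OF h]
      proof eventually_elim
        case (elim z)
        have "norm (g z * F' z - h z * F z) \<le> norm (g z) * norm (F' z) + norm (h z) * norm (F z)"
          using norm_triangle_ineq4[of "g z * F' z" "h z * F z"] by (simp add: norm_mult)
        also have "\<dots> \<le> (norm (g v) + 1) * (C2 * norm (z - v) ^ n) + (norm (h v) + 1) * (C1 * norm (z - v) ^ n)"
          using elim by (intro add_mono mult_mono) auto
        finally show ?case by (simp add: algebra_simps)
      qed
      then show ?thesis by blast
    qed
    obtain CX where CX: "\<forall>\<^sub>F z in at v. norm (D z * X z) \<le> CX * norm (z - v) ^ n"
      using comb[OF hol(1,3)] unfolding DX by blast
    obtain CY where "\<forall>\<^sub>F z in at v. norm (dS z * F' z - dS' z * F z) \<le> CY * norm (z - v) ^ n"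
      using comb[OF hol(2,4)] by blast
    then have CY: "\<forall>\<^sub>F z in at v. norm (D z * Y z) \<le> CY * norm (z - v) ^ n"
      unfolding DY by (simp add: norm_minus_commute)
    have "X v \<noteq> 0 \<or> Y v \<noteq> 0" using rest_not_both_zero[OF c m B th] by (simp add: X_def Y_def v_def)
    then show ?thesis
      using order_bound_cancel[OF _ _ CX] order_bound_cancel[OF _ _ CY] rest_holomorphic[OF c m]
      unfolding n_def v_def X_def Y_def by blast
  qed
  obtain \<beta> :: "nat \<Rightarrow> real" where Th: "\<Theta> = four_index_set" and \<beta>: "\<forall>k\<in>{1..4}. \<beta> k \<in> {-1<..<1}"
    and asy: "\<forall>k\<in>{1..4}. (\<lambda>n::int. \<Lambda> (n, k) - (2 * of_int n + of_real (\<beta> k)))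
           \<in> O[sup at_top at_bot](\<lambda>n. complex_of_real (1 / real_of_int \<bar>n\<bar>))"
    using four unfolding four_sequence_form_def by (elim exE conjE)
  obtain C where C: "\<And>n k. k \<in> {1..4::nat} \<Longrightarrow> norm (\<Lambda> (n,k) - (2 * of_int n + of_real (\<beta> k))) \<le> C / (real_of_int \<bar>n\<bar> + 1)"
    using four_sequence_bound[OF bspec[OF asy]] by blast
  obtain K where K: "\<And>\<epsilon>. \<epsilon> > 0 \<Longrightarrow> \<exists>R. \<forall>z. norm z \<ge> R \<longrightarrow> norm (z * D z) \<le> K + \<epsilon> * exp (2 * pi * \<bar>Im z\<bar>)"
    using cross_growth[OF e1 e1' re] unfolding D_def S_def dS_def S'_def dS'_def by blast
  have D0: "D z = 0" for z
  proof (rule entire_zero_if_too_many_zeros[OF Dh _ _ _ K])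
    show "\<bar>\<beta> k\<bar> < 1" if "k \<in> {1..4}" for k using \<beta> that by (auto simp: abs_less_iff)
    show "norm (\<Lambda> (n,k) - (2 * of_int n + of_real (\<beta> k))) \<le> C / (real_of_int \<bar>n\<bar> + 1)" if "(n,k) \<in> four_index_set" for n k
      by (rule C) (use that in \<open>auto simp: four_index_set_def\<close>)
    show "\<exists>g. g holomorphic_on UNIV \<and> (\<forall>z. D z = g z * (\<Prod>i\<in>I. z - \<Lambda> i))" if I: "finite I" "I \<subseteq> four_index_set" for I
    proof (rule entire_divide_family[OF I(1) Dh])
      fix i assume i: "i \<in> I"
      then have iT: "i \<in> \<Theta>" using I(2) Th by blast
      obtain C where C: "\<forall>\<^sub>F z in at (\<Lambda> i). norm (D z) \<le> C * norm (z - \<Lambda> i) ^ card {\<tau>\<in>\<Theta>. \<Lambda> \<tau> = \<Lambda> i}"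
        using ord[OF iT] by blast
      have fin: "finite {\<tau>\<in>\<Theta>. \<Lambda> \<tau> = \<Lambda> i}" using sub iT unfolding subspectrum_def by blast
      have le: "card {j\<in>I. \<Lambda> j = \<Lambda> i} \<le> card {\<tau>\<in>\<Theta>. \<Lambda> \<tau> = \<Lambda> i}"
        by (rule card_mono[OF fin]) (use I(2) Th in auto)
      have "\<forall>\<^sub>F z in at (\<Lambda> i). norm (D z) \<le> \<bar>C\<bar> * norm (z - \<Lambda> i) ^ card {j\<in>I. \<Lambda> j = \<Lambda> i}"
        using C eventually_at_norm_diff_le_1
      proof eventually_elim
        case (elim z)
        have "norm (D z) \<le> \<bar>C\<bar> * norm (z - \<Lambda> i) ^ card {\<tau>\<in>\<Theta>. \<Lambda> \<tau> = \<Lambda> i}"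
          using elim(1) mult_right_mono[OF abs_ge_self[of C], of "norm (z - \<Lambda> i) ^ card {\<tau>\<in>\<Theta>. \<Lambda> \<tau> = \<Lambda> i}"] by simp
        also have "\<dots> \<le> \<bar>C\<bar> * norm (z - \<Lambda> i) ^ card {j\<in>I. \<Lambda> j = \<Lambda> i}"
          by (intro mult_left_mono power_decreasing le elim(2)) auto
        finally show ?case .
      qed
      then show "\<exists>C. \<forall>\<^sub>F z in at (\<Lambda> i). norm (D z) \<le> C * norm (z - \<Lambda> i) ^ card {j\<in>I. \<Lambda> j = \<Lambda> i}" by blast
    qed
  qed
  have M: "sol_S (p 1) (q 1) pi lam * deriv_S (p' 1) (q' 1) pi lam = sol_S (p' 1) (q' 1) pi lam * deriv_S (p 1) (q 1) pi lam" for lam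
    using D0[of lam] by (simp add: D_def S_def dS_def S'_def dS'_def)
  have "{0<..<pi} \<in> sets lebesgue" by simp
  from edge_uniqueness[OF e1 e1' re M] show ?thesis
    by (simp add: eq_AC_def eq_L_def AE_lebesgue_on_iff_negligible)
qed

theorem theorem2:
  fixes m :: nat
    and p q p' q' :: "nat \<Rightarrow> real \<Rightarrow> complex"
    and \<Theta> \<Theta>' :: "(int \<times> nat) set"
    and \<Lambda> \<Lambda>' :: "int \<times> nat \<Rightarrow> complex"
  assumes "m \<ge> 2"
    and "coefficients m p q" and "coefficients m p' q'"
    and "\<And>j. j \<in> {2..m} \<Longrightarrow> eq_AC (p j) (p' j)"
    and "\<And>j. j \<in> {2..m} \<Longrightarrow> eq_L (q j) (q' j)"
    and "subspectrum m p q \<Theta> \<Lambda>" and "subspectrum m p' q' \<Theta>' \<Lambda>'"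
    and "four_sequence_form m p \<Theta> \<Lambda>"
    and "\<Theta> = \<Theta>'" and "\<And>\<theta>. \<theta> \<in> \<Theta> \<Longrightarrow> \<Lambda> \<theta> = \<Lambda>' \<theta>"
    and "assumption_A m p" and "assumption_A m p'"
    and "assumption_B m p q \<Theta> \<Lambda>" and "assumption_B m p' q' \<Theta>' \<Lambda>'"
  shows "eq_AC (p 1) (p' 1) \<and> eq_L (q 1) (q' 1) \<and>
    (\<exists>p1 q1. inverse_solution m p q \<Theta> \<Lambda> p1 q1 \<and>
       (\<forall>p2 q2. inverse_solution m p q \<Theta> \<Lambda> p2 q2 \<longrightarrow> eq_AC p1 p2 \<and> eq_L q1 q2))"
proof -
  have one: "1 \<in> {1..m}" using assms(1) by simp
  have A1: "alpha p 1 \<in> \<real>" "alpha p' 1 \<in> \<real>" using assms(11,12) one by (auto simp: assumption_A_def)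
  have "{\<tau>\<in>\<Theta>. \<Lambda> \<tau> = \<Lambda> \<theta>} = {\<tau>\<in>\<Theta>'. \<Lambda>' \<tau> = \<Lambda>' \<theta>}" if "\<theta> \<in> \<Theta>" for \<theta>
    using assms(9,10) that by auto
  \<comment> \<open>\<open>\<Lambda>\<close> and \<open>\<Lambda>'\<close> agree on \<open>\<Theta>\<close> only, so multiplicities have to be compared\<close>
  then have sub': "subspectrum m p' q' \<Theta> \<Lambda>" using assms(7,9,10) by (simp add: subspectrum_def)
  have first: "eq_AC (p 1) (p' 1) \<and> eq_L (q 1) (q' 1)"
    by (rule first_edge_unique[OF assms(1,2,3,4,5,6) sub' assms(8) A1 assms(13)])
  have "inverse_solution m p q \<Theta> \<Lambda> (p 1) (q 1)"
    using assms(2,6,11,13) by (simp add: inverse_solution_def)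
  moreover have "eq_AC (p 1) p2 \<and> eq_L (q 1) q2" if inv: "inverse_solution m p q \<Theta> \<Lambda> p2 q2" for p2 q2
  proof -
    have i: "coefficients m (p(1 := p2)) (q(1 := q2))" "subspectrum m (p(1 := p2)) (q(1 := q2)) \<Theta> \<Lambda>"
      "assumption_A m (p(1 := p2))" using inv by (auto simp: inverse_solution_def)
    have "eq_AC (p 1) ((p(1 := p2)) 1) \<and> eq_L (q 1) ((q(1 := q2)) 1)"
    proof (rule first_edge_unique[OF assms(1,2) i(1) _ _ assms(6) i(2) assms(8) A1(1) _ assms(13)])
      show "alpha (p(1 := p2)) 1 \<in> \<real>" using i(3) one by (auto simp: assumption_A_def)
    qed (auto simp: eq_AC_def eq_L_def)
    then show ?thesis by simp
  qed
  ultimately show ?thesis using first by blast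
qed

end
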